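(* Let $K$ be a field of characteristic zero, let $\mathbf{T}$ be a neutral Tannakian category over $K$, let $A$ and $B$ be nonzero objects of $\mathbf{T}$, and let $$0\to B\to E\to A\to 0$$ be a short exact sequence in $\mathbf{T}$. Suppose that $\mathbf{T}$ is a filtered Tannakian category with filtration $W_\bullet$, and suppose moreover that at least one of the following conditions holds: (i) the associated graded object $Gr^W E$ is semisimple and there are no nonzero morphisms $Gr^W A\to Gr^W B$ in $\mathbf{T}$; (ii) the sets of weights of $A$ and $B$ are disjoint. Let $\mathcal{E}\in Ext^1_{\mathbf{T}}(\mathbb{1},Hom(A,B))$ be the class corresponding to the given extension under the canonical isomorphism $Ext^1_{\mathbf{T}}(A,B)\cong Ext^1_{\mathbf{T}}(\mathbb{1},Hom(A,B))$. If $\mathcal{E}$ is totally nonsplit, then the image of the algebra homomorphism $$\Omega: End_{\mathbf{T}}(E;B)\to End_{\mathbf{T}}(B)\times End_{\mathbf{T}}(A),\qquad \phi\mapsto(\phi_B,\phi_A),$$ is equal to the diagonal copy of $K$, that is, to $\{(a\cdot Id_B,\,a\cdot Id_A): a\in K\}$.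
   Context: $End_{\mathbf{T}}(X)$ is the endomorphism algebra of an object $X$ of $\mathbf{T}$. For a subobject $Y\subset X$, $End_{\mathbf{T}}(X;Y)$ is the subalgebra of those endomorphisms of $X$ that map $Y$ to $Y$. Given the exact sequence $0\to B\to E\to A\to 0$ and $\phi\in End_{\mathbf{T}}(E;B)$, $\phi_B$ is the restriction of $\phi$ to $B$ and $\phi_A$ is the endomorphism of $A\cong E/B$ induced by $\phi$. $\mathbb{1}$ is the unit object, $Hom(A,B)$ is the internal Hom object, and $Ext^1_{\mathbf{T}}$ is the $Ext^1$ group in $\mathbf{T}$. The class $\mathcal{E}\in Ext^1_{\mathbf{T}}(\mathbb{1},Hom(A,B))$ is called totally nonsplit if for every proper subobject $C\subsetneq Hom(A,B)$ the pushforward of $\mathcal{E}$ along the quotient map $Hom(A,B)\to Hom(A,B)/C$ is a nonsplit extension. A filtered Tannakian category is a Tannakian category equipped with a filtration $W_\bullet$ (the weight filtration) similar to the weight filtration on mixed motives: each object $X$ has a filtration by subobjects $W_nX$, $n\in\mathbb{Z}$, which is functorial in $X$, increasing, finite on every object ($W_nX=0$ for $n\ll0$ and $W_nX=X$ for $n\gg0$), exact (each $W_n$ is an exact functor), and respects the tensor structure ($W_n(X\otimes Y)=\sum_{p+q=n}W_pX\otimes W_qY$). The weights of $X$ are the integers $n$ with $W_nX/W_{n-1}X\neq0$. The associated graded is $Gr^WX:=\bigoplus_n W_nX/W_{n-1}X$. *)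

theory Defs
  imports Complex_Main
begin

section \<open>Categories\<close>

record ('o, 'm) category =
  Ob :: "'o set"
  Arr :: "'m set"
  Dom :: "'m \<Rightarrow> 'o"
  Cod :: "'m \<Rightarrow> 'o"
  Ide :: "'o \<Rightarrow> 'm"
  Comp :: "'m \<Rightarrow> 'm \<Rightarrow> 'm"  (infixr \<open>\<cdot>\<index>\<close> 75)

definition Mor :: "('o, 'm, 'z) category_scheme \<Rightarrow> 'o \<Rightarrow> 'o \<Rightarrow> 'm set" where
  "Mor C X Y = {f \<in> Arr C. Dom C f = X \<and> Cod C f = Y}"

locale category =
  fixes C :: "('o, 'm, 'z) category_scheme" (structure)
  assumes Dom_in_Ob: "f \<in> Arr C \<Longrightarrow> Dom C f \<in> Ob C"
    and Cod_in_Ob: "f \<in> Arr C \<Longrightarrow> Cod C f \<in> Ob C"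
    and Ide_in_Mor: "X \<in> Ob C \<Longrightarrow> Ide C X \<in> Mor C X X"
    and Comp_in_Mor: "\<lbrakk>f \<in> Mor C X Y; g \<in> Mor C Y Z\<rbrakk> \<Longrightarrow> g \<cdot> f \<in> Mor C X Z"
    and Comp_assoc: "\<lbrakk>f \<in> Mor C X Y; g \<in> Mor C Y Z; h \<in> Mor C Z V\<rbrakk>
      \<Longrightarrow> (h \<cdot> g) \<cdot> f = h \<cdot> (g \<cdot> f)"
    and Comp_Ide_left: "f \<in> Mor C X Y \<Longrightarrow> Ide C Y \<cdot> f = f"
    and Comp_Ide_right: "f \<in> Mor C X Y \<Longrightarrow> f \<cdot> Ide C X = f"

definition is_inverse :: "('o, 'm, 'z) category_scheme \<Rightarrow> 'm \<Rightarrow> 'm \<Rightarrow> bool" where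
  "is_inverse C f g \<longleftrightarrow> f \<in> Arr C \<and> g \<in> Mor C (Cod C f) (Dom C f) \<and>
     g \<cdot>\<^bsub>C\<^esub> f = Ide C (Dom C f) \<and> f \<cdot>\<^bsub>C\<^esub> g = Ide C (Cod C f)"

definition is_iso :: "('o, 'm, 'z) category_scheme \<Rightarrow> 'm \<Rightarrow> bool" where
  "is_iso C f \<longleftrightarrow> (\<exists>g. is_inverse C f g)"

definition is_mono :: "('o, 'm, 'z) category_scheme \<Rightarrow> 'm \<Rightarrow> bool" where
  "is_mono C f \<longleftrightarrow> f \<in> Arr C \<and>
     (\<forall>Z. \<forall>g \<in> Mor C Z (Dom C f). \<forall>h \<in> Mor C Z (Dom C f). f \<cdot>\<^bsub>C\<^esub> g = f \<cdot>\<^bsub>C\<^esub> h \<longrightarrow> g = h)"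

definition is_epi :: "('o, 'm, 'z) category_scheme \<Rightarrow> 'm \<Rightarrow> bool" where
  "is_epi C f \<longleftrightarrow> f \<in> Arr C \<and>
     (\<forall>Z. \<forall>g \<in> Mor C (Cod C f) Z. \<forall>h \<in> Mor C (Cod C f) Z. g \<cdot>\<^bsub>C\<^esub> f = h \<cdot>\<^bsub>C\<^esub> f \<longrightarrow> g = h)"

definition zero_obj :: "('o, 'm, 'z) category_scheme \<Rightarrow> 'o \<Rightarrow> bool" where
  "zero_obj C X \<longleftrightarrow> X \<in> Ob C \<and> (\<forall>Y \<in> Ob C. (\<exists>!f. f \<in> Mor C X Y) \<and> (\<exists>!f. f \<in> Mor C Y X))"

definition simple_obj :: "('o, 'm, 'z) category_scheme \<Rightarrow> 'o \<Rightarrow> bool" where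
  "simple_obj C X \<longleftrightarrow> X \<in> Ob C \<and> \<not> zero_obj C X \<and>
     (\<forall>m. is_mono C m \<and> Cod C m = X \<longrightarrow> zero_obj C (Dom C m) \<or> is_iso C m)"

definition is_coproduct ::
  "('o, 'm, 'z) category_scheme \<Rightarrow> 'i set \<Rightarrow> ('i \<Rightarrow> 'o) \<Rightarrow> ('i \<Rightarrow> 'm) \<Rightarrow> 'o \<Rightarrow> bool" where
  "is_coproduct C I Q u G \<longleftrightarrow> G \<in> Ob C \<and> (\<forall>i\<in>I. u i \<in> Mor C (Q i) G) \<and>
     (\<forall>Z \<in> Ob C. \<forall>h. (\<forall>i\<in>I. h i \<in> Mor C (Q i) Z) \<longrightarrow>
        (\<exists>!t. t \<in> Mor C G Z \<and> (\<forall>i\<in>I. t \<cdot>\<^bsub>C\<^esub> u i = h i)))"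

definition semisimple_obj :: "('o, 'm, 'z) category_scheme \<Rightarrow> 'o \<Rightarrow> bool" where
  "semisimple_obj C X \<longleftrightarrow>
     (\<exists>(n::nat) S u. (\<forall>k<n. simple_obj C (S k)) \<and> is_coproduct C {..<n} S u X)"

text \<open>The square \<open>p \<cdot> r = j \<cdot> q\<close> is cartesian.\<close>
definition is_pullback :: "('o, 'm, 'z) category_scheme \<Rightarrow> 'm \<Rightarrow> 'm \<Rightarrow> 'm \<Rightarrow> 'm \<Rightarrow> bool" where
  "is_pullback C p j r q \<longleftrightarrow> p \<in> Arr C \<and> j \<in> Arr C \<and> Cod C p = Cod C j \<and>
     r \<in> Mor C (Dom C q) (Dom C p) \<and> q \<in> Mor C (Dom C q) (Dom C j) \<and>
     p \<cdot>\<^bsub>C\<^esub> r = j \<cdot>\<^bsub>C\<^esub> q \<and>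
     (\<forall>Z. \<forall>a \<in> Mor C Z (Dom C p). \<forall>b \<in> Mor C Z (Dom C j). p \<cdot>\<^bsub>C\<^esub> a = j \<cdot>\<^bsub>C\<^esub> b \<longrightarrow>
        (\<exists>!t. t \<in> Mor C Z (Dom C q) \<and> r \<cdot>\<^bsub>C\<^esub> t = a \<and> q \<cdot>\<^bsub>C\<^esub> t = b))"

text \<open>The square \<open>i' \<cdot> f = g \<cdot> i\<close> is cocartesian.\<close>
definition is_pushout :: "('o, 'm, 'z) category_scheme \<Rightarrow> 'm \<Rightarrow> 'm \<Rightarrow> 'm \<Rightarrow> 'm \<Rightarrow> bool" where
  "is_pushout C f i i' g \<longleftrightarrow> f \<in> Arr C \<and> i \<in> Arr C \<and> Dom C f = Dom C i \<and>
     i' \<in> Mor C (Cod C f) (Cod C i') \<and> g \<in> Mor C (Cod C i) (Cod C i') \<and>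
     i' \<cdot>\<^bsub>C\<^esub> f = g \<cdot>\<^bsub>C\<^esub> i \<and>
     (\<forall>Z. \<forall>a \<in> Mor C (Cod C f) Z. \<forall>b \<in> Mor C (Cod C i) Z. a \<cdot>\<^bsub>C\<^esub> f = b \<cdot>\<^bsub>C\<^esub> i \<longrightarrow>
        (\<exists>!t. t \<in> Mor C (Cod C i') Z \<and> t \<cdot>\<^bsub>C\<^esub> i' = a \<and> t \<cdot>\<^bsub>C\<^esub> g = b))"

text \<open>Subobjects are represented by monomorphisms; \<open>subobj_le\<close> is their inclusion order, and the
  sum of a set of subobjects is their least upper bound.\<close>
definition subobj_le :: "('o, 'm, 'z) category_scheme \<Rightarrow> 'm \<Rightarrow> 'm \<Rightarrow> bool" where
  "subobj_le C m m' \<longleftrightarrow> m \<in> Arr C \<and> m' \<in> Arr C \<and> Cod C m = Cod C m' \<and>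
     (\<exists>h \<in> Mor C (Dom C m) (Dom C m'). m' \<cdot>\<^bsub>C\<^esub> h = m)"

definition is_subobj_sum :: "('o, 'm, 'z) category_scheme \<Rightarrow> 'm set \<Rightarrow> 'm \<Rightarrow> bool" where
  "is_subobj_sum C S m \<longleftrightarrow> is_mono C m \<and> (\<forall>s\<in>S. subobj_le C s m) \<and>
     (\<forall>m'. is_mono C m' \<and> Cod C m' = Cod C m \<and> (\<forall>s\<in>S. subobj_le C s m') \<longrightarrow> subobj_le C m m')"


section \<open>Abelian \<open>K\<close>-linear categories\<close>

record ('o, 'm, 'k) linear_category = "('o, 'm) category" +
  Add :: "'m \<Rightarrow> 'm \<Rightarrow> 'm"  (infixl \<open>\<boxplus>\<index>\<close> 65)
  Zero :: "'o \<Rightarrow> 'o \<Rightarrow> 'm"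
  Scale :: "'k \<Rightarrow> 'm \<Rightarrow> 'm"  (infixr \<open>\<star>\<index>\<close> 76)

locale linear_category = category C
  for C :: "('o, 'm, 'k::field, 'z) linear_category_scheme" (structure) +
  assumes Add_in_Mor: "\<lbrakk>f \<in> Mor C X Y; g \<in> Mor C X Y\<rbrakk> \<Longrightarrow> f \<boxplus> g \<in> Mor C X Y"
    and Zero_in_Mor: "\<lbrakk>X \<in> Ob C; Y \<in> Ob C\<rbrakk> \<Longrightarrow> Zero C X Y \<in> Mor C X Y"
    and Scale_in_Mor: "f \<in> Mor C X Y \<Longrightarrow> c \<star> f \<in> Mor C X Y"
    and Add_assoc: "\<lbrakk>f \<in> Mor C X Y; g \<in> Mor C X Y; h \<in> Mor C X Y\<rbrakk>
      \<Longrightarrow> (f \<boxplus> g) \<boxplus> h = f \<boxplus> (g \<boxplus> h)"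
    and Add_commute: "\<lbrakk>f \<in> Mor C X Y; g \<in> Mor C X Y\<rbrakk> \<Longrightarrow> f \<boxplus> g = g \<boxplus> f"
    and Add_Zero: "f \<in> Mor C X Y \<Longrightarrow> f \<boxplus> Zero C X Y = f"
    and Add_inverse: "f \<in> Mor C X Y \<Longrightarrow> \<exists>g \<in> Mor C X Y. f \<boxplus> g = Zero C X Y"
    and Scale_Add: "\<lbrakk>f \<in> Mor C X Y; g \<in> Mor C X Y\<rbrakk> \<Longrightarrow> c \<star> (f \<boxplus> g) = (c \<star> f) \<boxplus> (c \<star> g)"
    and Scale_add: "f \<in> Mor C X Y \<Longrightarrow> (c + d) \<star> f = (c \<star> f) \<boxplus> (d \<star> f)"
    and Scale_mult: "f \<in> Mor C X Y \<Longrightarrow> (c * d) \<star> f = c \<star> (d \<star> f)"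
    and Scale_one: "f \<in> Mor C X Y \<Longrightarrow> 1 \<star> f = f"
    and Comp_Add_left: "\<lbrakk>f \<in> Mor C X Y; g \<in> Mor C Y Z; g' \<in> Mor C Y Z\<rbrakk>
      \<Longrightarrow> (g \<boxplus> g') \<cdot> f = (g \<cdot> f) \<boxplus> (g' \<cdot> f)"
    and Comp_Add_right: "\<lbrakk>f \<in> Mor C X Y; f' \<in> Mor C X Y; g \<in> Mor C Y Z\<rbrakk>
      \<Longrightarrow> g \<cdot> (f \<boxplus> f') = (g \<cdot> f) \<boxplus> (g \<cdot> f')"
    and Comp_Scale_left: "\<lbrakk>f \<in> Mor C X Y; g \<in> Mor C Y Z\<rbrakk> \<Longrightarrow> (c \<star> g) \<cdot> f = c \<star> (g \<cdot> f)"
    and Comp_Scale_right: "\<lbrakk>f \<in> Mor C X Y; g \<in> Mor C Y Z\<rbrakk> \<Longrightarrow> g \<cdot> (c \<star> f) = c \<star> (g \<cdot> f)"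

definition is_kernel :: "('o, 'm, 'k, 'z) linear_category_scheme \<Rightarrow> 'm \<Rightarrow> 'm \<Rightarrow> bool" where
  "is_kernel C k f \<longleftrightarrow> f \<in> Arr C \<and> k \<in> Mor C (Dom C k) (Dom C f) \<and>
     f \<cdot>\<^bsub>C\<^esub> k = Zero C (Dom C k) (Cod C f) \<and>
     (\<forall>Z. \<forall>g \<in> Mor C Z (Dom C f). f \<cdot>\<^bsub>C\<^esub> g = Zero C Z (Cod C f) \<longrightarrow>
        (\<exists>!t. t \<in> Mor C Z (Dom C k) \<and> k \<cdot>\<^bsub>C\<^esub> t = g))"

definition is_cokernel :: "('o, 'm, 'k, 'z) linear_category_scheme \<Rightarrow> 'm \<Rightarrow> 'm \<Rightarrow> bool" where
  "is_cokernel C q f \<longleftrightarrow> f \<in> Arr C \<and> q \<in> Mor C (Cod C f) (Cod C q) \<and>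
     q \<cdot>\<^bsub>C\<^esub> f = Zero C (Dom C f) (Cod C q) \<and>
     (\<forall>Z. \<forall>g \<in> Mor C (Cod C f) Z. g \<cdot>\<^bsub>C\<^esub> f = Zero C (Dom C f) Z \<longrightarrow>
        (\<exists>!t. t \<in> Mor C (Cod C q) Z \<and> t \<cdot>\<^bsub>C\<^esub> q = g))"

definition short_exact :: "('o, 'm, 'k, 'z) linear_category_scheme \<Rightarrow> 'm \<Rightarrow> 'm \<Rightarrow> bool" where
  "short_exact C i p \<longleftrightarrow> is_kernel C i p \<and> is_cokernel C p i"

definition is_biproduct ::
  "('o, 'm, 'k, 'z) linear_category_scheme \<Rightarrow> 'o \<Rightarrow> 'o \<Rightarrow> 'o \<Rightarrow> 'm \<Rightarrow> 'm \<Rightarrow> 'm \<Rightarrow> 'm \<Rightarrow> bool" where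
  "is_biproduct C X Y P i1 i2 p1 p2 \<longleftrightarrow>
     i1 \<in> Mor C X P \<and> i2 \<in> Mor C Y P \<and> p1 \<in> Mor C P X \<and> p2 \<in> Mor C P Y \<and>
     p1 \<cdot>\<^bsub>C\<^esub> i1 = Ide C X \<and> p2 \<cdot>\<^bsub>C\<^esub> i2 = Ide C Y \<and>
     p2 \<cdot>\<^bsub>C\<^esub> i1 = Zero C X Y \<and> p1 \<cdot>\<^bsub>C\<^esub> i2 = Zero C Y X \<and>
     (i1 \<cdot>\<^bsub>C\<^esub> p1) \<boxplus>\<^bsub>C\<^esub> (i2 \<cdot>\<^bsub>C\<^esub> p2) = Ide C P"

locale abelian_category = linear_category C
  for C :: "('o, 'm, 'k::field, 'z) linear_category_scheme" (structure) +
  assumes ex_zero_obj: "\<exists>X. zero_obj C X"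
    and ex_biproduct: "\<lbrakk>X \<in> Ob C; Y \<in> Ob C\<rbrakk> \<Longrightarrow> \<exists>P i1 i2 p1 p2. is_biproduct C X Y P i1 i2 p1 p2"
    and ex_kernel: "f \<in> Arr C \<Longrightarrow> \<exists>k. is_kernel C k f"
    and ex_cokernel: "f \<in> Arr C \<Longrightarrow> \<exists>q. is_cokernel C q f"
    and mono_is_kernel: "is_mono C f \<Longrightarrow> \<exists>g. is_kernel C f g"
    and epi_is_cokernel: "is_epi C f \<Longrightarrow> \<exists>g. is_cokernel C f g"


section \<open>Rigid tensor categories\<close>

record ('o, 'm, 'k) tensor_category = "('o, 'm, 'k) linear_category" +
  Tob :: "'o \<Rightarrow> 'o \<Rightarrow> 'o"  (infixl \<open>\<otimes>\<^sub>o\<index>\<close> 80)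
  Tmor :: "'m \<Rightarrow> 'm \<Rightarrow> 'm"  (infixl \<open>\<otimes>\<^sub>m\<index>\<close> 80)
  Unit :: "'o"
  Assoc :: "'o \<Rightarrow> 'o \<Rightarrow> 'o \<Rightarrow> 'm"
  LUnit :: "'o \<Rightarrow> 'm"
  RUnit :: "'o \<Rightarrow> 'm"
  Braid :: "'o \<Rightarrow> 'o \<Rightarrow> 'm"

text \<open>Directions: \<open>Assoc X Y Z : (X \<otimes> Y) \<otimes> Z \<rightarrow> X \<otimes> (Y \<otimes> Z)\<close>, \<open>LUnit X : 1 \<otimes> X \<rightarrow> X\<close>,
  \<open>RUnit X : X \<otimes> 1 \<rightarrow> X\<close>, \<open>Braid X Y : X \<otimes> Y \<rightarrow> Y \<otimes> X\<close>.\<close>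
locale tensor_category = abelian_category C
  for C :: "('o, 'm, 'k::field, 'z) tensor_category_scheme" (structure) +
  assumes Unit_in_Ob: "Unit C \<in> Ob C"
    and Tob_in_Ob: "\<lbrakk>X \<in> Ob C; Y \<in> Ob C\<rbrakk> \<Longrightarrow> X \<otimes>\<^sub>o Y \<in> Ob C"
    and Tmor_in_Mor: "\<lbrakk>f \<in> Mor C X X'; g \<in> Mor C Y Y'\<rbrakk> \<Longrightarrow> f \<otimes>\<^sub>m g \<in> Mor C (X \<otimes>\<^sub>o Y) (X' \<otimes>\<^sub>o Y')"
    and Tmor_Ide: "\<lbrakk>X \<in> Ob C; Y \<in> Ob C\<rbrakk> \<Longrightarrow> Ide C X \<otimes>\<^sub>m Ide C Y = Ide C (X \<otimes>\<^sub>o Y)"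
    and Tmor_Comp: "\<lbrakk>f \<in> Mor C X X'; f' \<in> Mor C X' X''; g \<in> Mor C Y Y'; g' \<in> Mor C Y' Y''\<rbrakk>
      \<Longrightarrow> (f' \<cdot> f) \<otimes>\<^sub>m (g' \<cdot> g) = (f' \<otimes>\<^sub>m g') \<cdot> (f \<otimes>\<^sub>m g)"
    and Tmor_Add_left: "\<lbrakk>f \<in> Mor C X X'; f' \<in> Mor C X X'; g \<in> Mor C Y Y'\<rbrakk>
      \<Longrightarrow> (f \<boxplus> f') \<otimes>\<^sub>m g = (f \<otimes>\<^sub>m g) \<boxplus> (f' \<otimes>\<^sub>m g)"
    and Tmor_Add_right: "\<lbrakk>f \<in> Mor C X X'; g \<in> Mor C Y Y'; g' \<in> Mor C Y Y'\<rbrakk>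
      \<Longrightarrow> f \<otimes>\<^sub>m (g \<boxplus> g') = (f \<otimes>\<^sub>m g) \<boxplus> (f \<otimes>\<^sub>m g')"
    and Tmor_Scale_left: "\<lbrakk>f \<in> Mor C X X'; g \<in> Mor C Y Y'\<rbrakk> \<Longrightarrow> (c \<star> f) \<otimes>\<^sub>m g = c \<star> (f \<otimes>\<^sub>m g)"
    and Tmor_Scale_right: "\<lbrakk>f \<in> Mor C X X'; g \<in> Mor C Y Y'\<rbrakk> \<Longrightarrow> f \<otimes>\<^sub>m (c \<star> g) = c \<star> (f \<otimes>\<^sub>m g)"
    and Assoc_in_Mor: "\<lbrakk>X \<in> Ob C; Y \<in> Ob C; Z \<in> Ob C\<rbrakk>
      \<Longrightarrow> Assoc C X Y Z \<in> Mor C ((X \<otimes>\<^sub>o Y) \<otimes>\<^sub>o Z) (X \<otimes>\<^sub>o (Y \<otimes>\<^sub>o Z))"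
    and Assoc_iso: "\<lbrakk>X \<in> Ob C; Y \<in> Ob C; Z \<in> Ob C\<rbrakk> \<Longrightarrow> is_iso C (Assoc C X Y Z)"
    and Assoc_natural: "\<lbrakk>f \<in> Mor C X X'; g \<in> Mor C Y Y'; h \<in> Mor C Z Z'\<rbrakk>
      \<Longrightarrow> Assoc C X' Y' Z' \<cdot> ((f \<otimes>\<^sub>m g) \<otimes>\<^sub>m h) = (f \<otimes>\<^sub>m (g \<otimes>\<^sub>m h)) \<cdot> Assoc C X Y Z"
    and LUnit_in_Mor: "X \<in> Ob C \<Longrightarrow> LUnit C X \<in> Mor C (Unit C \<otimes>\<^sub>o X) X"
    and LUnit_iso: "X \<in> Ob C \<Longrightarrow> is_iso C (LUnit C X)"
    and LUnit_natural: "f \<in> Mor C X Y \<Longrightarrow> LUnit C Y \<cdot> (Ide C (Unit C) \<otimes>\<^sub>m f) = f \<cdot> LUnit C X"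
    and RUnit_in_Mor: "X \<in> Ob C \<Longrightarrow> RUnit C X \<in> Mor C (X \<otimes>\<^sub>o Unit C) X"
    and RUnit_iso: "X \<in> Ob C \<Longrightarrow> is_iso C (RUnit C X)"
    and RUnit_natural: "f \<in> Mor C X Y \<Longrightarrow> RUnit C Y \<cdot> (f \<otimes>\<^sub>m Ide C (Unit C)) = f \<cdot> RUnit C X"
    and Braid_in_Mor: "\<lbrakk>X \<in> Ob C; Y \<in> Ob C\<rbrakk> \<Longrightarrow> Braid C X Y \<in> Mor C (X \<otimes>\<^sub>o Y) (Y \<otimes>\<^sub>o X)"
    and Braid_natural: "\<lbrakk>f \<in> Mor C X X'; g \<in> Mor C Y Y'\<rbrakk>
      \<Longrightarrow> Braid C X' Y' \<cdot> (f \<otimes>\<^sub>m g) = (g \<otimes>\<^sub>m f) \<cdot> Braid C X Y"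
    and Braid_symmetric: "\<lbrakk>X \<in> Ob C; Y \<in> Ob C\<rbrakk> \<Longrightarrow> Braid C Y X \<cdot> Braid C X Y = Ide C (X \<otimes>\<^sub>o Y)"
    and pentagon: "\<lbrakk>V \<in> Ob C; X \<in> Ob C; Y \<in> Ob C; Z \<in> Ob C\<rbrakk>
      \<Longrightarrow> Assoc C V X (Y \<otimes>\<^sub>o Z) \<cdot> Assoc C (V \<otimes>\<^sub>o X) Y Z =
        (Ide C V \<otimes>\<^sub>m Assoc C X Y Z) \<cdot> Assoc C V (X \<otimes>\<^sub>o Y) Z \<cdot> (Assoc C V X Y \<otimes>\<^sub>m Ide C Z)"
    and triangle: "\<lbrakk>X \<in> Ob C; Y \<in> Ob C\<rbrakk>
      \<Longrightarrow> (Ide C X \<otimes>\<^sub>m LUnit C Y) \<cdot> Assoc C X (Unit C) Y = RUnit C X \<otimes>\<^sub>m Ide C Y"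
    and hexagon: "\<lbrakk>X \<in> Ob C; Y \<in> Ob C; Z \<in> Ob C\<rbrakk>
      \<Longrightarrow> Assoc C Y Z X \<cdot> Braid C X (Y \<otimes>\<^sub>o Z) \<cdot> Assoc C X Y Z =
        (Ide C Y \<otimes>\<^sub>m Braid C X Z) \<cdot> Assoc C Y X Z \<cdot> (Braid C X Y \<otimes>\<^sub>m Ide C Z)"

text \<open>\<open>D\<close> is a dual of \<open>X\<close> with evaluation \<open>D \<otimes> X \<rightarrow> 1\<close> and coevaluation \<open>1 \<rightarrow> X \<otimes> D\<close>;
  the last two conjuncts are the triangle identities.\<close>
definition is_dual :: "('o, 'm, 'k, 'z) tensor_category_scheme \<Rightarrow> 'o \<Rightarrow> 'o \<Rightarrow> 'm \<Rightarrow> 'm \<Rightarrow> bool" where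
  "is_dual C X D ev coev \<longleftrightarrow> X \<in> Ob C \<and> D \<in> Ob C \<and>
     ev \<in> Mor C (D \<otimes>\<^sub>o\<^bsub>C\<^esub> X) (Unit C) \<and> coev \<in> Mor C (Unit C) (X \<otimes>\<^sub>o\<^bsub>C\<^esub> D) \<and>
     RUnit C X \<cdot>\<^bsub>C\<^esub> (Ide C X \<otimes>\<^sub>m\<^bsub>C\<^esub> ev) \<cdot>\<^bsub>C\<^esub> Assoc C X D X \<cdot>\<^bsub>C\<^esub> (coev \<otimes>\<^sub>m\<^bsub>C\<^esub> Ide C X) = LUnit C X \<and>
     (\<exists>a. is_inverse C (Assoc C D X D) a \<and>
        LUnit C D \<cdot>\<^bsub>C\<^esub> (ev \<otimes>\<^sub>m\<^bsub>C\<^esub> Ide C D) \<cdot>\<^bsub>C\<^esub> a \<cdot>\<^bsub>C\<^esub> (Ide C D \<otimes>\<^sub>m\<^bsub>C\<^esub> coev) = RUnit C D)"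

locale rigid_tensor_category = tensor_category C
  for C :: "('o, 'm, 'k::field, 'z) tensor_category_scheme" (structure) +
  assumes ex_dual: "X \<in> Ob C \<Longrightarrow> \<exists>D ev coev. is_dual C X D ev coev"
    and End_Unit: "bij_betw (\<lambda>c. c \<star> Ide C (Unit C)) UNIV (Mor C (Unit C) (Unit C))"

text \<open>\<open>H\<close> together with \<open>ev : H \<otimes> A \<rightarrow> B\<close> is the internal Hom object \<open>Hom(A, B)\<close>, that is, it
  represents \<open>Z \<mapsto> Mor (Z \<otimes> A) B\<close>.\<close>
definition is_ihom :: "('o, 'm, 'k, 'z) tensor_category_scheme \<Rightarrow> 'o \<Rightarrow> 'o \<Rightarrow> 'o \<Rightarrow> 'm \<Rightarrow> bool" where
  "is_ihom C A B H ev \<longleftrightarrow> H \<in> Ob C \<and> ev \<in> Mor C (H \<otimes>\<^sub>o\<^bsub>C\<^esub> A) B \<and>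
     (\<forall>Z \<in> Ob C. \<forall>g \<in> Mor C (Z \<otimes>\<^sub>o\<^bsub>C\<^esub> A) B.
        \<exists>!h. h \<in> Mor C Z H \<and> ev \<cdot>\<^bsub>C\<^esub> (h \<otimes>\<^sub>m\<^bsub>C\<^esub> Ide C A) = g)"


section \<open>Fibre functors and neutral Tannakian categories\<close>

text \<open>The fibres \<open>Fob F X\<close> are finite-dimensional subspaces of one ambient \<open>K\<close>-vector space on the
  type \<open>'v\<close>; every family of vector spaces embeds into its direct sum, so this is no restriction.
  A map \<open>Farr F f\<close> matters only on \<open>Fob F (Dom C f)\<close>.  \<open>Fmult F X Y\<close> encodes the tensor constraint
  as the bilinear map that induces \<open>Fob F X \<otimes> Fob F Y \<cong> Fob F (X \<otimes> Y)\<close>.\<close>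
record ('o, 'm, 'k, 'v) fibre_functor =
  VScale :: "'k \<Rightarrow> 'v \<Rightarrow> 'v"
  Fob :: "'o \<Rightarrow> 'v set"
  Farr :: "'m \<Rightarrow> 'v \<Rightarrow> 'v"
  Fmult :: "'o \<Rightarrow> 'o \<Rightarrow> 'v \<Rightarrow> 'v \<Rightarrow> 'v"

definition linear_between ::
  "('k \<Rightarrow> 'v \<Rightarrow> 'v::ab_group_add) \<Rightarrow> 'v set \<Rightarrow> 'v set \<Rightarrow> ('v \<Rightarrow> 'v) \<Rightarrow> bool" where
  "linear_between s U V h \<longleftrightarrow> (\<forall>x\<in>U. h x \<in> V) \<and>
     (\<forall>x\<in>U. \<forall>y\<in>U. h (x + y) = h x + h y) \<and> (\<forall>c. \<forall>x\<in>U. h (s c x) = s c (h x))"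

definition bilinear_between ::
  "('k \<Rightarrow> 'v \<Rightarrow> 'v::ab_group_add) \<Rightarrow> 'v set \<Rightarrow> 'v set \<Rightarrow> 'v set \<Rightarrow> ('v \<Rightarrow> 'v \<Rightarrow> 'v) \<Rightarrow> bool" where
  "bilinear_between s U V W b \<longleftrightarrow>
     (\<forall>x\<in>U. linear_between s V W (b x)) \<and> (\<forall>y\<in>V. linear_between s U W (\<lambda>x. b x y))"

text \<open>The universal property of the tensor product, tested on bilinear maps into the ambient space
  (which suffices as soon as that space is nonzero).\<close>
definition is_tensor_product ::
  "('k \<Rightarrow> 'v \<Rightarrow> 'v::ab_group_add) \<Rightarrow> 'v set \<Rightarrow> 'v set \<Rightarrow> 'v set \<Rightarrow> ('v \<Rightarrow> 'v \<Rightarrow> 'v) \<Rightarrow> bool" where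
  "is_tensor_product s U V P m \<longleftrightarrow> bilinear_between s U V P m \<and>
     (\<forall>b. bilinear_between s U V UNIV b \<longrightarrow>
        (\<exists>h. linear_between s P UNIV h \<and> (\<forall>x\<in>U. \<forall>y\<in>V. h (m x y) = b x y))) \<and>
     (\<forall>h h'. linear_between s P UNIV h \<and> linear_between s P UNIV h' \<and>
        (\<forall>x\<in>U. \<forall>y\<in>V. h (m x y) = h' (m x y)) \<longrightarrow> (\<forall>z\<in>P. h z = h' z))"

locale neutral_tannakian = rigid_tensor_category C + V: vector_space "VScale F"
  for C :: "('o, 'm, 'k::field, 'z) tensor_category_scheme" (structure)
    and F :: "('o, 'm, 'k, 'v::ab_group_add) fibre_functor" +
  assumes Fob_subspace: "X \<in> Ob C \<Longrightarrow> V.subspace (Fob F X)"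
    and Fob_finite_dim: "X \<in> Ob C \<Longrightarrow> \<exists>S. finite S \<and> V.span S = Fob F X"
    and Farr_linear: "f \<in> Mor C X Y \<Longrightarrow> linear_between (VScale F) (Fob F X) (Fob F Y) (Farr F f)"
    and Farr_Ide: "\<lbrakk>X \<in> Ob C; x \<in> Fob F X\<rbrakk> \<Longrightarrow> Farr F (Ide C X) x = x"
    and Farr_Comp: "\<lbrakk>f \<in> Mor C X Y; g \<in> Mor C Y Z; x \<in> Fob F X\<rbrakk>
      \<Longrightarrow> Farr F (g \<cdot> f) x = Farr F g (Farr F f x)"
    and Farr_Add: "\<lbrakk>f \<in> Mor C X Y; g \<in> Mor C X Y; x \<in> Fob F X\<rbrakk>
      \<Longrightarrow> Farr F (f \<boxplus> g) x = Farr F f x + Farr F g x"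
    and Farr_Scale: "\<lbrakk>f \<in> Mor C X Y; x \<in> Fob F X\<rbrakk> \<Longrightarrow> Farr F (c \<star> f) x = VScale F c (Farr F f x)"
    and Farr_faithful: "\<lbrakk>f \<in> Mor C X Y; g \<in> Mor C X Y; \<And>x. x \<in> Fob F X \<Longrightarrow> Farr F f x = Farr F g x\<rbrakk>
      \<Longrightarrow> f = g"
    and Farr_exact: "short_exact C i p \<Longrightarrow>
        inj_on (Farr F i) (Fob F (Dom C i)) \<and>
        Farr F i ` Fob F (Dom C i) = {x \<in> Fob F (Cod C i). Farr F p x = 0} \<and>
        Farr F p ` Fob F (Dom C p) = Fob F (Cod C p)"
    and Fmult_tensor_product: "\<lbrakk>X \<in> Ob C; Y \<in> Ob C\<rbrakk>
      \<Longrightarrow> is_tensor_product (VScale F) (Fob F X) (Fob F Y) (Fob F (X \<otimes>\<^sub>o Y)) (Fmult F X Y)"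
    and Fmult_natural: "\<lbrakk>f \<in> Mor C X X'; g \<in> Mor C Y Y'; x \<in> Fob F X; y \<in> Fob F Y\<rbrakk>
      \<Longrightarrow> Farr F (f \<otimes>\<^sub>m g) (Fmult F X Y x y) = Fmult F X' Y' (Farr F f x) (Farr F g y)"
    and Fmult_Assoc: "\<lbrakk>X \<in> Ob C; Y \<in> Ob C; Z \<in> Ob C; x \<in> Fob F X; y \<in> Fob F Y; z \<in> Fob F Z\<rbrakk>
      \<Longrightarrow> Farr F (Assoc C X Y Z) (Fmult F (X \<otimes>\<^sub>o Y) Z (Fmult F X Y x y) z) =
        Fmult F X (Y \<otimes>\<^sub>o Z) x (Fmult F Y Z y z)"
    and Fmult_Braid: "\<lbrakk>X \<in> Ob C; Y \<in> Ob C; x \<in> Fob F X; y \<in> Fob F Y\<rbrakk>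
      \<Longrightarrow> Farr F (Braid C X Y) (Fmult F X Y x y) = Fmult F Y X y x"
    and Fmult_Unit: "\<exists>e. e \<noteq> 0 \<and> Fob F (Unit C) = V.span {e} \<and>
        (\<forall>X \<in> Ob C. \<forall>x \<in> Fob F X. Farr F (LUnit C X) (Fmult F (Unit C) X e x) = x \<and>
           Farr F (RUnit C X) (Fmult F X (Unit C) x e) = x)"


section \<open>Weight filtrations\<close>

text \<open>\<open>W n X\<close> is the inclusion arrow of the subobject \<open>W\<^sub>n X\<close>, whose object is \<open>Dom C (W n X)\<close>.
  As \<open>W n Y\<close> is a monomorphism, the arrow induced by \<open>f : X \<rightarrow> Y\<close> on the \<open>n\<close>-th steps is unique,
  so its existence makes \<open>W\<^sub>n\<close> a functor.\<close>
locale weight_filtration = tensor_category C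
  for C :: "('o, 'm, 'k::field, 'z) tensor_category_scheme" (structure)
    and W :: "int \<Rightarrow> 'o \<Rightarrow> 'm" +
  assumes W_mono: "X \<in> Ob C \<Longrightarrow> is_mono C (W n X)"
    and W_Cod: "X \<in> Ob C \<Longrightarrow> Cod C (W n X) = X"
    and W_functorial: "f \<in> Mor C X Y
      \<Longrightarrow> \<exists>g \<in> Mor C (Dom C (W n X)) (Dom C (W n Y)). W n Y \<cdot> g = f \<cdot> W n X"
    and W_increasing: "\<lbrakk>X \<in> Ob C; m \<le> n\<rbrakk> \<Longrightarrow> subobj_le C (W m X) (W n X)"
    and W_eventually_zero: "X \<in> Ob C \<Longrightarrow> \<exists>a. \<forall>n\<le>a. zero_obj C (Dom C (W n X))"
    and W_eventually_all: "X \<in> Ob C \<Longrightarrow> \<exists>b. \<forall>n\<ge>b. is_iso C (W n X)"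
    and W_exact: "\<lbrakk>short_exact C i p; i \<in> Mor C X Y; p \<in> Mor C Y Z;
        i' \<in> Mor C (Dom C (W n X)) (Dom C (W n Y)); W n Y \<cdot> i' = i \<cdot> W n X;
        p' \<in> Mor C (Dom C (W n Y)) (Dom C (W n Z)); W n Z \<cdot> p' = p \<cdot> W n Y\<rbrakk>
      \<Longrightarrow> short_exact C i' p'"
    and W_tensor: "\<lbrakk>X \<in> Ob C; Y \<in> Ob C\<rbrakk>
      \<Longrightarrow> is_subobj_sum C {W p X \<otimes>\<^sub>m W q Y | p q. p + q = n} (W n (X \<otimes>\<^sub>o Y))"

text \<open>\<open>q\<close> is the quotient arrow \<open>W\<^sub>n X \<rightarrow> W\<^sub>n X / W\<^sub>n\<^sub>-\<^sub>1 X\<close>.\<close>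
definition is_gr_quotient ::
  "('o, 'm, 'k, 'z) linear_category_scheme \<Rightarrow> (int \<Rightarrow> 'o \<Rightarrow> 'm) \<Rightarrow> int \<Rightarrow> 'o \<Rightarrow> 'm \<Rightarrow> bool" where
  "is_gr_quotient C W n X q \<longleftrightarrow>
     (\<exists>w \<in> Mor C (Dom C (W (n - 1) X)) (Dom C (W n X)).
        W n X \<cdot>\<^bsub>C\<^esub> w = W (n - 1) X \<and> is_cokernel C q w)"

definition weights ::
  "('o, 'm, 'k, 'z) linear_category_scheme \<Rightarrow> (int \<Rightarrow> 'o \<Rightarrow> 'm) \<Rightarrow> 'o \<Rightarrow> int set" where
  "weights C W X = {n. \<exists>q. is_gr_quotient C W n X q \<and> \<not> zero_obj C (Cod C q)}"

text \<open>\<open>G\<close> is the associated graded object of \<open>X\<close>.  The coproduct over all integers exists, since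
  only finitely many of its summands are nonzero.\<close>
definition is_associated_graded ::
  "('o, 'm, 'k, 'z) linear_category_scheme \<Rightarrow> (int \<Rightarrow> 'o \<Rightarrow> 'm) \<Rightarrow> 'o \<Rightarrow> 'o \<Rightarrow> bool" where
  "is_associated_graded C W X G \<longleftrightarrow>
     (\<exists>q u. (\<forall>n. is_gr_quotient C W n X (q n)) \<and> is_coproduct C UNIV (\<lambda>n. Cod C (q n)) u G)"


section \<open>Extensions\<close>

text \<open>An extension \<open>0 \<rightarrow> B \<rightarrow> E \<rightarrow> A \<rightarrow> 0\<close> of \<open>A\<close> by \<open>B\<close> is the pair of its two arrows, and
  \<open>Ext1 C A B\<close> is the set of Yoneda classes of such extensions.\<close>
definition extensions ::
  "('o, 'm, 'k, 'z) linear_category_scheme \<Rightarrow> 'o \<Rightarrow> 'o \<Rightarrow> ('m \<times> 'm) set" where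
  "extensions C A B = {(i, p). short_exact C i p \<and> Dom C i = B \<and> Cod C p = A}"

definition ext_rel ::
  "('o, 'm, 'k, 'z) linear_category_scheme \<Rightarrow> 'o \<Rightarrow> 'o \<Rightarrow> (('m \<times> 'm) \<times> ('m \<times> 'm)) set" where
  "ext_rel C A B = {((i, p), (i', p')). (i, p) \<in> extensions C A B \<and> (i', p') \<in> extensions C A B \<and>
     (\<exists>t \<in> Mor C (Cod C i) (Cod C i'). is_iso C t \<and> t \<cdot>\<^bsub>C\<^esub> i = i' \<and> p' \<cdot>\<^bsub>C\<^esub> t = p)}"

definition Ext1 ::
  "('o, 'm, 'k, 'z) linear_category_scheme \<Rightarrow> 'o \<Rightarrow> 'o \<Rightarrow> ('m \<times> 'm) set set" where
  "Ext1 C A B = extensions C A B // ext_rel C A B"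

definition ext_class ::
  "('o, 'm, 'k, 'z) linear_category_scheme \<Rightarrow> 'o \<Rightarrow> 'o \<Rightarrow> 'm \<Rightarrow> 'm \<Rightarrow> ('m \<times> 'm) set" where
  "ext_class C A B i p = ext_rel C A B `` {(i, p)}"

lemma ext_class_in_Ext1:
  "(i, p) \<in> extensions C A B \<Longrightarrow> ext_class C A B i p \<in> Ext1 C A B"
  by (simp add: ext_class_def Ext1_def quotientI)

text \<open>Since \<open>split_extension\<close> is invariant under equivalence, a Yoneda class is trivial iff one of
  its representatives splits.\<close>
definition split_extension :: "('o, 'm, 'k, 'z) linear_category_scheme \<Rightarrow> 'm \<Rightarrow> 'm \<Rightarrow> bool" where
  "split_extension C i p \<longleftrightarrow> (\<exists>s \<in> Mor C (Cod C p) (Dom C p). p \<cdot>\<^bsub>C\<^esub> s = Ide C (Cod C p))"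

text \<open>The pushforward \<open>f\<^sub>* : Ext1 C A B \<rightarrow> Ext1 C A B'\<close> along \<open>f : B \<rightarrow> B'\<close>.\<close>
definition ext_pushforward ::
  "('o, 'm, 'k, 'z) linear_category_scheme \<Rightarrow> 'm \<Rightarrow> ('m \<times> 'm) set \<Rightarrow> ('m \<times> 'm) set" where
  "ext_pushforward C f \<xi> = {(i', p'). short_exact C i' p' \<and>
     (\<exists>(i, p) \<in> \<xi>. \<exists>g. is_pushout C f i i' g \<and> p' \<cdot>\<^bsub>C\<^esub> g = p)}"

definition totally_nonsplit ::
  "('o, 'm, 'k, 'z) linear_category_scheme \<Rightarrow> 'o \<Rightarrow> ('m \<times> 'm) set \<Rightarrow> bool" where
  "totally_nonsplit C H \<xi> \<longleftrightarrow>
     (\<forall>c q. is_mono C c \<and> Cod C c = H \<and> \<not> is_iso C c \<and> is_cokernel C q c \<longrightarrow>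
        \<not> (\<exists>(i', p') \<in> ext_pushforward C q \<xi>. split_extension C i' p'))"

text \<open>\<open>t = Hom(A, f) : Hom(A, X) \<rightarrow> Hom(A, Y)\<close> for \<open>f : X \<rightarrow> Y\<close>, where \<open>(H, ev)\<close> and \<open>(H', ev')\<close>
  are the internal Homs.\<close>
definition is_ihom_map ::
  "('o, 'm, 'k, 'z) tensor_category_scheme \<Rightarrow> 'o \<Rightarrow> 'o \<Rightarrow> 'm \<Rightarrow> 'o \<Rightarrow> 'm \<Rightarrow> 'm \<Rightarrow> 'm \<Rightarrow> bool" where
  "is_ihom_map C A H ev H' ev' f t \<longleftrightarrow>
     t \<in> Mor C H H' \<and> ev' \<cdot>\<^bsub>C\<^esub> (t \<otimes>\<^sub>m\<^bsub>C\<^esub> Ide C A) = f \<cdot>\<^bsub>C\<^esub> ev"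

text \<open>The canonical isomorphism \<open>Ext1 C A B \<rightarrow> Ext1 C 1 H\<close>, where \<open>(H, ev)\<close> is the internal Hom
  \<open>Hom(A, B)\<close>: apply \<open>Hom(A, -)\<close> to \<open>0 \<rightarrow> B \<rightarrow> E \<rightarrow> A \<rightarrow> 0\<close> and pull the result
  \<open>0 \<rightarrow> H \<rightarrow> Hom(A, E) \<rightarrow> Hom(A, A) \<rightarrow> 0\<close> back along the arrow \<open>j : 1 \<rightarrow> Hom(A, A)\<close> adjoint to
  \<open>1 \<otimes> A \<cong> A\<close>.  All choices are unique up to isomorphism, so the set below is one Yoneda class.\<close>
definition ext_to_unit ::
  "('o, 'm, 'k, 'z) tensor_category_scheme \<Rightarrow> 'o \<Rightarrow> 'o \<Rightarrow> 'o \<Rightarrow> 'm \<Rightarrow> ('m \<times> 'm) set \<Rightarrow> ('m \<times> 'm) set"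
  where
  "ext_to_unit C A B H ev \<xi> = {(k, q). (k, q) \<in> extensions C (Unit C) H \<and>
     (\<exists>(i, p) \<in> \<xi>. \<exists>HE evE HA evA i1 p1 j r.
        is_ihom C A (Cod C i) HE evE \<and> is_ihom C A A HA evA \<and>
        is_ihom_map C A H ev HE evE i i1 \<and> is_ihom_map C A HE evE HA evA p p1 \<and>
        j \<in> Mor C (Unit C) HA \<and> evA \<cdot>\<^bsub>C\<^esub> (j \<otimes>\<^sub>m\<^bsub>C\<^esub> Ide C A) = LUnit C A \<and>
        is_pullback C p1 j r q \<and> r \<cdot>\<^bsub>C\<^esub> k = i1)}"


section \<open>Endomorphisms of an extension\<close>

text \<open>\<open>i : B \<rightarrow> E\<close> is the inclusion of a subobject and \<open>p : E \<rightarrow> A\<close> the quotient by it.\<close>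

definition End_sub :: "('o, 'm, 'z) category_scheme \<Rightarrow> 'm \<Rightarrow> 'm set" where
  "End_sub C i = {\<phi> \<in> Mor C (Cod C i) (Cod C i).
     \<exists>b \<in> Mor C (Dom C i) (Dom C i). i \<cdot>\<^bsub>C\<^esub> b = \<phi> \<cdot>\<^bsub>C\<^esub> i}"

definition restrict_end :: "('o, 'm, 'z) category_scheme \<Rightarrow> 'm \<Rightarrow> 'm \<Rightarrow> 'm" where
  "restrict_end C i \<phi> = (THE b. b \<in> Mor C (Dom C i) (Dom C i) \<and> i \<cdot>\<^bsub>C\<^esub> b = \<phi> \<cdot>\<^bsub>C\<^esub> i)"

definition induced_end :: "('o, 'm, 'z) category_scheme \<Rightarrow> 'm \<Rightarrow> 'm \<Rightarrow> 'm" where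
  "induced_end C p \<phi> = (THE a. a \<in> Mor C (Cod C p) (Cod C p) \<and> a \<cdot>\<^bsub>C\<^esub> p = p \<cdot>\<^bsub>C\<^esub> \<phi>)"

definition Omega :: "('o, 'm, 'z) category_scheme \<Rightarrow> 'm \<Rightarrow> 'm \<Rightarrow> 'm \<Rightarrow> 'm \<times> 'm" where
  "Omega C i p \<phi> = (restrict_end C i \<phi>, induced_end C p \<phi>)"

end

theory Submission
  imports Defs "HOL-Computational_Algebra.Polynomial"
begin

text \<open>
Let \<open>X\<close> be the middle term of the extension of \<open>1\<close> by \<open>H = Hom(A, B)\<close> that corresponds to
\<open>0 \<rightarrow> B \<rightarrow> E \<rightarrow> A \<rightarrow> 0\<close>.  On fibres, \<open>X\<close> consists of the linear maps \<open>h : A \<rightarrow> E\<close> for which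
\<open>p \<circ> h\<close> is a scalar.  The pushforward of this extension along an arrow out of \<open>H\<close> splits iff the
arrow extends to \<open>X\<close>; so total nonsplitness says that a nonzero epimorphism out of \<open>H\<close> never
extends to \<open>X\<close> (\<open>totally_nonsplit_extends\<close>).  The proof writes down arrows \<open>X \<rightarrow> H\<close> in terms of
endomorphisms of \<open>E\<close> and reads off the consequences.

Either condition on the weights implies that there is no nonzero arrow from a subobject of \<open>A\<close> to
a quotient of \<open>B\<close> (\<open>no_hom_disjoint_weights\<close>, \<open>no_hom_semisimple_graded\<close>).  Indeed such an arrow
\<open>f\<close> would lower weights, that is, map \<open>W\<^sub>n\<close> into \<open>W\<^sub>n\<^sub>-\<^sub>1\<close>: in the first case because each weight is
missing from \<open>A\<close> or from \<open>B\<close>, in the second because the graded pieces in question are direct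
summands of those of \<open>A\<close> and \<open>B\<close>.  By strictness, which is the exactness of the functors \<open>W\<^sub>n\<close>,
an arrow that lowers weights is zero.

Consider an endomorphism \<open>b\<close> of \<open>B\<close> and an endomorphism \<open>a\<close> of \<open>A\<close> such that the endomorphism
\<open>f \<mapsto> b \<circ> f \<circ> a\<close> of \<open>H\<close> extends to an arrow \<open>X \<rightarrow> H\<close>.  The maps \<open>A \<rightarrow> B\<close> in the image of the
extension take values in \<open>im b\<close> and vanish on \<open>ker a\<close>, since the obstructions are arrows
\<open>A \<rightarrow> B / im b\<close> and \<open>ker a \<rightarrow> im b\<close>.  So the extension has the same image as \<open>f \<mapsto> b \<circ> f \<circ> a\<close>, the
corestriction of the latter to its image extends too, and total nonsplitness gives \<open>b = 0\<close> or
\<open>a = 0\<close> (\<open>sandwich_extends\<close>).  If \<open>\<phi>\<close> and \<open>\<psi>\<close> preserve \<open>B\<close> and \<open>\<phi>\<^sub>B \<psi>\<^sub>B = 0\<close>, then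
\<open>h \<mapsto> \<phi> h \<psi>\<^sub>A - \<phi> \<psi> h\<close> extends \<open>f \<mapsto> \<phi>\<^sub>B f \<psi>\<^sub>A\<close>; and if \<open>\<psi>\<^sub>A = 0\<close>, then \<open>h \<mapsto> \<psi> h\<close> extends
\<open>f \<mapsto> \<psi>\<^sub>B f\<close>.  Hence \<open>\<phi>\<^sub>B\<close> and \<open>\<phi>\<^sub>A\<close> determine each other, and the restrictions \<open>\<phi>\<^sub>B\<close> form a
finite-dimensional algebra without zero divisors, a division algebra.

Finally let \<open>T\<close> be the commutator map \<open>f \<mapsto> \<phi>\<^sub>B f - f \<phi>\<^sub>A\<close> on \<open>H\<close>, which \<open>h \<mapsto> \<phi> h - h \<phi>\<^sub>A\<close> extends to
\<open>X\<close>.  As \<open>\<phi>\<^sub>B\<close> generates a field that is separable over \<open>K\<close>, \<open>ker T\<^sup>2 = ker T\<close>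
(\<open>commutator_map_semisimple\<close>).  Therefore \<open>T\<close> has a generalised inverse that is a polynomial in
\<open>T\<close>, the corestriction of \<open>T\<close> to its image extends to \<open>X\<close>, and \<open>T = 0\<close>.  So
\<open>\<phi>\<^sub>B f = f \<phi>\<^sub>A\<close> for every linear \<open>f\<close>, which forces \<open>\<phi>\<^sub>B\<close> and \<open>\<phi>\<^sub>A\<close> to be the same scalar.

All of this is carried out on fibres.  The fibre functor is faithful and exact, so equations,
monomorphisms, epimorphisms and exactness are checked on vectors, and the fibre of an internal Hom
is the space of linear maps between the fibres, by duality.
\<close>

section \<open>Morphisms and their fibres\<close>

context category
begin

lemma Mor_Ob: "f \<in> Mor C X Y \<Longrightarrow> X \<in> Ob C \<and> Y \<in> Ob C"
  using Dom_in_Ob Cod_in_Ob by (auto simp: Mor_def)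

lemma Comp_typing [simp]:
  assumes "f \<in> Arr C" "g \<in> Arr C" "Dom C g = Cod C f"
  shows "g \<cdot> f \<in> Arr C" "Dom C (g \<cdot> f) = Dom C f" "Cod C (g \<cdot> f) = Cod C g"
  using Comp_in_Mor[of f "Dom C f" "Cod C f" g "Cod C g"] assms by (auto simp: Mor_def)

lemma Ide_typing [simp]:
  assumes "X \<in> Ob C"
  shows "Ide C X \<in> Arr C" "Dom C (Ide C X) = X" "Cod C (Ide C X) = X"
  using Ide_in_Mor[OF assms] by (auto simp: Mor_def)

end

context linear_category
begin

lemma Add_typing [simp]:
  assumes "f \<in> Arr C" "g \<in> Arr C" "Dom C g = Dom C f" "Cod C g = Cod C f"
  shows "f \<boxplus> g \<in> Arr C" "Dom C (f \<boxplus> g) = Dom C f" "Cod C (f \<boxplus> g) = Cod C f"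
  using Add_in_Mor[of f "Dom C f" "Cod C f" g] assms by (auto simp: Mor_def)

lemma Scale_typing [simp]:
  assumes "f \<in> Arr C"
  shows "c \<star> f \<in> Arr C" "Dom C (c \<star> f) = Dom C f" "Cod C (c \<star> f) = Cod C f"
  using Scale_in_Mor[of f "Dom C f" "Cod C f" c] assms by (auto simp: Mor_def)

lemma Zero_typing [simp]:
  assumes "X \<in> Ob C" "Y \<in> Ob C"
  shows "Zero C X Y \<in> Arr C" "Dom C (Zero C X Y) = X" "Cod C (Zero C X Y) = Y"
  using Zero_in_Mor[OF assms] by (auto simp: Mor_def)

end

context tensor_category
begin

lemma Tmor_typing [simp]:
  assumes "f \<in> Arr C" "g \<in> Arr C"
  shows "f \<otimes>\<^sub>m g \<in> Arr C" "Dom C (f \<otimes>\<^sub>m g) = Dom C f \<otimes>\<^sub>o Dom C g"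
    "Cod C (f \<otimes>\<^sub>m g) = Cod C f \<otimes>\<^sub>o Cod C g"
  using Tmor_in_Mor[of f "Dom C f" "Cod C f" g "Dom C g" "Cod C g"] assms by (auto simp: Mor_def)

lemma Assoc_typing [simp]:
  assumes "X \<in> Ob C" "Y \<in> Ob C" "Z \<in> Ob C"
  shows "Assoc C X Y Z \<in> Arr C" "Dom C (Assoc C X Y Z) = (X \<otimes>\<^sub>o Y) \<otimes>\<^sub>o Z"
    "Cod C (Assoc C X Y Z) = X \<otimes>\<^sub>o (Y \<otimes>\<^sub>o Z)"
  using Assoc_in_Mor[OF assms] by (auto simp: Mor_def)

lemma LUnit_typing [simp]:
  assumes "X \<in> Ob C"
  shows "LUnit C X \<in> Arr C" "Dom C (LUnit C X) = Unit C \<otimes>\<^sub>o X" "Cod C (LUnit C X) = X"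
  using LUnit_in_Mor[OF assms] by (auto simp: Mor_def)

lemma RUnit_typing [simp]:
  assumes "X \<in> Ob C"
  shows "RUnit C X \<in> Arr C" "Dom C (RUnit C X) = X \<otimes>\<^sub>o Unit C" "Cod C (RUnit C X) = X"
  using RUnit_in_Mor[OF assms] by (auto simp: Mor_def)

declare Unit_in_Ob [simp] Tob_in_Ob [simp]

end

context neutral_tannakian
begin

lemma V_simps [simp]:
  "VScale F 0 x = 0" "VScale F 1 x = x" "VScale F c 0 = 0"
  "VScale F (- 1) x = - x"
  by simp_all

lemma Fob_closed [simp]:
  assumes "X \<in> Ob C"
  shows "0 \<in> Fob F X" "x \<in> Fob F X \<Longrightarrow> y \<in> Fob F X \<Longrightarrow> x + y \<in> Fob F X"
    "x \<in> Fob F X \<Longrightarrow> VScale F c x \<in> Fob F X" "x \<in> Fob F X \<Longrightarrow> - x \<in> Fob F X"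
    "x \<in> Fob F X \<Longrightarrow> y \<in> Fob F X \<Longrightarrow> x - y \<in> Fob F X"
  using Fob_subspace[OF assms]
  by (auto intro: V.subspace_0 V.subspace_add V.subspace_scale V.subspace_neg V.subspace_diff)

lemma Farr_in [simp]:
  assumes "f \<in> Arr C" "Cod C f = Y" "x \<in> Fob F (Dom C f)"
  shows "Farr F f x \<in> Fob F Y"
  using Farr_linear[of f "Dom C f" "Cod C f"] assms by (auto simp: Mor_def linear_between_def)

lemma Farr_plus [simp]:
  assumes "f \<in> Arr C" "x \<in> Fob F (Dom C f)" "y \<in> Fob F (Dom C f)"
  shows "Farr F f (x + y) = Farr F f x + Farr F f y"
  using Farr_linear[of f "Dom C f" "Cod C f"] assms by (auto simp: Mor_def linear_between_def)

lemma Farr_VScale [simp]: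
  assumes "f \<in> Arr C" "x \<in> Fob F (Dom C f)"
  shows "Farr F f (VScale F c x) = VScale F c (Farr F f x)"
  using Farr_linear[of f "Dom C f" "Cod C f"] assms by (auto simp: Mor_def linear_between_def)

lemma Farr_zero [simp]:
  assumes "f \<in> Arr C"
  shows "Farr F f 0 = 0"
  using Farr_VScale[OF assms, of 0 0] Dom_in_Ob[OF assms] by (simp del: Farr_VScale)

lemma Farr_uminus [simp]:
  assumes "f \<in> Arr C" "x \<in> Fob F (Dom C f)"
  shows "Farr F f (- x) = - Farr F f x"
  using Farr_VScale[OF assms, of "- 1"] by (simp del: Farr_VScale)

lemma Farr_diff [simp]:
  assumes "f \<in> Arr C" "x \<in> Fob F (Dom C f)" "y \<in> Fob F (Dom C f)"
  shows "Farr F f (x - y) = Farr F f x - Farr F f y"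
  using Farr_plus[OF assms(1,2), of "- y"] assms Dom_in_Ob[OF assms(1)] by (simp del: Farr_plus)

lemma Farr_comp [simp]:
  assumes "f \<in> Arr C" "g \<in> Arr C" "Dom C g = Cod C f" "x \<in> Fob F (Dom C f)"
  shows "Farr F (g \<cdot> f) x = Farr F g (Farr F f x)"
  by (rule Farr_Comp[of f "Dom C f" "Cod C f" g "Cod C g"]) (use assms in \<open>auto simp: Mor_def\<close>)

lemma Farr_ide [simp]: "X \<in> Ob C \<Longrightarrow> x \<in> Fob F X \<Longrightarrow> Farr F (Ide C X) x = x"
  by (rule Farr_Ide)

lemma Farr_add [simp]:
  assumes "f \<in> Arr C" "g \<in> Arr C" "Dom C g = Dom C f" "Cod C g = Cod C f" "x \<in> Fob F (Dom C f)"
  shows "Farr F (f \<boxplus> g) x = Farr F f x + Farr F g x"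
  by (rule Farr_Add[of f "Dom C f" "Cod C f"]) (use assms in \<open>auto simp: Mor_def\<close>)

lemma Farr_scale [simp]:
  assumes "f \<in> Arr C" "x \<in> Fob F (Dom C f)"
  shows "Farr F (c \<star> f) x = VScale F c (Farr F f x)"
  by (rule Farr_Scale[of f "Dom C f" "Cod C f"]) (use assms in \<open>auto simp: Mor_def\<close>)

lemma Farr_Zero [simp]:
  assumes "X \<in> Ob C" "Y \<in> Ob C" "x \<in> Fob F X"
  shows "Farr F (Zero C X Y) x = 0"
proof -
  have "Farr F (Zero C X Y \<boxplus> Zero C X Y) x = Farr F (Zero C X Y) x"
    using Add_Zero[OF Zero_in_Mor[OF assms(1,2)]] by simp
  then show ?thesis using assms by simp
qed

text \<open>Faithfulness of the fibre functor, in terms of \<open>Arr\<close>, \<open>Dom\<close> and \<open>Cod\<close> so that the typing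
  conditions are solved by simplification.\<close>
lemma Mor_eqI:
  assumes "f \<in> Arr C" "g \<in> Arr C" "Dom C f = Dom C g" "Cod C f = Cod C g"
    and "\<And>x. x \<in> Fob F (Dom C g) \<Longrightarrow> Farr F f x = Farr F g x"
  shows "f = g"
  by (rule Farr_faithful[of f "Dom C g" "Cod C g"]) (use assms in \<open>auto simp: Mor_def\<close>)

lemma zero_obj_iff: "X \<in> Ob C \<Longrightarrow> zero_obj C X \<longleftrightarrow> Fob F X = {0}"
proof
  assume X: "X \<in> Ob C" and z: "zero_obj C X"
  have "Ide C X = Zero C X X"
    using z X Ide_in_Mor[OF X] Zero_in_Mor[OF X X] unfolding zero_obj_def by blast
  then have "x = 0" if "x \<in> Fob F X" for x
    using Farr_ide[OF X that] Farr_Zero[OF X X that] by simp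
  then show "Fob F X = {0}" using X by auto
next
  assume X: "X \<in> Ob C" and z: "Fob F X = {0}"
  have 1: "f = g" if "f \<in> Mor C X Y" "g \<in> Mor C X Y" for f g Y
    by (rule Farr_faithful[OF that]) (use that z in \<open>auto simp: Mor_def\<close>)
  have 2: "f = g" if "f \<in> Mor C Y X" "g \<in> Mor C Y X" for f g Y
  proof (rule Farr_faithful[OF that])
    fix x assume "x \<in> Fob F Y"
    then have "Farr F f x \<in> Fob F X" "Farr F g x \<in> Fob F X"
      using that by (auto simp: Mor_def)
    then show "Farr F f x = Farr F g x" using z by simp
  qed
  show "zero_obj C X"
    unfolding zero_obj_def using X 1 2 Zero_in_Mor by blast
qed

section \<open>Kernels, images and exactness on fibres\<close>

lemma kernel_typing: "is_kernel C k f \<Longrightarrow> k \<in> Arr C" "is_kernel C k f \<Longrightarrow> Cod C k = Dom C f"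
  by (auto simp: is_kernel_def Mor_def)

lemma kernel_factor:
  assumes "is_kernel C k f" "h \<in> Mor C Z (Dom C f)" "f \<cdot> h = Zero C Z (Cod C f)"
  obtains t where "t \<in> Mor C Z (Dom C k)" "k \<cdot> t = h"
  using assms unfolding is_kernel_def by metis

lemma cokernel_factor:
  assumes "is_cokernel C q f" "h \<in> Mor C (Cod C f) Z" "h \<cdot> f = Zero C (Dom C f) Z"
  obtains t where "t \<in> Mor C (Cod C q) Z" "t \<cdot> q = h"
  using assms unfolding is_cokernel_def by metis

lemma is_kernel_is_mono:
  assumes "is_kernel C k f" shows "is_mono C k"
  unfolding is_mono_def
proof (intro conjI allI ballI impI)
  have k: "k \<in> Arr C" "Cod C k = Dom C f" and f: "f \<in> Arr C"
    and z: "f \<cdot> k = Zero C (Dom C k) (Cod C f)"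
    and u: "\<And>Z g. g \<in> Mor C Z (Dom C f) \<Longrightarrow> f \<cdot> g = Zero C Z (Cod C f) \<Longrightarrow>
       \<exists>!t. t \<in> Mor C Z (Dom C k) \<and> k \<cdot> t = g"
    using assms by (auto simp: is_kernel_def Mor_def)
  show "k \<in> Arr C" by (rule k)
  fix Z g h assume gh: "g \<in> Mor C Z (Dom C k)" "h \<in> Mor C Z (Dom C k)" "k \<cdot> g = k \<cdot> h"
  have "k \<cdot> g \<in> Mor C Z (Dom C f)" using gh k by (auto simp: Mor_def)
  moreover have "f \<cdot> (k \<cdot> g) = Zero C Z (Cod C f)"
  proof -
    have "f \<cdot> (k \<cdot> g) = (f \<cdot> k) \<cdot> g"
      using Comp_assoc[of g Z "Dom C k" k "Dom C f" f "Cod C f"] gh(1) k f by (simp add: Mor_def)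
    also have "\<dots> = Zero C Z (Cod C f)"
      by (rule Mor_eqI) (use gh(1) z k f in \<open>auto simp: Mor_def Dom_in_Ob Cod_in_Ob\<close>)
    finally show ?thesis .
  qed
  ultimately show "g = h" using u[of "k \<cdot> g" Z] gh by metis
qed

lemma is_cokernel_is_epi:
  assumes "is_cokernel C q f" shows "is_epi C q"
  unfolding is_epi_def
proof (intro conjI allI ballI impI)
  have q: "q \<in> Arr C" "Dom C q = Cod C f" and f: "f \<in> Arr C"
    and z: "q \<cdot> f = Zero C (Dom C f) (Cod C q)"
    and u: "\<And>Z g. g \<in> Mor C (Cod C f) Z \<Longrightarrow> g \<cdot> f = Zero C (Dom C f) Z \<Longrightarrow>
       \<exists>!t. t \<in> Mor C (Cod C q) Z \<and> t \<cdot> q = g"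
    using assms by (auto simp: is_cokernel_def Mor_def)
  show "q \<in> Arr C" by (rule q)
  fix Z g h assume gh: "g \<in> Mor C (Cod C q) Z" "h \<in> Mor C (Cod C q) Z" "g \<cdot> q = h \<cdot> q"
  have "g \<cdot> q \<in> Mor C (Cod C f) Z" using gh q by (auto simp: Mor_def)
  moreover have "(g \<cdot> q) \<cdot> f = Zero C (Dom C f) Z"
  proof -
    have "(g \<cdot> q) \<cdot> f = g \<cdot> (q \<cdot> f)"
      using Comp_assoc[of f "Dom C f" "Cod C f" q "Cod C q" g Z] gh(1) q f by (simp add: Mor_def)
    also have "\<dots> = Zero C (Dom C f) Z"
      by (rule Mor_eqI) (use gh(1) z q f in \<open>auto simp: Mor_def Dom_in_Ob Cod_in_Ob\<close>)
    finally show ?thesis .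
  qed
  ultimately show "g = h" using u[of "g \<cdot> q" Z] gh by metis
qed

lemma short_exactD:
  assumes "short_exact C k q"
  shows "is_mono C k" "is_epi C q" "k \<in> Arr C" "q \<in> Arr C" "Dom C q = Cod C k"
  using assms is_kernel_is_mono[of k q] is_cokernel_is_epi[of q k] unfolding short_exact_def
  by (auto simp: is_mono_def is_epi_def is_cokernel_def Mor_def)

lemma mono_short_exact:
  assumes m: "is_mono C m"
  obtains q where "short_exact C m q"
proof -
  have mA: "m \<in> Arr C" using m by (simp add: is_mono_def)
  obtain g where g: "is_kernel C m g" using mono_is_kernel[OF m] ..
  obtain q where q: "is_cokernel C q m" using ex_cokernel[OF mA] ..
  have gA: "g \<in> Arr C" "Cod C m = Dom C g" "g \<cdot> m = Zero C (Dom C m) (Cod C g)"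
    using g by (auto simp: is_kernel_def Mor_def)
  have qA: "q \<in> Arr C" "Dom C q = Cod C m" "q \<cdot> m = Zero C (Dom C m) (Cod C q)"
    using q by (auto simp: is_cokernel_def Mor_def)
  obtain t where t: "t \<in> Mor C (Cod C q) (Cod C g)" "t \<cdot> q = g"
    by (rule cokernel_factor[OF q, of g]) (use gA in \<open>simp_all add: Mor_def\<close>)
  have "is_kernel C m q"
    unfolding is_kernel_def
  proof (intro conjI allI ballI impI)
    show "q \<in> Arr C" "m \<in> Mor C (Dom C m) (Dom C q)" "q \<cdot> m = Zero C (Dom C m) (Cod C q)"
      using qA mA by (auto simp: Mor_def)
    fix Z h assume h: "h \<in> Mor C Z (Dom C q)" "q \<cdot> h = Zero C Z (Cod C q)"
    have "g \<cdot> h = Zero C Z (Cod C g)"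
    proof (rule Mor_eqI)
      fix x assume x: "x \<in> Fob F (Dom C (Zero C Z (Cod C g)))"
      have Z: "Z \<in> Ob C" "Cod C g \<in> Ob C" "Cod C q \<in> Ob C"
        using h gA qA Mor_Ob[OF h(1)] by (auto simp: Cod_in_Ob)
      have "Farr F (t \<cdot> q) (Farr F h x) = Farr F t (Farr F (q \<cdot> h) x)"
        using x h(1) t(1) qA Z by (simp add: Mor_def)
      also have "\<dots> = 0" unfolding h(2) using x Z t(1) by (simp add: Mor_def)
      finally show "Farr F (g \<cdot> h) x = Farr F (Zero C Z (Cod C g)) x"
        using x h(1) t gA qA Z by (simp add: Mor_def)
    qed (use h(1) gA qA Mor_Ob[OF h(1)] in \<open>auto simp: Mor_def Cod_in_Ob\<close>)
    moreover have "h \<in> Mor C Z (Dom C g)" using h(1) gA(2) qA(2) by simp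
    ultimately show "\<exists>!t. t \<in> Mor C Z (Dom C m) \<and> m \<cdot> t = h"
      using g unfolding is_kernel_def by blast
  qed
  then have "short_exact C m q" using q by (simp add: short_exact_def)
  then show thesis by (rule that)
qed

lemma epi_short_exact:
  assumes e: "is_epi C e"
  obtains k where "short_exact C k e"
proof -
  have eA: "e \<in> Arr C" using e by (simp add: is_epi_def)
  obtain g where g: "is_cokernel C e g" using epi_is_cokernel[OF e] ..
  obtain k where k: "is_kernel C k e" using ex_kernel[OF eA] ..
  have gA: "g \<in> Arr C" "Cod C g = Dom C e" "e \<cdot> g = Zero C (Dom C g) (Cod C e)"
    using g by (auto simp: is_cokernel_def Mor_def)
  have kA: "k \<in> Arr C" "Dom C e = Cod C k" "e \<cdot> k = Zero C (Dom C k) (Cod C e)"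
    using k by (auto simp: is_kernel_def Mor_def)
  obtain t where t: "t \<in> Mor C (Dom C g) (Dom C k)" "k \<cdot> t = g"
    by (rule kernel_factor[OF k, of g]) (use gA in \<open>simp_all add: Mor_def\<close>)
  have "is_cokernel C e k"
    unfolding is_cokernel_def
  proof (intro conjI allI ballI impI)
    show "k \<in> Arr C" "e \<in> Mor C (Cod C k) (Cod C e)" "e \<cdot> k = Zero C (Dom C k) (Cod C e)"
      using kA eA by (auto simp: Mor_def)
    fix Z h assume h: "h \<in> Mor C (Cod C k) Z" "h \<cdot> k = Zero C (Dom C k) Z"
    have "h \<cdot> g = Zero C (Dom C g) Z"
    proof (rule Mor_eqI)
      fix x assume x: "x \<in> Fob F (Dom C (Zero C (Dom C g) Z))"
      have Z: "Z \<in> Ob C" "Dom C g \<in> Ob C" "Dom C k \<in> Ob C"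
        using h gA kA Mor_Ob[OF h(1)] by (auto simp: Dom_in_Ob)
      have "Farr F h (Farr F (k \<cdot> t) x) = Farr F (h \<cdot> k) (Farr F t x)"
        using x h(1) t(1) kA Z by (simp add: Mor_def)
      also have "\<dots> = 0" unfolding h(2) using x Z t(1) by (simp add: Mor_def)
      finally show "Farr F (h \<cdot> g) x = Farr F (Zero C (Dom C g) Z) x"
        using x h(1) t gA kA Z by (simp add: Mor_def)
    qed (use h(1) gA kA Mor_Ob[OF h(1)] in \<open>auto simp: Mor_def Dom_in_Ob\<close>)
    moreover have "h \<in> Mor C (Cod C g) Z" using h(1) gA(2) kA(2) by simp
    ultimately show "\<exists>!t. t \<in> Mor C (Cod C e) Z \<and> t \<cdot> e = h"
      using g unfolding is_cokernel_def by blast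
  qed
  then have "short_exact C k e" using k by (simp add: short_exact_def)
  then show thesis by (rule that)
qed

lemma mono_iff_inj: "f \<in> Arr C \<Longrightarrow> is_mono C f \<longleftrightarrow> inj_on (Farr F f) (Fob F (Dom C f))"
proof
  assume "is_mono C f"
  then show "inj_on (Farr F f) (Fob F (Dom C f))" by (metis mono_short_exact Farr_exact)
next
  assume f: "f \<in> Arr C" and i: "inj_on (Farr F f) (Fob F (Dom C f))"
  show "is_mono C f"
    unfolding is_mono_def
  proof (intro conjI allI ballI impI)
    fix Z g h assume gh: "g \<in> Mor C Z (Dom C f)" "h \<in> Mor C Z (Dom C f)" "f \<cdot> g = f \<cdot> h"
    show "g = h"
    proof (rule Farr_faithful[OF gh(1,2)])
      fix x assume x: "x \<in> Fob F Z"
      have "Farr F (f \<cdot> g) x = Farr F (f \<cdot> h) x" using gh by simp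
      then have "Farr F f (Farr F g x) = Farr F f (Farr F h x)"
        using f gh(1,2) x by (simp add: Mor_def)
      moreover have "Farr F g x \<in> Fob F (Dom C f)" "Farr F h x \<in> Fob F (Dom C f)"
        using f gh(1,2) x by (auto simp: Mor_def)
      ultimately show "Farr F g x = Farr F h x" using i by (simp add: inj_on_def)
    qed
  qed (rule f)
qed

lemma epi_iff_surj: "f \<in> Arr C \<Longrightarrow> is_epi C f \<longleftrightarrow> Farr F f ` Fob F (Dom C f) = Fob F (Cod C f)"
proof
  assume "is_epi C f"
  then show "Farr F f ` Fob F (Dom C f) = Fob F (Cod C f)" by (metis epi_short_exact Farr_exact)
next
  assume f: "f \<in> Arr C" and i: "Farr F f ` Fob F (Dom C f) = Fob F (Cod C f)"
  show "is_epi C f"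
    unfolding is_epi_def
  proof (intro conjI allI ballI impI)
    fix Z g h assume gh: "g \<in> Mor C (Cod C f) Z" "h \<in> Mor C (Cod C f) Z" "g \<cdot> f = h \<cdot> f"
    show "g = h"
    proof (rule Farr_faithful[OF gh(1,2)])
      fix y assume "y \<in> Fob F (Cod C f)"
      then obtain x where x: "x \<in> Fob F (Dom C f)" "y = Farr F f x" using i by auto
      have "Farr F (g \<cdot> f) x = Farr F (h \<cdot> f) x" using gh by simp
      then show "Farr F g y = Farr F h y"
        using f gh(1,2) x by (simp add: Mor_def)
    qed
  qed (rule f)
qed

lemma mono_inj:
  "is_mono C f \<Longrightarrow> x \<in> Fob F (Dom C f) \<Longrightarrow> y \<in> Fob F (Dom C f) \<Longrightarrow> Farr F f x = Farr F f y \<Longrightarrow> x = y"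
  using mono_iff_inj[of f] by (auto simp: is_mono_def inj_on_def)

lemma mono_inj0:
  assumes "is_mono C f" "x \<in> Fob F (Dom C f)" "Farr F f x = 0"
  shows "x = 0"
proof -
  have "f \<in> Arr C" using assms by (simp add: is_mono_def)
  then show ?thesis using mono_inj[OF assms(1,2), of 0] assms(3) Dom_in_Ob[of f] by simp
qed

lemma inj0_mono:
  assumes "f \<in> Arr C" and "\<And>x. x \<in> Fob F (Dom C f) \<Longrightarrow> Farr F f x = 0 \<Longrightarrow> x = 0"
  shows "is_mono C f"
  unfolding mono_iff_inj[OF assms(1)]
proof (rule inj_onI)
  fix x y assume xy: "x \<in> Fob F (Dom C f)" "y \<in> Fob F (Dom C f)" "Farr F f x = Farr F f y"
  then have "x - y \<in> Fob F (Dom C f)" "Farr F f (x - y) = 0"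
    using assms(1) Dom_in_Ob[OF assms(1)] by auto
  from assms(2)[OF this] show "x = y" by simp
qed

lemma epi_surj:
  assumes "is_epi C f" "y \<in> Fob F (Cod C f)"
  obtains x where "x \<in> Fob F (Dom C f)" "Farr F f x = y"
proof -
  have "f \<in> Arr C" using assms by (simp add: is_epi_def)
  then have "y \<in> Farr F f ` Fob F (Dom C f)" using epi_iff_surj assms by simp
  then show thesis using that by auto
qed

lemma surj_epi:
  assumes "f \<in> Arr C" "\<And>y. y \<in> Fob F (Cod C f) \<Longrightarrow> \<exists>x \<in> Fob F (Dom C f). Farr F f x = y"
  shows "is_epi C f"
  unfolding epi_iff_surj[OF assms(1)] using assms(2) Farr_in[OF assms(1) refl] by force

lemma factor_through_mono:
  assumes m: "is_mono C m" and f: "f \<in> Mor C X (Cod C m)"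
    and im: "\<And>x. x \<in> Fob F X \<Longrightarrow> Farr F f x \<in> Farr F m ` Fob F (Dom C m)"
  obtains t where "t \<in> Mor C X (Dom C m)" "m \<cdot> t = f"
proof -
  obtain q where q: "short_exact C m q" using mono_short_exact[OF m] .
  have qA: "q \<in> Arr C" "Dom C q = Cod C m" and k: "is_kernel C m q"
    using q by (auto simp: short_exact_def is_cokernel_def Mor_def)
  have "q \<cdot> f = Zero C X (Cod C q)"
  proof (rule Mor_eqI)
    fix x assume "x \<in> Fob F (Dom C (Zero C X (Cod C q)))"
    then have x: "x \<in> Fob F X" using Mor_Ob[OF f] Cod_in_Ob[OF qA(1)] by simp
    have "Farr F q (Farr F f x) = 0" using im[OF x] Farr_exact[OF q] by auto
    then show "Farr F (q \<cdot> f) x = Farr F (Zero C X (Cod C q)) x"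
      using x f qA Mor_Ob[OF f] Cod_in_Ob[OF qA(1)] by (simp add: Mor_def)
  qed (use f qA Mor_Ob[OF f] in \<open>auto simp: Mor_def Cod_in_Ob\<close>)
  then have "\<exists>t. t \<in> Mor C X (Dom C m) \<and> m \<cdot> t = f"
    using k f qA(2) unfolding is_kernel_def by metis
  then show thesis using that by blast
qed

lemma factor_through_epi:
  assumes e: "is_epi C e" and f: "f \<in> Mor C (Dom C e) Z"
    and ker: "\<And>x. x \<in> Fob F (Dom C e) \<Longrightarrow> Farr F e x = 0 \<Longrightarrow> Farr F f x = 0"
  obtains t where "t \<in> Mor C (Cod C e) Z" "t \<cdot> e = f"
proof -
  obtain k where k: "short_exact C k e" using epi_short_exact[OF e] .
  have kA: "k \<in> Arr C" "Dom C e = Cod C k" and c: "is_cokernel C e k"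
    using k by (auto simp: short_exact_def is_cokernel_def Mor_def)
  have "f \<cdot> k = Zero C (Dom C k) Z"
  proof (rule Mor_eqI)
    fix x assume "x \<in> Fob F (Dom C (Zero C (Dom C k) Z))"
    then have x: "x \<in> Fob F (Dom C k)" using Mor_Ob[OF f] Dom_in_Ob[OF kA(1)] by simp
    have "Farr F f (Farr F k x) = 0" using x ker kA(2) Farr_exact[OF k] by auto
    then show "Farr F (f \<cdot> k) x = Farr F (Zero C (Dom C k) Z) x"
      using x f kA Mor_Ob[OF f] Dom_in_Ob[OF kA(1)] by (simp add: Mor_def)
  qed (use f kA Mor_Ob[OF f] in \<open>auto simp: Mor_def Dom_in_Ob\<close>)
  then have "\<exists>t. t \<in> Mor C (Cod C e) Z \<and> t \<cdot> e = f"
    using c f kA(2) unfolding is_cokernel_def by metis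
  then show thesis using that by blast
qed

lemma image_factorization:
  assumes f: "f \<in> Mor C X Y"
  obtains I e m where "e \<in> Mor C X I" "is_epi C e" "m \<in> Mor C I Y" "is_mono C m" "m \<cdot> e = f"
proof -
  have fA: "f \<in> Arr C" "Dom C f = X" "Cod C f = Y" and XY: "X \<in> Ob C" "Y \<in> Ob C"
    using f Mor_Ob[OF f] by (auto simp: Mor_def)
  obtain q where q: "is_cokernel C q f" using ex_cokernel[OF fA(1)] ..
  have qA: "q \<in> Arr C" "Dom C q = Y" "q \<cdot> f = Zero C X (Cod C q)"
    using q fA by (auto simp: is_cokernel_def Mor_def)
  obtain m where m: "is_kernel C m q" using ex_kernel[OF qA(1)] ..
  have mA: "m \<in> Arr C" "Cod C m = Y" "q \<cdot> m = Zero C (Dom C m) (Cod C q)"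
    using m qA by (auto simp: is_kernel_def Mor_def)
  have mm: "is_mono C m" using is_kernel_is_mono[OF m] .
  obtain e where e: "e \<in> Mor C X (Dom C m)" "m \<cdot> e = f"
    by (rule kernel_factor[OF m, of f X]) (use f qA in simp_all)
  have eA: "e \<in> Arr C" "Dom C e = X" "Cod C e = Dom C m" using e by (auto simp: Mor_def)
  have I: "Dom C m \<in> Ob C" using mA Dom_in_Ob by auto
  \<comment> \<open>If \<open>g\<close> and \<open>h\<close> agree on \<open>e\<close>, the kernel \<open>n\<close> of \<open>g - h\<close> gives a subobject \<open>m \<cdot> n\<close> through which
    \<open>f\<close> factors; hence it contains the image \<open>m\<close>, and \<open>g = h\<close>.\<close>
  have "is_epi C e"
    unfolding is_epi_def
  proof (intro conjI allI ballI impI)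
    fix Z g h assume gh: "g \<in> Mor C (Cod C e) Z" "h \<in> Mor C (Cod C e) Z" "g \<cdot> e = h \<cdot> e"
    have Z: "Z \<in> Ob C" using Mor_Ob[OF gh(1)] by simp
    have gA: "g \<in> Arr C" "Dom C g = Dom C m" "Cod C g = Z"
      "h \<in> Arr C" "Dom C h = Dom C m" "Cod C h = Z" using gh eA by (auto simp: Mor_def)
    define d where "d = g \<boxplus> (- 1) \<star> h"
    have dA: "d \<in> Arr C" "Dom C d = Dom C m" "Cod C d = Z" using gA by (auto simp: d_def)
    have dx: "Farr F d x = Farr F g x - Farr F h x" if "x \<in> Fob F (Dom C m)" for x
      using that gA by (simp add: d_def)
    have de: "Farr F d (Farr F e x) = 0" if x: "x \<in> Fob F X" for x
    proof -
      have "Farr F (g \<cdot> e) x = Farr F (h \<cdot> e) x" using gh(3) by simp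
      then show ?thesis using x gA eA dx[of "Farr F e x"] by simp
    qed
    obtain n where n: "is_kernel C n d" using ex_kernel[OF dA(1)] ..
    have nA: "n \<in> Arr C" "Cod C n = Dom C m" "d \<cdot> n = Zero C (Dom C n) Z"
      using n dA by (auto simp: is_kernel_def Mor_def)
    have d_e: "d \<cdot> e = Zero C X Z"
      by (rule Mor_eqI) (use eA dA de XY Z in auto)
    obtain t where t: "t \<in> Mor C X (Dom C n)" "n \<cdot> t = e"
      by (rule kernel_factor[OF n, of e X, unfolded dA]) (use e d_e in auto)
    have nm: "is_mono C n" using is_kernel_is_mono[OF n] .
    have "is_mono C (m \<cdot> n)"
      by (rule inj0_mono) (use mA(1) nA(1,2) mono_inj0[OF mm] mono_inj0[OF nm] in auto)
    then obtain c where c: "short_exact C (m \<cdot> n) c" using mono_short_exact by blast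
    have cA: "c \<in> Arr C" "Dom C c = Y" "c \<cdot> (m \<cdot> n) = Zero C (Dom C n) (Cod C c)"
      using c mA nA by (auto simp: short_exact_def is_cokernel_def Mor_def)
    have cO: "Cod C c \<in> Ob C" "Dom C n \<in> Ob C" using cA nA Cod_in_Ob Dom_in_Ob by auto
    have "c \<cdot> f = Zero C X (Cod C c)"
    proof (rule Mor_eqI)
      fix x assume "x \<in> Fob F (Dom C (Zero C X (Cod C c)))"
      then have x: "x \<in> Fob F X" using XY cO by simp
      have tA: "t \<in> Arr C" "Dom C t = X" "Cod C t = Dom C n" using t by (auto simp: Mor_def)
      have "Farr F (m \<cdot> e) x = Farr F m (Farr F (n \<cdot> t) x)"
        unfolding t(2) using x mA eA by simp
      also have "\<dots> = Farr F (m \<cdot> n) (Farr F t x)" using x mA nA tA by simp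
      finally have "Farr F c (Farr F f x) = Farr F (c \<cdot> (m \<cdot> n)) (Farr F t x)"
        unfolding e(2) using x mA nA tA cA(1,2) by simp
      also have "\<dots> = 0" unfolding cA(3) using x tA cO by simp
      finally show "Farr F (c \<cdot> f) x = Farr F (Zero C X (Cod C c)) x"
        using x fA cA XY cO by simp
    qed (use cA fA XY cO in auto)
    note c_f = this
    obtain c' where c': "c' \<in> Mor C (Cod C q) (Cod C c)" "c' \<cdot> q = c"
      by (rule cokernel_factor[OF q, of c, unfolded fA]) (use cA c_f in \<open>auto simp: Mor_def\<close>)
    have c'A: "c' \<in> Arr C" "Dom C c' = Cod C q" "Cod C c' = Cod C c" using c' by (auto simp: Mor_def)
    show "g = h"
    proof (rule Mor_eqI)
      fix x assume "x \<in> Fob F (Dom C h)"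
      then have x: "x \<in> Fob F (Dom C m)" using gA by simp
      have qO: "Cod C q \<in> Ob C" using qA Cod_in_Ob by simp
      have "Farr F (c' \<cdot> q) (Farr F m x) = Farr F c' (Farr F (q \<cdot> m) x)"
        using x c'A qA(1,2) mA(1,2) by simp
      also have "\<dots> = 0" unfolding mA(3) using x qO I c'A by simp
      finally have "Farr F c (Farr F m x) = 0" unfolding c'(2) .
      moreover have "Farr F m x \<in> Fob F (Cod C (m \<cdot> n))" using x mA nA by simp
      ultimately have "Farr F m x \<in> Farr F (m \<cdot> n) ` Fob F (Dom C (m \<cdot> n))"
        using Farr_exact[OF c] by blast
      then obtain y where y: "y \<in> Fob F (Dom C n)" "Farr F m x = Farr F m (Farr F n y)"
        using mA nA by auto
      have "x = Farr F n y" by (rule mono_inj[OF mm]) (use x y nA in auto)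
      then have "Farr F d x = Farr F (d \<cdot> n) y" using dA nA(1,2) y by simp
      also have "\<dots> = 0" unfolding nA(3) using y cO Z by simp
      finally show "Farr F g x = Farr F h x" using dx[OF x] by simp
    qed (use gA in auto)
  qed (rule eA)
  then show thesis using that[OF e(1) _ _ mm e(2)] mA by (auto simp: Mor_def)
qed

lemma kernel_fibre:
  assumes k: "is_kernel C k f"
  shows "Farr F k ` Fob F (Dom C k) = {x \<in> Fob F (Dom C f). Farr F f x = 0}"
proof -
  have fA: "f \<in> Arr C" and kA: "k \<in> Arr C" "Cod C k = Dom C f" "f \<cdot> k = Zero C (Dom C k) (Cod C f)"
    using k by (auto simp: is_kernel_def Mor_def)
  have O: "Dom C f \<in> Ob C" "Cod C f \<in> Ob C" "Dom C k \<in> Ob C"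
    using fA kA Dom_in_Ob Cod_in_Ob by auto
  have "f \<in> Mor C (Dom C f) (Cod C f)" using fA by (simp add: Mor_def)
  then obtain I e m where em: "e \<in> Mor C (Dom C f) I" "is_epi C e" "m \<in> Mor C I (Cod C f)"
    "is_mono C m" "m \<cdot> e = f" by (rule image_factorization)
  have A: "e \<in> Arr C" "Dom C e = Dom C f" "Cod C e = I" "m \<in> Arr C" "Dom C m = I" "Cod C m = Cod C f"
    using em by (auto simp: Mor_def)
  obtain k' where k': "short_exact C k' e" using epi_short_exact[OF em(2)] .
  have k'A: "k' \<in> Arr C" "Cod C k' = Dom C f" using k' A by (auto simp: short_exact_def is_kernel_def Mor_def)
  have fx: "Farr F f x = Farr F m (Farr F e x)" if "x \<in> Fob F (Dom C f)" for x
    using em(5) A that by (metis Farr_comp)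
  have ek': "Farr F e (Farr F k' x) = 0" if "x \<in> Fob F (Dom C k')" for x
    using Farr_exact[OF k'] that by auto
  have f_k': "f \<cdot> k' = Zero C (Dom C k') (Cod C f)"
    by (rule Mor_eqI) (use k'A fA A O fx ek' Dom_in_Ob[OF k'A(1)] in auto)
  obtain t where t: "t \<in> Mor C (Dom C k') (Dom C k)" "k \<cdot> t = k'"
    by (rule kernel_factor[OF k, of k']) (use k'A f_k' in \<open>auto simp: Mor_def\<close>)
  have tA: "t \<in> Arr C" "Dom C t = Dom C k'" "Cod C t = Dom C k" using t by (auto simp: Mor_def)
  show ?thesis
  proof (intro equalityI subsetI)
    fix y assume "y \<in> Farr F k ` Fob F (Dom C k)"
    then obtain x where x: "x \<in> Fob F (Dom C k)" "y = Farr F k x" by auto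
    have "Farr F f y = Farr F (f \<cdot> k) x" using x fA kA(1,2) by simp
    then show "y \<in> {x \<in> Fob F (Dom C f). Farr F f x = 0}" unfolding kA(3) using x O kA by simp
  next
    fix y assume "y \<in> {x \<in> Fob F (Dom C f). Farr F f x = 0}"
    then have y: "y \<in> Fob F (Dom C f)" "Farr F f y = 0" by auto
    have "Farr F e y = 0"
      by (rule mono_inj0[OF em(4)]) (use y fx A in auto)
    then have "y \<in> Farr F k' ` Fob F (Dom C k')" using Farr_exact[OF k'] y k'A by auto
    then obtain x where x: "x \<in> Fob F (Dom C k')" "y = Farr F k' x" by auto
    then have "y = Farr F k (Farr F t x)" using t(2) tA kA by (metis Farr_comp)
    then show "y \<in> Farr F k ` Fob F (Dom C k)" using x tA by auto
  qed
qed

lemma short_exactI_fibre: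
  assumes k: "k \<in> Mor C X Y" and q: "q \<in> Mor C Y Z"
    and inj: "\<And>x. x \<in> Fob F X \<Longrightarrow> Farr F k x = 0 \<Longrightarrow> x = 0"
    and zero: "\<And>x. x \<in> Fob F X \<Longrightarrow> Farr F q (Farr F k x) = 0"
    and ker: "\<And>y. y \<in> Fob F Y \<Longrightarrow> Farr F q y = 0 \<Longrightarrow> \<exists>x \<in> Fob F X. Farr F k x = y"
    and surj: "\<And>z. z \<in> Fob F Z \<Longrightarrow> \<exists>y \<in> Fob F Y. Farr F q y = z"
  shows "short_exact C k q"
proof -
  have A: "k \<in> Arr C" "Dom C k = X" "Cod C k = Y" "q \<in> Arr C" "Dom C q = Y" "Cod C q = Z"
    using k q by (auto simp: Mor_def)
  have O: "X \<in> Ob C" "Y \<in> Ob C" "Z \<in> Ob C" using Mor_Ob[OF k] Mor_Ob[OF q] by auto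
  have mk: "is_mono C k" by (rule inj0_mono) (use A inj in auto)
  have eq: "is_epi C q" by (rule surj_epi) (use A surj in auto)
  have z: "q \<cdot> k = Zero C X Z" by (rule Mor_eqI) (use A O zero in auto)
  have "\<exists>!t. t \<in> Mor C V X \<and> k \<cdot> t = g" if g: "g \<in> Mor C V Y" "q \<cdot> g = Zero C V Z" for V g
  proof -
    have V: "V \<in> Ob C" using Mor_Ob[OF g(1)] by simp
    obtain t where t: "t \<in> Mor C V (Dom C k)" "k \<cdot> t = g"
    proof (rule factor_through_mono[OF mk, of g V])
      show "g \<in> Mor C V (Cod C k)" using g A by simp
      fix x assume x: "x \<in> Fob F V"
      have gx: "Farr F g x \<in> Fob F Y" using g(1) x by (simp add: Mor_def)
      have "Farr F q (Farr F g x) = Farr F (q \<cdot> g) x" using g(1) x A by (simp add: Mor_def)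
      then have "Farr F q (Farr F g x) = 0" unfolding g(2) using x V O by simp
      from ker[OF gx this] show "Farr F g x \<in> Farr F k ` Fob F (Dom C k)" using A by force
    qed
    then show ?thesis using mk A unfolding is_mono_def by (metis)
  qed
  moreover have "\<exists>!t. t \<in> Mor C Z V \<and> t \<cdot> q = g" if g: "g \<in> Mor C Y V" "g \<cdot> k = Zero C X V" for V g
  proof -
    have V: "V \<in> Ob C" using Mor_Ob[OF g(1)] by simp
    obtain t where t: "t \<in> Mor C (Cod C q) V" "t \<cdot> q = g"
    proof (rule factor_through_epi[OF eq, of g V])
      show "g \<in> Mor C (Dom C q) V" using g A by simp
      fix y assume y: "y \<in> Fob F (Dom C q)" "Farr F q y = 0"
      then obtain x where x: "x \<in> Fob F X" "Farr F k x = y" using ker A by auto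
      have "Farr F g y = Farr F (g \<cdot> k) x" using g(1) x A by (simp add: Mor_def)
      then show "Farr F g y = 0" unfolding g(2) using x V O by simp
    qed
    then show ?thesis using eq A unfolding is_epi_def by (metis)
  qed
  ultimately show ?thesis
    unfolding short_exact_def is_kernel_def is_cokernel_def using A z k q by auto
qed

end

section \<open>Tensor products and internal Homs on fibres\<close>

context neutral_tannakian
begin

sublocale VV: vector_space_pair "VScale F" "VScale F" ..

lemma subspace_projection:
  assumes "V.subspace S"
  obtains \<pi> where "Vector_Spaces.linear (VScale F) (VScale F) \<pi>" "\<And>v. \<pi> v \<in> S" "\<And>v. v \<in> S \<Longrightarrow> \<pi> v = v"
proof -
  have "Vector_Spaces.linear (VScale F) (VScale F) (\<lambda>x. x)" by (rule V.linear_ident)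
  then obtain g where "range g \<subseteq> S" "Vector_Spaces.linear (VScale F) (VScale F) g" "\<forall>v\<in>S. g v = v"
    using VV.linear_exists_left_inverse_on[of "\<lambda>x. x" S] assms by (auto simp: inj_on_def)
  then show thesis using that by blast
qed

lemma linear_extension:
  assumes h: "linear_between (VScale F) (Fob F X) U h" and X: "X \<in> Ob C"
  obtains h' where "Vector_Spaces.linear (VScale F) (VScale F) h'" "\<And>x. x \<in> Fob F X \<Longrightarrow> h' x = h x"
proof -
  obtain \<pi> where p: "Vector_Spaces.linear (VScale F) (VScale F) \<pi>" "\<And>v. \<pi> v \<in> Fob F X"
    "\<And>v. v \<in> Fob F X \<Longrightarrow> \<pi> v = v" using subspace_projection[OF Fob_subspace[OF X]] by blast
  have "Vector_Spaces.linear (VScale F) (VScale F) (\<lambda>x. h (\<pi> x))"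
    using p(2) h VV.linear_add[OF p(1)] VV.linear_scale[OF p(1)] V.vector_space_axioms
    by (auto simp: linear_between_def Vector_Spaces.linear_iff)
  then show thesis by (rule that) (use p in auto)
qed

lemma generalized_inverse:
  assumes t: "linear_between (VScale F) (Fob F X) (Fob F X) t" and X: "X \<in> Ob C"
  obtains g where "linear_between (VScale F) (Fob F X) (Fob F X) g"
    "\<And>x. x \<in> Fob F X \<Longrightarrow> t (g (t x)) = t x"
proof -
  obtain t' where t': "Vector_Spaces.linear (VScale F) (VScale F) t'" "\<And>x. x \<in> Fob F X \<Longrightarrow> t' x = t x"
    using linear_extension[OF t X] by blast
  obtain g where g: "range g \<subseteq> Fob F X" "Vector_Spaces.linear (VScale F) (VScale F) g"
    "\<forall>v \<in> t' ` Fob F X. t' (g v) = v"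
    using VV.linear_exists_right_inverse_on[OF t'(1) Fob_subspace[OF X]] by blast
  have "linear_between (VScale F) (Fob F X) (Fob F X) g"
    using g(1) VV.linear_add[OF g(2)] VV.linear_scale[OF g(2)] by (auto simp: linear_between_def)
  moreover have "t (g (t x)) = t x" if "x \<in> Fob F X" for x
    using g(1,3) t'(2) that by (metis imageI rangeI subsetD)
  ultimately show thesis by (rule that)
qed

lemma Fmult_bilinear:
  "X \<in> Ob C \<Longrightarrow> Y \<in> Ob C \<Longrightarrow>
    bilinear_between (VScale F) (Fob F X) (Fob F Y) (Fob F (X \<otimes>\<^sub>o Y)) (Fmult F X Y)"
  using Fmult_tensor_product unfolding is_tensor_product_def by blast

lemma Fmult_simps [simp]:
  assumes "X \<in> Ob C" "Y \<in> Ob C" "x \<in> Fob F X" "y \<in> Fob F Y"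
  shows "Fmult F X Y x y \<in> Fob F (X \<otimes>\<^sub>o Y)"
    "x' \<in> Fob F X \<Longrightarrow> Fmult F X Y (x + x') y = Fmult F X Y x y + Fmult F X Y x' y"
    "y' \<in> Fob F Y \<Longrightarrow> Fmult F X Y x (y + y') = Fmult F X Y x y + Fmult F X Y x y'"
    "Fmult F X Y (VScale F c x) y = VScale F c (Fmult F X Y x y)"
    "Fmult F X Y x (VScale F c y) = VScale F c (Fmult F X Y x y)"
  using Fmult_bilinear[OF assms(1,2)] assms
  by (auto simp: bilinear_between_def linear_between_def)

lemma Fmult_zero [simp]:
  assumes "X \<in> Ob C" "Y \<in> Ob C"
  shows "y \<in> Fob F Y \<Longrightarrow> Fmult F X Y 0 y = 0" "x \<in> Fob F X \<Longrightarrow> Fmult F X Y x 0 = 0"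
  using Fmult_simps(4)[OF assms, of 0 y 0] Fmult_simps(5)[OF assms, of x 0 0] assms by (auto simp del: Fmult_simps)

lemma Fmult_uminus [simp]:
  assumes "X \<in> Ob C" "Y \<in> Ob C" "x \<in> Fob F X" "y \<in> Fob F Y"
  shows "Fmult F X Y (- x) y = - Fmult F X Y x y" "Fmult F X Y x (- y) = - Fmult F X Y x y"
  using Fmult_simps(4,5)[OF assms, of "- 1"] by (auto simp del: Fmult_simps)

lemma Fmult_diff_left [simp]:
  assumes "X \<in> Ob C" "Y \<in> Ob C" "x \<in> Fob F X" "x' \<in> Fob F X" "y \<in> Fob F Y"
  shows "Fmult F X Y (x - x') y = Fmult F X Y x y - Fmult F X Y x' y"
  using Fmult_simps(2)[OF assms(1-3,5), of "- x'"] assms by simp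

lemma Fmult_diff_right [simp]:
  assumes "X \<in> Ob C" "Y \<in> Ob C" "x \<in> Fob F X" "y \<in> Fob F Y" "y' \<in> Fob F Y"
  shows "Fmult F X Y x (y - y') = Fmult F X Y x y - Fmult F X Y x y'"
  using Fmult_simps(3)[OF assms(1-4), of "- y'"] assms by simp

lemma Farr_Tmor [simp]:
  assumes "f \<in> Arr C" "g \<in> Arr C" "Dom C f = X" "Dom C g = Y" "x \<in> Fob F X" "y \<in> Fob F Y"
  shows "Farr F (f \<otimes>\<^sub>m g) (Fmult F X Y x y) = Fmult F (Cod C f) (Cod C g) (Farr F f x) (Farr F g y)"
  by (rule Fmult_natural) (use assms in \<open>auto simp: Mor_def\<close>)

lemma Farr_Assoc [simp]:
  assumes "X \<in> Ob C" "Y \<in> Ob C" "Z \<in> Ob C" "x \<in> Fob F X" "y \<in> Fob F Y" "z \<in> Fob F Z"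
  shows "Farr F (Assoc C X Y Z) (Fmult F (X \<otimes>\<^sub>o Y) Z (Fmult F X Y x y) z) =
    Fmult F X (Y \<otimes>\<^sub>o Z) x (Fmult F Y Z y z)"
  by (rule Fmult_Assoc[OF assms])

text \<open>The pure tensors span: a linear projection onto their span agrees with the identity on them,
  so by the uniqueness half of the universal property it is the identity.\<close>
lemma tensor_induct [consumes 3, case_names pure add scale]:
  assumes z: "z \<in> Fob F (X \<otimes>\<^sub>o Y)" and X: "X \<in> Ob C" and Y: "Y \<in> Ob C"
    and pure: "\<And>x y. x \<in> Fob F X \<Longrightarrow> y \<in> Fob F Y \<Longrightarrow> P (Fmult F X Y x y)"
    and add: "\<And>z w. z \<in> Fob F (X \<otimes>\<^sub>o Y) \<Longrightarrow> w \<in> Fob F (X \<otimes>\<^sub>o Y) \<Longrightarrow> P z \<Longrightarrow> P w \<Longrightarrow> P (z + w)"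
    and scale: "\<And>c z. z \<in> Fob F (X \<otimes>\<^sub>o Y) \<Longrightarrow> P z \<Longrightarrow> P (VScale F c z)"
  shows "P z"
proof -
  let ?S = "{z \<in> Fob F (X \<otimes>\<^sub>o Y). P z}"
  have "P 0" using pure[of 0 0] X Y by simp
  then have "V.subspace ?S"
    unfolding V.subspace_def using add scale X Y by auto
  then obtain \<pi> where p: "Vector_Spaces.linear (VScale F) (VScale F) \<pi>" "\<And>v. \<pi> v \<in> ?S"
    "\<And>v. v \<in> ?S \<Longrightarrow> \<pi> v = v" using subspace_projection by blast
  have "linear_between (VScale F) (Fob F (X \<otimes>\<^sub>o Y)) UNIV \<pi>"
    using VV.linear_add[OF p(1)] VV.linear_scale[OF p(1)] by (auto simp: linear_between_def)
  moreover have "linear_between (VScale F) (Fob F (X \<otimes>\<^sub>o Y)) UNIV (\<lambda>v. v)"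
    by (auto simp: linear_between_def)
  moreover have "\<forall>x \<in> Fob F X. \<forall>y \<in> Fob F Y. \<pi> (Fmult F X Y x y) = Fmult F X Y x y"
    using p(3) pure X Y by simp
  ultimately have "\<pi> z = z"
    using Fmult_tensor_product[OF X Y] z unfolding is_tensor_product_def by blast
  then show ?thesis using p(2)[of z] by simp
qed

lemma tensor_linear_eqI:
  assumes X: "X \<in> Ob C" and Y: "Y \<in> Ob C"
    and f: "linear_between (VScale F) (Fob F (X \<otimes>\<^sub>o Y)) U f"
    and g: "linear_between (VScale F) (Fob F (X \<otimes>\<^sub>o Y)) U' g"
    and eq: "\<And>x y. x \<in> Fob F X \<Longrightarrow> y \<in> Fob F Y \<Longrightarrow> f (Fmult F X Y x y) = g (Fmult F X Y x y)"
    and z: "z \<in> Fob F (X \<otimes>\<^sub>o Y)"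
  shows "f z = g z"
  using z X Y by (induction rule: tensor_induct) (use f g eq in \<open>auto simp: linear_between_def\<close>)

lemma Mor_tensor_eqI:
  assumes f: "f \<in> Mor C (X \<otimes>\<^sub>o Y) Z" and g: "g \<in> Mor C (X \<otimes>\<^sub>o Y) Z" and X: "X \<in> Ob C" and Y: "Y \<in> Ob C"
    and eq: "\<And>x y. x \<in> Fob F X \<Longrightarrow> y \<in> Fob F Y \<Longrightarrow>
      Farr F f (Fmult F X Y x y) = Farr F g (Fmult F X Y x y)"
  shows "f = g"
  by (rule Farr_faithful[OF f g], rule tensor_linear_eqI[OF X Y Farr_linear[OF f] Farr_linear[OF g] eq])

text \<open>The element \<open>1\<close> of the fibre \<open>K\<close> of the unit object.\<close>
definition unit_vec :: 'v where
  "unit_vec = (SOME e. e \<noteq> 0 \<and> Fob F (Unit C) = V.span {e} \<and>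
     (\<forall>X \<in> Ob C. \<forall>x \<in> Fob F X. Farr F (LUnit C X) (Fmult F (Unit C) X e x) = x \<and>
           Farr F (RUnit C X) (Fmult F X (Unit C) x e) = x))"

lemma unit_vec:
  "unit_vec \<noteq> 0" "Fob F (Unit C) = V.span {unit_vec}" "unit_vec \<in> Fob F (Unit C)"
  and LUnit_fibre [simp]:
    "X \<in> Ob C \<Longrightarrow> x \<in> Fob F X \<Longrightarrow> Farr F (LUnit C X) (Fmult F (Unit C) X unit_vec x) = x"
  and RUnit_fibre [simp]:
    "X \<in> Ob C \<Longrightarrow> x \<in> Fob F X \<Longrightarrow> Farr F (RUnit C X) (Fmult F X (Unit C) x unit_vec) = x"
  using someI_ex[OF Fmult_Unit, folded unit_vec_def] V.span_base[of unit_vec "{unit_vec}"] by auto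

declare unit_vec(3) [simp]

lemma Unit_fibre_cases:
  assumes "x \<in> Fob F (Unit C)" obtains c where "x = VScale F c unit_vec"
  using assms unit_vec(2) by (auto simp: V.span_singleton)

lemma inverse_fibre:
  assumes "is_inverse C f g" "x \<in> Fob F (Dom C f)"
  shows "Farr F g (Farr F f x) = x"
proof -
  have "f \<in> Arr C" "g \<in> Arr C" "Dom C g = Cod C f" "g \<cdot> f = Ide C (Dom C f)"
    using assms by (auto simp: is_inverse_def Mor_def)
  then show ?thesis using Farr_comp[of f g x] Farr_ide[OF Dom_in_Ob assms(2)] assms(2) by metis
qed

lemma inverse_typing:
  assumes "is_inverse C f g" shows "g \<in> Arr C" "Dom C g = Cod C f" "Cod C g = Dom C f"
  using assms by (auto simp: is_inverse_def Mor_def)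

text \<open>For \<open>ev : H \<otimes> A \<rightarrow> B\<close>, a vector in the fibre of \<open>H\<close> acts as a linear map between the fibres of
  \<open>A\<close> and \<open>B\<close>.\<close>
abbreviation act :: "'o \<Rightarrow> 'o \<Rightarrow> 'm \<Rightarrow> 'v \<Rightarrow> 'v \<Rightarrow> 'v" where
  "act H A ev x a \<equiv> Farr F ev (Fmult F H A x a)"

lemma act_linear:
  assumes "ev \<in> Mor C (H \<otimes>\<^sub>o A) B" "H \<in> Ob C" "A \<in> Ob C" "x \<in> Fob F H"
  shows "linear_between (VScale F) (Fob F A) (Fob F B) (act H A ev x)"
  using assms by (auto simp: linear_between_def Mor_def)

text \<open>The pairing \<open>\<beta>\<close> is the evaluation; \<open>G a\<close> and \<open>L d\<close> contract \<open>A \<otimes> D\<close>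
  against \<open>a\<close> and \<open>d\<close>, and the two triangle identities say that contracting the coevaluation
  tensor gives back \<open>a\<close> and \<open>d\<close>.\<close>
lemma dual_fibre:
  assumes dual: "is_dual C A D \<epsilon> \<eta>"
  obtains \<beta> G L where
    "\<And>d a. d \<in> Fob F D \<Longrightarrow> a \<in> Fob F A \<Longrightarrow> Farr F \<epsilon> (Fmult F D A d a) = VScale F (\<beta> d a) unit_vec"
    "\<And>a. a \<in> Fob F A \<Longrightarrow> linear_between (VScale F) (Fob F (A \<otimes>\<^sub>o D)) (Fob F A) (G a)"
    "\<And>a a' d. a \<in> Fob F A \<Longrightarrow> a' \<in> Fob F A \<Longrightarrow> d \<in> Fob F D \<Longrightarrow> G a (Fmult F A D a' d) = VScale F (\<beta> d a) a'"
    "\<And>a. a \<in> Fob F A \<Longrightarrow> G a (Farr F \<eta> unit_vec) = a"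
    "\<And>d. d \<in> Fob F D \<Longrightarrow> linear_between (VScale F) (Fob F (A \<otimes>\<^sub>o D)) (Fob F D) (L d)"
    "\<And>d a d'. d \<in> Fob F D \<Longrightarrow> a \<in> Fob F A \<Longrightarrow> d' \<in> Fob F D \<Longrightarrow> L d (Fmult F A D a d') = VScale F (\<beta> d a) d'"
    "\<And>d. d \<in> Fob F D \<Longrightarrow> L d (Farr F \<eta> unit_vec) = d"
proof -
  have O: "A \<in> Ob C" "D \<in> Ob C" and eA: "\<epsilon> \<in> Arr C" "Dom C \<epsilon> = D \<otimes>\<^sub>o A" "Cod C \<epsilon> = Unit C"
    and hA: "\<eta> \<in> Arr C" "Dom C \<eta> = Unit C" "Cod C \<eta> = A \<otimes>\<^sub>o D"
    using dual by (auto simp: is_dual_def Mor_def)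
  have t1: "RUnit C A \<cdot> (Ide C A \<otimes>\<^sub>m \<epsilon>) \<cdot> Assoc C A D A \<cdot> (\<eta> \<otimes>\<^sub>m Ide C A) = LUnit C A"
    using dual by (simp add: is_dual_def)
  obtain s where s: "is_inverse C (Assoc C D A D) s"
    and t2: "LUnit C D \<cdot> (\<epsilon> \<otimes>\<^sub>m Ide C D) \<cdot> s \<cdot> (Ide C D \<otimes>\<^sub>m \<eta>) = RUnit C D"
    using dual by (auto simp: is_dual_def)
  have sA: "s \<in> Arr C" "Dom C s = D \<otimes>\<^sub>o (A \<otimes>\<^sub>o D)" "Cod C s = (D \<otimes>\<^sub>o A) \<otimes>\<^sub>o D"
    using inverse_typing[OF s] O by auto
  have sx: "Farr F s (Fmult F D (A \<otimes>\<^sub>o D) d (Fmult F A D a d')) = Fmult F (D \<otimes>\<^sub>o A) D (Fmult F D A d a) d'"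
    if "d \<in> Fob F D" "a \<in> Fob F A" "d' \<in> Fob F D" for d a d'
    using inverse_fibre[OF s, of "Fmult F (D \<otimes>\<^sub>o A) D (Fmult F D A d a) d'"] that O by simp
  have "\<forall>d a. \<exists>c. d \<in> Fob F D \<longrightarrow> a \<in> Fob F A \<longrightarrow> Farr F \<epsilon> (Fmult F D A d a) = VScale F c unit_vec"
    using Unit_fibre_cases eA O by (metis Farr_in Fmult_simps(1))
  then obtain \<beta> where b: "\<And>d a. d \<in> Fob F D \<Longrightarrow> a \<in> Fob F A \<Longrightarrow>
    Farr F \<epsilon> (Fmult F D A d a) = VScale F (\<beta> d a) unit_vec" by metis
  let ?g = "RUnit C A \<cdot> (Ide C A \<otimes>\<^sub>m \<epsilon>) \<cdot> Assoc C A D A"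
  let ?l = "LUnit C D \<cdot> (\<epsilon> \<otimes>\<^sub>m Ide C D) \<cdot> s"
  define G where "G a z = Farr F ?g (Fmult F (A \<otimes>\<^sub>o D) A z a)" for a z
  define L where "L d z = Farr F ?l (Fmult F D (A \<otimes>\<^sub>o D) d z)" for d z
  have z0: "Farr F \<eta> unit_vec \<in> Fob F (A \<otimes>\<^sub>o D)" using hA by simp
  show thesis
  proof (rule that[of \<beta> G L])
    show "linear_between (VScale F) (Fob F (A \<otimes>\<^sub>o D)) (Fob F A) (G a)" if "a \<in> Fob F A" for a
      using that O eA by (auto simp: linear_between_def G_def)
    show "linear_between (VScale F) (Fob F (A \<otimes>\<^sub>o D)) (Fob F D) (L d)" if "d \<in> Fob F D" for d
      using that O eA sA by (auto simp: linear_between_def L_def)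
    show "G a (Fmult F A D a' d) = VScale F (\<beta> d a) a'"
      if "a \<in> Fob F A" "a' \<in> Fob F A" "d \<in> Fob F D" for a a' d
      using that O eA by (simp add: G_def b)
    show "L d (Fmult F A D a d') = VScale F (\<beta> d a) d'"
      if "d \<in> Fob F D" "a \<in> Fob F A" "d' \<in> Fob F D" for d a d'
      using that O eA sA by (simp add: L_def sx b)
    show "G a (Farr F \<eta> unit_vec) = a" if "a \<in> Fob F A" for a
    proof -
      have "G a (Farr F \<eta> unit_vec) =
          Farr F (RUnit C A \<cdot> (Ide C A \<otimes>\<^sub>m \<epsilon>) \<cdot> Assoc C A D A \<cdot> (\<eta> \<otimes>\<^sub>m Ide C A)) (Fmult F (Unit C) A unit_vec a)"
        using that O eA hA z0 by (simp add: G_def)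
      then show ?thesis unfolding t1 using that O by simp
    qed
    show "L d (Farr F \<eta> unit_vec) = d" if "d \<in> Fob F D" for d
    proof -
      have "L d (Farr F \<eta> unit_vec) =
          Farr F (LUnit C D \<cdot> (\<epsilon> \<otimes>\<^sub>m Ide C D) \<cdot> s \<cdot> (Ide C D \<otimes>\<^sub>m \<eta>)) (Fmult F D (Unit C) d unit_vec)"
        using that O eA hA z0 sA by (simp add: L_def)
      then show ?thesis unfolding t2 using that O by simp
    qed
  qed (use b in auto)
qed

text \<open>The internal Hom is \<open>B \<otimes> D\<close> with \<open>D\<close> a dual of \<open>A\<close>, where \<open>b \<otimes> d\<close> acts as the rank-one map
  \<open>a \<mapsto> \<beta> d a \<cdot> b\<close>.  A linear map \<open>f\<close> is the action of the vector obtained by applying \<open>f\<close> to the first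
  factor of the coevaluation tensor, and a vector \<open>w\<close> is recovered from its action by the second
  triangle identity.\<close>
lemma dual_ihom:
  assumes A: "A \<in> Ob C" and B: "B \<in> Ob C"
  obtains H ev where "is_ihom C A B H ev"
    "\<And>x. x \<in> Fob F H \<Longrightarrow> (\<And>a. a \<in> Fob F A \<Longrightarrow> act H A ev x a = 0) \<Longrightarrow> x = 0"
    "\<And>f. linear_between (VScale F) (Fob F A) (Fob F B) f \<Longrightarrow>
       \<exists>x \<in> Fob F H. \<forall>a \<in> Fob F A. act H A ev x a = f a"
proof -
  obtain D \<epsilon> \<eta> where dual: "is_dual C A D \<epsilon> \<eta>" using ex_dual[OF A] by blast
  have D: "D \<in> Ob C" and eA: "\<epsilon> \<in> Arr C" "Dom C \<epsilon> = D \<otimes>\<^sub>o A" "Cod C \<epsilon> = Unit C"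
    and hA: "\<eta> \<in> Arr C" "Dom C \<eta> = Unit C" "Cod C \<eta> = A \<otimes>\<^sub>o D"
    using dual by (auto simp: is_dual_def Mor_def)
  obtain \<beta> G L where
    b: "\<And>d a. d \<in> Fob F D \<Longrightarrow> a \<in> Fob F A \<Longrightarrow> Farr F \<epsilon> (Fmult F D A d a) = VScale F (\<beta> d a) unit_vec"
    and G: "\<And>a. a \<in> Fob F A \<Longrightarrow> linear_between (VScale F) (Fob F (A \<otimes>\<^sub>o D)) (Fob F A) (G a)"
    "\<And>a a' d. a \<in> Fob F A \<Longrightarrow> a' \<in> Fob F A \<Longrightarrow> d \<in> Fob F D \<Longrightarrow> G a (Fmult F A D a' d) = VScale F (\<beta> d a) a'"
    "\<And>a. a \<in> Fob F A \<Longrightarrow> G a (Farr F \<eta> unit_vec) = a"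
    and L: "\<And>d. d \<in> Fob F D \<Longrightarrow> linear_between (VScale F) (Fob F (A \<otimes>\<^sub>o D)) (Fob F D) (L d)"
    "\<And>d a d'. d \<in> Fob F D \<Longrightarrow> a \<in> Fob F A \<Longrightarrow> d' \<in> Fob F D \<Longrightarrow> L d (Fmult F A D a d') = VScale F (\<beta> d a) d'"
    "\<And>d. d \<in> Fob F D \<Longrightarrow> L d (Farr F \<eta> unit_vec) = d"
    by (rule dual_fibre[OF dual]) blast
  have Gs: "G a z \<in> Fob F A" "G a (z + w) = G a z + G a w" "G a (VScale F c z) = VScale F c (G a z)"
    if "a \<in> Fob F A" "z \<in> Fob F (A \<otimes>\<^sub>o D)" "w \<in> Fob F (A \<otimes>\<^sub>o D)" for a z w c
    using G(1)[OF that(1)] that by (auto simp: linear_between_def)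
  have Ls: "L d z \<in> Fob F D" "L d (z + w) = L d z + L d w" "L d (VScale F c z) = VScale F c (L d z)"
    if "d \<in> Fob F D" "z \<in> Fob F (A \<otimes>\<^sub>o D)" "w \<in> Fob F (A \<otimes>\<^sub>o D)" for d z w c
    using L(1)[OF that(1)] that by (auto simp: linear_between_def)
  define z0 where "z0 = Farr F \<eta> unit_vec"
  have z0: "z0 \<in> Fob F (A \<otimes>\<^sub>o D)" using hA by (simp add: z0_def)
  define ev where "ev = RUnit C B \<cdot> (Ide C B \<otimes>\<^sub>m \<epsilon>) \<cdot> Assoc C B D A"
  have ev: "ev \<in> Arr C" "Dom C ev = (B \<otimes>\<^sub>o D) \<otimes>\<^sub>o A" "Cod C ev = B"
    using A B D eA by (auto simp: ev_def)
  have evx: "Farr F ev (Fmult F (B \<otimes>\<^sub>o D) A (Fmult F B D b' d) a) = VScale F (\<beta> d a) b'"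
    if "b' \<in> Fob F B" "d \<in> Fob F D" "a \<in> Fob F A" for b' d a
    using that A B D eA by (simp add: ev_def b)
  \<comment> \<open>For \<open>g : Z \<otimes> A \<rightarrow> B\<close> the arrow \<open>\<Gamma> : Z \<otimes> (A \<otimes> D) \<rightarrow> B \<otimes> D\<close> applies \<open>g\<close> to the first two factors;
    evaluating it at the coevaluation tensor gives the arrow adjoint to \<open>g\<close>.\<close>
  have \<Gamma>: "\<exists>\<Gamma>. \<Gamma> \<in> Mor C (Z \<otimes>\<^sub>o (A \<otimes>\<^sub>o D)) (B \<otimes>\<^sub>o D) \<and> (\<forall>x \<in> Fob F Z. \<forall>a \<in> Fob F A. \<forall>d \<in> Fob F D.
      Farr F \<Gamma> (Fmult F Z (A \<otimes>\<^sub>o D) x (Fmult F A D a d)) = Fmult F B D (Farr F g (Fmult F Z A x a)) d)"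
    if g: "g \<in> Mor C (Z \<otimes>\<^sub>o A) B" and Z: "Z \<in> Ob C" for Z g
  proof -
    obtain s where s: "is_inverse C (Assoc C Z A D) s" using Assoc_iso[OF Z A D] by (auto simp: is_iso_def)
    have sA: "s \<in> Arr C" "Dom C s = Z \<otimes>\<^sub>o (A \<otimes>\<^sub>o D)" "Cod C s = (Z \<otimes>\<^sub>o A) \<otimes>\<^sub>o D"
      using inverse_typing[OF s] Z A D by auto
    have sx: "Farr F s (Fmult F Z (A \<otimes>\<^sub>o D) x (Fmult F A D a d)) = Fmult F (Z \<otimes>\<^sub>o A) D (Fmult F Z A x a) d"
      if "x \<in> Fob F Z" "a \<in> Fob F A" "d \<in> Fob F D" for x a d
      using inverse_fibre[OF s, of "Fmult F (Z \<otimes>\<^sub>o A) D (Fmult F Z A x a) d"] that Z A D by simp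
    show ?thesis
      by (rule exI[of _ "(g \<otimes>\<^sub>m Ide C D) \<cdot> s"]) (use g sA sx A B D Z in \<open>auto simp: Mor_def\<close>)
  qed
  have ex: "\<exists>h \<in> Mor C Z (B \<otimes>\<^sub>o D). ev \<cdot> (h \<otimes>\<^sub>m Ide C A) = g"
    if g: "g \<in> Mor C (Z \<otimes>\<^sub>o A) B" and Z: "Z \<in> Ob C" for Z g
  proof -
    obtain \<Gamma> where \<Gamma>: "\<Gamma> \<in> Mor C (Z \<otimes>\<^sub>o (A \<otimes>\<^sub>o D)) (B \<otimes>\<^sub>o D)"
      and \<Gamma>x: "\<And>x a d. x \<in> Fob F Z \<Longrightarrow> a \<in> Fob F A \<Longrightarrow> d \<in> Fob F D \<Longrightarrow>
      Farr F \<Gamma> (Fmult F Z (A \<otimes>\<^sub>o D) x (Fmult F A D a d)) = Fmult F B D (Farr F g (Fmult F Z A x a)) d"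
      using \<Gamma>[OF g Z] by blast
    have \<Gamma>A: "\<Gamma> \<in> Arr C" "Dom C \<Gamma> = Z \<otimes>\<^sub>o (A \<otimes>\<^sub>o D)" "Cod C \<Gamma> = B \<otimes>\<^sub>o D" using \<Gamma> by (auto simp: Mor_def)
    have gA: "g \<in> Arr C" "Dom C g = Z \<otimes>\<^sub>o A" "Cod C g = B" using g by (auto simp: Mor_def)
    obtain u where u: "is_inverse C (RUnit C Z) u" using RUnit_iso[OF Z] by (auto simp: is_iso_def)
    have uA: "u \<in> Arr C" "Dom C u = Z" "Cod C u = Z \<otimes>\<^sub>o Unit C" using inverse_typing[OF u] Z by auto
    have ux: "Farr F u x = Fmult F Z (Unit C) x unit_vec" if "x \<in> Fob F Z" for x
      using inverse_fibre[OF u, of "Fmult F Z (Unit C) x unit_vec"] that Z by simp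
    define h where "h = \<Gamma> \<cdot> (Ide C Z \<otimes>\<^sub>m \<eta>) \<cdot> u"
    have h: "h \<in> Arr C" "Dom C h = Z" "Cod C h = B \<otimes>\<^sub>o D"
      using \<Gamma>A hA uA Z by (auto simp: h_def)
    have hx: "Farr F h x = Farr F \<Gamma> (Fmult F Z (A \<otimes>\<^sub>o D) x z0)" if "x \<in> Fob F Z" for x
      using that \<Gamma>A hA uA Z by (simp add: h_def ux z0_def)
    have key: "Farr F ev (Fmult F (B \<otimes>\<^sub>o D) A (Farr F \<Gamma> (Fmult F Z (A \<otimes>\<^sub>o D) x z)) a) = Farr F g (Fmult F Z A x (G a z))"
      if x: "x \<in> Fob F Z" and a: "a \<in> Fob F A" and z: "z \<in> Fob F (A \<otimes>\<^sub>o D)" for x a z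
      using z A D
    proof (induction rule: tensor_induct)
      case (pure a' d)
      then show ?case using x a A B D Z gA by (simp add: \<Gamma>x evx G(2))
    next
      case (add z w)
      then show ?case using x a A B D Z gA \<Gamma>A ev Gs by simp
    next
      case (scale c z)
      then show ?case using x a A B D Z gA \<Gamma>A ev Gs by simp
    qed
    have "ev \<cdot> (h \<otimes>\<^sub>m Ide C A) = g"
      by (rule Mor_tensor_eqI[OF _ g Z A])
        (use h ev A Z z0 key G(3) in \<open>auto simp: Mor_def hx z0_def\<close>)
    then show ?thesis using h by (auto simp: Mor_def)
  qed
  have inj: "w = 0" if w: "w \<in> Fob F (B \<otimes>\<^sub>o D)"
    and w0: "\<And>a. a \<in> Fob F A \<Longrightarrow> act (B \<otimes>\<^sub>o D) A ev w a = 0" for w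
  proof -
    have "ev \<in> Mor C ((B \<otimes>\<^sub>o D) \<otimes>\<^sub>o A) B" using ev by (simp add: Mor_def)
    from \<Gamma>[OF this] obtain \<Gamma> where \<Gamma>: "\<Gamma> \<in> Mor C ((B \<otimes>\<^sub>o D) \<otimes>\<^sub>o (A \<otimes>\<^sub>o D)) (B \<otimes>\<^sub>o D)"
      and \<Gamma>x: "\<And>x a d. x \<in> Fob F (B \<otimes>\<^sub>o D) \<Longrightarrow> a \<in> Fob F A \<Longrightarrow> d \<in> Fob F D \<Longrightarrow>
      Farr F \<Gamma> (Fmult F (B \<otimes>\<^sub>o D) (A \<otimes>\<^sub>o D) x (Fmult F A D a d)) =
        Fmult F B D (Farr F ev (Fmult F (B \<otimes>\<^sub>o D) A x a)) d"
      using B D by auto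
    have \<Gamma>A: "\<Gamma> \<in> Arr C" "Dom C \<Gamma> = (B \<otimes>\<^sub>o D) \<otimes>\<^sub>o (A \<otimes>\<^sub>o D)" "Cod C \<Gamma> = B \<otimes>\<^sub>o D"
      using \<Gamma> by (auto simp: Mor_def)
    have 1: "Farr F \<Gamma> (Fmult F (B \<otimes>\<^sub>o D) (A \<otimes>\<^sub>o D) w z) = 0" if "z \<in> Fob F (A \<otimes>\<^sub>o D)" for z
      using that A D
      by (induction rule: tensor_induct) (use w w0 \<Gamma>x \<Gamma>A A B D in auto)
    have 2: "Farr F \<Gamma> (Fmult F (B \<otimes>\<^sub>o D) (A \<otimes>\<^sub>o D) (Fmult F B D b' d) z) = Fmult F B D b' (L d z)"
      if z: "z \<in> Fob F (A \<otimes>\<^sub>o D)" and bd: "b' \<in> Fob F B" "d \<in> Fob F D" for z b' d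
      using z A D
    proof (induction rule: tensor_induct)
      case (pure a d')
      then show ?case using bd A B D by (simp add: \<Gamma>x evx L(2))
    next
      case (add z w)
      then show ?case using bd A B D \<Gamma>A Ls by simp
    next
      case (scale c z)
      then show ?case using bd A B D \<Gamma>A Ls by simp
    qed
    have "Farr F \<Gamma> (Fmult F (B \<otimes>\<^sub>o D) (A \<otimes>\<^sub>o D) w' z0) = w'" if "w' \<in> Fob F (B \<otimes>\<^sub>o D)" for w'
      using that B D
    proof (induction rule: tensor_induct)
      case (pure b' d)
      then show ?case using 2[OF z0] L(3) by (simp add: z0_def)
    next
      case (add z w)
      then show ?case using z0 A B D \<Gamma>A by simp
    next
      case (scale c z)
      then show ?case using z0 A B D \<Gamma>A by simp
    qed
    then show "w = 0" using 1[OF z0] w by simp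
  qed
  have uniq: "h = h'" if h: "h \<in> Mor C Z (B \<otimes>\<^sub>o D)" "h' \<in> Mor C Z (B \<otimes>\<^sub>o D)"
    and eq: "ev \<cdot> (h \<otimes>\<^sub>m Ide C A) = ev \<cdot> (h' \<otimes>\<^sub>m Ide C A)" for Z h h'
  proof (rule Farr_faithful[OF h])
    fix x assume x: "x \<in> Fob F Z"
    have Z: "Z \<in> Ob C" using Mor_Ob[OF h(1)] by simp
    have hA: "h \<in> Arr C" "Dom C h = Z" "Cod C h = B \<otimes>\<^sub>o D" "h' \<in> Arr C" "Dom C h' = Z" "Cod C h' = B \<otimes>\<^sub>o D"
      using h by (auto simp: Mor_def)
    have "Farr F h x - Farr F h' x = 0"
    proof (rule inj)
      show "Farr F h x - Farr F h' x \<in> Fob F (B \<otimes>\<^sub>o D)" using x hA B D by simp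
      fix a assume a: "a \<in> Fob F A"
      have "Farr F (ev \<cdot> (h \<otimes>\<^sub>m Ide C A)) (Fmult F Z A x a) = Farr F (ev \<cdot> (h' \<otimes>\<^sub>m Ide C A)) (Fmult F Z A x a)"
        by (simp add: eq)
      then show "act (B \<otimes>\<^sub>o D) A ev (Farr F h x - Farr F h' x) a = 0"
        using x a hA A B D ev Z by simp
    qed
    then show "Farr F h x = Farr F h' x" by simp
  qed
  have "is_ihom C A B (B \<otimes>\<^sub>o D) ev"
    unfolding is_ihom_def
  proof (intro conjI ballI)
    show "B \<otimes>\<^sub>o D \<in> Ob C" using B D by simp
    show "ev \<in> Mor C ((B \<otimes>\<^sub>o D) \<otimes>\<^sub>o A) B" using ev by (simp add: Mor_def)
    fix Z g assume Z: "Z \<in> Ob C" and g: "g \<in> Mor C (Z \<otimes>\<^sub>o A) B"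
    obtain h where h: "h \<in> Mor C Z (B \<otimes>\<^sub>o D)" "ev \<cdot> (h \<otimes>\<^sub>m Ide C A) = g" using ex[OF g Z] by blast
    show "\<exists>!h. h \<in> Mor C Z (B \<otimes>\<^sub>o D) \<and> ev \<cdot> (h \<otimes>\<^sub>m Ide C A) = g"
    proof (rule ex1I[of _ h])
      fix h' assume "h' \<in> Mor C Z (B \<otimes>\<^sub>o D) \<and> ev \<cdot> (h' \<otimes>\<^sub>m Ide C A) = g"
      then show "h' = h" using uniq[of h' Z h] h by simp
    qed (use h in simp)
  qed
  moreover have "\<exists>x \<in> Fob F (B \<otimes>\<^sub>o D). \<forall>a \<in> Fob F A. act (B \<otimes>\<^sub>o D) A ev x a = f a"
    if f: "linear_between (VScale F) (Fob F A) (Fob F B) f" for f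
  proof -
    have fs: "f a \<in> Fob F B" "f (a + a') = f a + f a'" "f (VScale F c a) = VScale F c (f a)"
      if "a \<in> Fob F A" "a' \<in> Fob F A" for a a' c
      using f that by (auto simp: linear_between_def)
    have "\<exists>x \<in> Fob F (B \<otimes>\<^sub>o D). \<forall>a \<in> Fob F A. act (B \<otimes>\<^sub>o D) A ev x a = f (G a z)"
      if "z \<in> Fob F (A \<otimes>\<^sub>o D)" for z
      using that A D
    proof (induction rule: tensor_induct)
      case (pure a' d)
      then show ?case
        by (intro bexI[of _ "Fmult F B D (f a') d"]) (use fs B D in \<open>auto simp: evx G(2)\<close>)
    next
      case (add z w)
      then obtain x y where "x \<in> Fob F (B \<otimes>\<^sub>o D)" "\<forall>a \<in> Fob F A. act (B \<otimes>\<^sub>o D) A ev x a = f (G a z)"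
        "y \<in> Fob F (B \<otimes>\<^sub>o D)" "\<forall>a \<in> Fob F A. act (B \<otimes>\<^sub>o D) A ev y a = f (G a w)" by blast
      then show ?case
        by (intro bexI[of _ "x + y"]) (use add fs Gs A B D ev in auto)
    next
      case (scale c z)
      then obtain x where "x \<in> Fob F (B \<otimes>\<^sub>o D)" "\<forall>a \<in> Fob F A. act (B \<otimes>\<^sub>o D) A ev x a = f (G a z)" by blast
      then show ?case
        by (intro bexI[of _ "VScale F c x"]) (use scale fs Gs A B D ev in auto)
    qed
    from this[OF z0] show ?thesis using G(3) by (simp add: z0_def)
  qed
  ultimately show thesis using that[of "B \<otimes>\<^sub>o D" ev] inj by blast
qed

lemma ex_ihom: "A \<in> Ob C \<Longrightarrow> B \<in> Ob C \<Longrightarrow> \<exists>H ev. is_ihom C A B H ev"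
  by (rule dual_ihom) blast+

lemma ihom_typing:
  assumes "is_ihom C A B H ev"
  shows "H \<in> Ob C" "ev \<in> Arr C" "Dom C ev = H \<otimes>\<^sub>o A" "Cod C ev = B"
  using assms by (auto simp: is_ihom_def Mor_def)

lemma ihom_lift:
  assumes "is_ihom C A B H ev" "A \<in> Ob C" "Z \<in> Ob C" "g \<in> Mor C (Z \<otimes>\<^sub>o A) B"
  obtains h where "h \<in> Mor C Z H" "ev \<cdot> (h \<otimes>\<^sub>m Ide C A) = g"
    "\<And>x a. x \<in> Fob F Z \<Longrightarrow> a \<in> Fob F A \<Longrightarrow> act H A ev (Farr F h x) a = Farr F g (Fmult F Z A x a)"
proof -
  obtain h where h: "h \<in> Mor C Z H" "ev \<cdot> (h \<otimes>\<^sub>m Ide C A) = g"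
    using assms unfolding is_ihom_def by metis
  have "act H A ev (Farr F h x) a = Farr F g (Fmult F Z A x a)" if "x \<in> Fob F Z" "a \<in> Fob F A" for x a
    unfolding h(2)[symmetric] using that h(1) ihom_typing[OF assms(1)] assms(2,3) by (simp add: Mor_def)
  then show thesis using that h by blast
qed

text \<open>An internal Hom is unique up to isomorphism, so the description of its fibre carries over from
  the one built from a dual.\<close>
lemma ihom_act_inj:
  assumes ih: "is_ihom C A B H ev" and A: "A \<in> Ob C" and B: "B \<in> Ob C" and x: "x \<in> Fob F H"
    and x0: "\<And>a. a \<in> Fob F A \<Longrightarrow> act H A ev x a = 0"
  shows "x = 0"
proof (rule dual_ihom[OF A B])
  fix H' ev' assume ih': "is_ihom C A B H' ev'"
    and inj: "\<And>x. x \<in> Fob F H' \<Longrightarrow> (\<And>a. a \<in> Fob F A \<Longrightarrow> act H' A ev' x a = 0) \<Longrightarrow> x = 0"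
  note T = ihom_typing[OF ih] ihom_typing[OF ih']
  have ev: "ev \<in> Mor C (H \<otimes>\<^sub>o A) B" "ev' \<in> Mor C (H' \<otimes>\<^sub>o A) B" using T by (auto simp: Mor_def)
  obtain g where g: "g \<in> Mor C H H'" "ev' \<cdot> (g \<otimes>\<^sub>m Ide C A) = ev"
    "\<And>x a. x \<in> Fob F H \<Longrightarrow> a \<in> Fob F A \<Longrightarrow> act H' A ev' (Farr F g x) a = act H A ev x a"
    by (rule ihom_lift[OF ih' A T(1) ev(1)]) blast
  obtain h where h: "h \<in> Mor C H' H" "ev \<cdot> (h \<otimes>\<^sub>m Ide C A) = ev'"
    "\<And>x a. x \<in> Fob F H' \<Longrightarrow> a \<in> Fob F A \<Longrightarrow> act H A ev (Farr F h x) a = act H' A ev' x a"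
    by (rule ihom_lift[OF ih A T(5) ev(2)]) blast
  have A': "g \<in> Arr C" "Dom C g = H" "Cod C g = H'" "h \<in> Arr C" "Dom C h = H'" "Cod C h = H"
    using g h by (auto simp: Mor_def)
  have hg: "h \<cdot> g \<in> Mor C H H" using A' by (simp add: Mor_def)
  have "ev \<cdot> ((h \<cdot> g) \<otimes>\<^sub>m Ide C A) = ev"
    by (rule Mor_tensor_eqI[OF _ ev(1) T(1) A]) (use A' T A g(3) h(3) in \<open>auto simp: Mor_def\<close>)
  moreover have "ev \<cdot> (Ide C H \<otimes>\<^sub>m Ide C A) = ev"
    by (rule Mor_tensor_eqI[OF _ ev(1) T(1) A]) (use T A in \<open>auto simp: Mor_def\<close>)
  moreover have "\<exists>!h. h \<in> Mor C H H \<and> ev \<cdot> (h \<otimes>\<^sub>m Ide C A) = ev"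
    using ih T(1) ev(1) unfolding is_ihom_def by blast
  ultimately have "h \<cdot> g = Ide C H" using hg Ide_in_Mor[OF T(1)] by blast
  then have "Farr F h (Farr F g x) = x" using A' x T(1) by (metis Farr_comp Farr_ide)
  moreover have "Farr F g x = 0" by (rule inj) (use x x0 A' g(3) in auto)
  ultimately show "x = 0" using A' by simp
qed

lemma ihom_act_eqI:
  assumes ih: "is_ihom C A B H ev" and A: "A \<in> Ob C" and B: "B \<in> Ob C" and x: "x \<in> Fob F H" "y \<in> Fob F H"
    and eq: "\<And>a. a \<in> Fob F A \<Longrightarrow> act H A ev x a = act H A ev y a"
  shows "x = y"
proof -
  have "x - y = 0"
    by (rule ihom_act_inj[OF ih A B]) (use x eq ihom_typing[OF ih] A in auto)
  then show ?thesis by simp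
qed

lemma ihom_act_surj:
  assumes ih: "is_ihom C A B H ev" and A: "A \<in> Ob C" and B: "B \<in> Ob C"
    and f: "linear_between (VScale F) (Fob F A) (Fob F B) f"
  obtains x where "x \<in> Fob F H" "\<And>a. a \<in> Fob F A \<Longrightarrow> act H A ev x a = f a"
proof (rule dual_ihom[OF A B])
  fix H' ev' assume ih': "is_ihom C A B H' ev'"
    and surj: "\<And>f. linear_between (VScale F) (Fob F A) (Fob F B) f \<Longrightarrow>
       \<exists>x \<in> Fob F H'. \<forall>a \<in> Fob F A. act H' A ev' x a = f a"
  note T = ihom_typing[OF ih] ihom_typing[OF ih']
  have ev': "ev' \<in> Mor C (H' \<otimes>\<^sub>o A) B" using T by (auto simp: Mor_def)
  obtain h where h: "h \<in> Mor C H' H" "ev \<cdot> (h \<otimes>\<^sub>m Ide C A) = ev'"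
    "\<And>x a. x \<in> Fob F H' \<Longrightarrow> a \<in> Fob F A \<Longrightarrow> act H A ev (Farr F h x) a = act H' A ev' x a"
    by (rule ihom_lift[OF ih A T(5) ev']) blast
  obtain x where "x \<in> Fob F H'" "\<forall>a \<in> Fob F A. act H' A ev' x a = f a" using surj[OF f] by blast
  then show thesis using that[of "Farr F h x"] h by (auto simp: Mor_def)
qed

end

section \<open>Polynomials in an endomorphism\<close>

context neutral_tannakian
begin

definition end_poly :: "'m \<Rightarrow> 'k poly \<Rightarrow> 'm" where
  "end_poly \<phi> p = fold_coeffs (\<lambda>c g. c \<star> Ide C (Dom C \<phi>) \<boxplus> \<phi> \<cdot> g) p (Zero C (Dom C \<phi>) (Dom C \<phi>))"

lemma end_poly_0: "end_poly \<phi> 0 = Zero C (Dom C \<phi>) (Dom C \<phi>)"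
  by (simp add: end_poly_def)

lemma end_poly_pCons:
  assumes "\<phi> \<in> Mor C X X"
  shows "end_poly \<phi> (pCons c p) = c \<star> Ide C X \<boxplus> \<phi> \<cdot> end_poly \<phi> p"
proof (cases "c = 0 \<and> p = 0")
  case True
  have O: "X \<in> Ob C" using Mor_Ob[OF assms] by simp
  have "Zero C X X = 0 \<star> Ide C X \<boxplus> \<phi> \<cdot> Zero C X X"
    by (rule Mor_eqI) (use assms O in \<open>auto simp: Mor_def\<close>)
  then show ?thesis using True assms by (simp add: end_poly_def Mor_def)
next
  case False
  then show ?thesis using assms by (cases "c = 0") (auto simp: end_poly_def Mor_def)
qed

lemma end_poly_in: "\<phi> \<in> Mor C X X \<Longrightarrow> end_poly \<phi> p \<in> Mor C X X"
proof (induction p)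
  case 0
  then show ?case using Mor_Ob[OF 0] by (simp add: end_poly_0 Mor_def)
next
  case (pCons c p)
  then show ?case
    using Mor_Ob[OF pCons.prems] unfolding end_poly_pCons[OF pCons.prems] by (auto simp: Mor_def)
qed

abbreviation poly_act :: "'m \<Rightarrow> 'k poly \<Rightarrow> 'v \<Rightarrow> 'v" where
  "poly_act \<phi> p \<equiv> Farr F (end_poly \<phi> p)"

lemma poly_act_in [simp]: "\<phi> \<in> Mor C X X \<Longrightarrow> x \<in> Fob F X \<Longrightarrow> poly_act \<phi> p x \<in> Fob F X"
  using end_poly_in[of \<phi> X p] by (simp add: Mor_def)

lemma end_in [simp]: "\<phi> \<in> Mor C X Y \<Longrightarrow> x \<in> Fob F X \<Longrightarrow> Farr F \<phi> x \<in> Fob F Y"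
  by (simp add: Mor_def)

lemma poly_act_0 [simp]: "\<phi> \<in> Mor C X X \<Longrightarrow> x \<in> Fob F X \<Longrightarrow> poly_act \<phi> 0 x = 0"
  using Mor_Ob[of \<phi> X X] by (simp add: end_poly_0 Mor_def)

lemma poly_act_pCons [simp]:
  assumes "\<phi> \<in> Mor C X X" "x \<in> Fob F X"
  shows "poly_act \<phi> (pCons c p) x = VScale F c x + Farr F \<phi> (poly_act \<phi> p x)"
  using assms Mor_Ob[OF assms(1)] end_poly_in[OF assms(1), of p]
  unfolding end_poly_pCons[OF assms(1)] by (simp add: Mor_def)

lemma Farr_sums:
  assumes "\<phi> \<in> Mor C X Y" "x \<in> Fob F X"
  shows "y \<in> Fob F X \<Longrightarrow> Farr F \<phi> (x + y) = Farr F \<phi> x + Farr F \<phi> y"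
    "Farr F \<phi> (VScale F c x) = VScale F c (Farr F \<phi> x)"
  using assms by (auto simp: Mor_def)

lemma poly_act_add:
  assumes "\<phi> \<in> Mor C X X" "x \<in> Fob F X"
  shows "poly_act \<phi> (p + r) x = poly_act \<phi> p x + poly_act \<phi> r x"
  by (induction p r rule: poly_induct2)
    (use assms in \<open>auto simp: Farr_sums V.scale_left_distrib\<close>)

lemma poly_act_smult:
  assumes "\<phi> \<in> Mor C X X" "x \<in> Fob F X"
  shows "poly_act \<phi> (smult c p) x = VScale F c (poly_act \<phi> p x)"
  by (induction p) (use assms in \<open>auto simp: Farr_sums V.scale_right_distrib\<close>)

lemma poly_act_mult:
  assumes "\<phi> \<in> Mor C X X" "x \<in> Fob F X"
  shows "poly_act \<phi> (p * r) x = poly_act \<phi> p (poly_act \<phi> r x)"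
  by (induction p)
    (use assms in \<open>auto simp: Farr_sums poly_act_add poly_act_smult Mor_Ob\<close>)

lemma poly_act_intertwine:
  assumes "\<phi> \<in> Mor C X X" "\<psi> \<in> Mor C Y Y" and g: "linear_between (VScale F) (Fob F X) (Fob F Y) g"
    and eq: "\<And>x. x \<in> Fob F X \<Longrightarrow> g (Farr F \<phi> x) = Farr F \<psi> (g x)" and x: "x \<in> Fob F X"
  shows "g (poly_act \<phi> p x) = poly_act \<psi> p (g x)"
proof (induction p)
  case 0
  have "g 0 = g (VScale F 0 x)" by simp
  also have "\<dots> = VScale F 0 (g x)" using g x unfolding linear_between_def by blast
  finally show ?case using assms by (auto simp: linear_between_def)
next
  case (pCons c p)
  have "g (poly_act \<phi> (pCons c p) x) = VScale F c (g x) + Farr F \<psi> (g (poly_act \<phi> p x))"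
    using assms Mor_Ob[OF assms(1)] by (simp add: linear_between_def)
  then show ?case using pCons g x assms(2) by (simp add: linear_between_def)
qed

lemma poly_act_commute:
  assumes "\<phi> \<in> Mor C X X" "x \<in> Fob F X"
  shows "poly_act \<phi> p (Farr F \<phi> x) = Farr F \<phi> (poly_act \<phi> p x)"
  using poly_act_intertwine[OF assms(1,1) Farr_linear[OF assms(1)] refl assms(2)] by simp

text \<open>Taking commutators with \<open>x\<close> is a derivation, so on polynomials it is determined by its value \<open>y\<close>
  on the generator; since \<open>y\<close> itself commutes with the generator, the Leibniz rule collects the
  terms into the derivative of \<open>p\<close>.\<close>
lemma poly_act_commutator:
  assumes b: "b \<in> Mor C B B" and a: "a \<in> Mor C A A"
    and x: "linear_between (VScale F) (Fob F A) (Fob F B) x"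
    and y: "linear_between (VScale F) (Fob F A) (Fob F B) y"
    and xy: "\<And>v. v \<in> Fob F A \<Longrightarrow> Farr F b (x v) = x (Farr F a v) + y v"
    and comm: "\<And>v. v \<in> Fob F A \<Longrightarrow> y (Farr F a v) = Farr F b (y v)"
    and v: "v \<in> Fob F A"
  shows "poly_act b p (x v) = x (poly_act a p v) + poly_act b (pderiv p) (y v)"
proof (induction p)
  case 0
  have "x 0 = x (VScale F 0 v)" by simp
  also have "\<dots> = VScale F 0 (x v)" using x v unfolding linear_between_def by blast
  finally show ?case using a b x y v by (auto simp: linear_between_def)
next
  case (pCons c p)
  have O: "A \<in> Ob C" "B \<in> Ob C" using Mor_Ob[OF a] Mor_Ob[OF b] by auto
  have xs: "x u \<in> Fob F B" "x (u + w) = x u + x w" "x (VScale F d u) = VScale F d (x u)"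
    "y u \<in> Fob F B"
    if "u \<in> Fob F A" "w \<in> Fob F A" for u w d
    using x y that by (auto simp: linear_between_def)
  let ?u = "poly_act a p v"
  have u: "?u \<in> Fob F A" using a v by simp
  have yu: "y ?u = poly_act b p (y v)" by (rule poly_act_intertwine[OF a b y comm v])
  have "poly_act b (pCons c p) (x v) = VScale F c (x v) + Farr F b (x ?u + poly_act b (pderiv p) (y v))"
    using b xs v pCons by simp
  also have "\<dots> = VScale F c (x v) + (x (Farr F a ?u) + y ?u + Farr F b (poly_act b (pderiv p) (y v)))"
    using b xs v u xy[OF u] by (simp add: Farr_sums)
  also have "\<dots> = x (poly_act a (pCons c p) v) + (poly_act b p (y v) + Farr F b (poly_act b (pderiv p) (y v)))"
    using a xs v u O by (simp add: yu)
  also have "poly_act b p (y v) + Farr F b (poly_act b (pderiv p) (y v)) = poly_act b (pderiv (pCons c p)) (y v)"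
    using b xs v by (simp add: pderiv_pCons poly_act_add)
  finally show ?case .
qed

lemma finite_span_relation:
  assumes S: "finite S" and w: "\<And>n::nat. w n \<in> V.span S"
  obtains N c where "\<exists>n\<le>N. c n \<noteq> 0" "(\<Sum>n\<le>N. VScale F (c n) (w n)) = 0"
proof (cases "inj_on w {..card S}")
  case True
  have "\<not> V.independent (w ` {..card S})"
  proof
    assume "V.independent (w ` {..card S})"
    from V.independent_span_bound[OF S this] have "card (w ` {..card S}) \<le> card S" using w by auto
    then show False using card_image[OF True] by simp
  qed
  then obtain u where u: "\<exists>v \<in> w ` {..card S}. u v \<noteq> 0" "(\<Sum>v \<in> w ` {..card S}. VScale F (u v) v) = 0"
    using V.dependent_finite[of "w ` {..card S}"] by auto
  show thesis
    by (rule that[of "card S" "\<lambda>n. u (w n)"]) (use u True in \<open>auto simp: sum.reindex\<close>)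
next
  case False
  then obtain m n where mn: "m \<le> card S" "n \<le> card S" "m \<noteq> n" "w m = w n" by (auto simp: inj_on_def)
  let ?c = "\<lambda>k. (if k = m then 1 else 0) - (if k = n then 1 else 0) :: 'k"
  have d: "VScale F (if b then 1 else 0) z = (if b then z else 0)" for b z by simp
  have sum0: "(\<Sum>k\<le>card S. VScale F (?c k) (w k)) = w m - w n"
    unfolding V.scale_left_diff_distrib d sum_subtractf using mn(1,2) by (simp only: sum.delta finite_atMost atMost_iff if_True)
  show thesis
  proof (rule that[of "card S" ?c])
    show "\<exists>k\<le>card S. ?c k \<noteq> 0" by (rule exI[of _ m]) (use mn in simp)
  qed (use sum0 mn in simp)
qed

text \<open>The iterates of \<open>\<phi>\<close> on one vector are linearly dependent; the polynomials so obtained from the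
  vectors of a finite spanning set are multiplied.\<close>
lemma ex_annihilator:
  assumes phi: "\<phi> \<in> Mor C X X"
  shows "\<exists>p. p \<noteq> 0 \<and> (\<forall>x \<in> Fob F X. poly_act \<phi> p x = 0)"
proof -
  have X: "X \<in> Ob C" using Mor_Ob[OF phi] by simp
  obtain S where S: "finite S" "V.span S = Fob F X" using Fob_finite_dim[OF X] by auto
  have phi0: "Farr F \<phi> 0 = 0" using phi by (simp add: Mor_def)
  have pow: "poly_act \<phi> (monom c n) v = VScale F c ((Farr F \<phi> ^^ n) v) \<and> (Farr F \<phi> ^^ n) v \<in> Fob F X"
    if "v \<in> Fob F X" for v c n
    by (induction n) (use that X phi phi0 in \<open>auto simp: monom_0 monom_Suc Farr_sums\<close>)
  have one: "\<exists>p. p \<noteq> 0 \<and> poly_act \<phi> p v = 0" if v: "v \<in> Fob F X" for v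
  proof -
    obtain N c where c: "\<exists>n\<le>N. c n \<noteq> 0" "(\<Sum>n\<le>N. VScale F (c n) ((Farr F \<phi> ^^ n) v)) = 0"
      using finite_span_relation[OF S(1), of "\<lambda>n. (Farr F \<phi> ^^ n) v"] pow[OF v] S(2) by metis
    define p where "p = (\<Sum>n\<le>N. monom (c n) n)"
    have "poly_act \<phi> (\<Sum>n\<le>M. monom (c n) n) v = (\<Sum>n\<le>M. VScale F (c n) ((Farr F \<phi> ^^ n) v))" for M
      by (induction M) (use phi v pow in \<open>auto simp: poly_act_add\<close>)
    then have "poly_act \<phi> p v = 0" using c(2) by (simp add: p_def)
    moreover have "coeff p n = (if n \<le> N then c n else 0)" for n
      by (simp add: p_def coeff_sum)
    then have "p \<noteq> 0" using c(1) by (metis coeff_0)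
    ultimately show ?thesis by blast
  qed
  have "\<exists>p. p \<noteq> 0 \<and> (\<forall>x \<in> S'. poly_act \<phi> p x = 0)" if "finite S'" "S' \<subseteq> Fob F X" for S'
    using that
  proof (induction S')
    case empty
    then show ?case by (intro exI[of _ 1]) simp
  next
    case (insert s S')
    then obtain p where p: "p \<noteq> 0" "\<forall>x \<in> S'. poly_act \<phi> p x = 0" by auto
    obtain r where r: "r \<noteq> 0" "poly_act \<phi> r (poly_act \<phi> p s) = 0"
      using one[of "poly_act \<phi> p s"] insert phi by auto
    have "poly_act \<phi> r 0 = 0" using end_poly_in[OF phi, of r] by (simp add: Mor_def)
    then have "poly_act \<phi> (r * p) x = 0" if "x \<in> insert s S'" for x
      using that insert p r phi by (subst poly_act_mult[OF phi]) auto
    then show ?case using p r by (intro exI[of _ "r * p"]) auto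
  qed
  then obtain p where p: "p \<noteq> 0" "\<forall>x \<in> S. poly_act \<phi> p x = 0"
    using S V.span_superset[of S] by metis
  have "V.subspace {x \<in> Fob F X. poly_act \<phi> p x = 0}"
    unfolding V.subspace_def using X end_poly_in[OF phi, of p] by (auto simp: Farr_sums Mor_def)
  moreover have "S \<subseteq> {x \<in> Fob F X. poly_act \<phi> p x = 0}" using p S V.span_superset[of S] by auto
  ultimately have "Fob F X \<subseteq> {x \<in> Fob F X. poly_act \<phi> p x = 0}"
    using V.span_minimal S(2) by metis
  then show ?thesis using p(1) by blast
qed

lemma minimal_polynomial:
  assumes "\<phi> \<in> Mor C X X"
  obtains p where "p \<noteq> 0" "\<And>x. x \<in> Fob F X \<Longrightarrow> poly_act \<phi> p x = 0"
    "\<And>r. r \<noteq> 0 \<Longrightarrow> (\<And>x. x \<in> Fob F X \<Longrightarrow> poly_act \<phi> r x = 0) \<Longrightarrow> degree p \<le> degree r"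
  using ex_has_least_nat[of "\<lambda>p. p \<noteq> 0 \<and> (\<forall>x \<in> Fob F X. poly_act \<phi> p x = 0)" _ degree]
    ex_annihilator[OF assms] by metis

lemma linear_map_separating:
  assumes A: "A \<in> Ob C" and B: "B \<in> Ob C" and S: "V.independent S" "S \<subseteq> Fob F A"
    and u: "u \<in> Fob F A" "u \<notin> V.span S" and w: "w \<in> Fob F B"
  obtains f where "linear_between (VScale F) (Fob F A) (Fob F B) f" "f u = w" "\<And>s. s \<in> S \<Longrightarrow> f s = 0"
proof -
  have "V.independent (insert u S)" by (rule V.independent_insertI[OF u(2) S(1)])
  then obtain g where g: "Vector_Spaces.linear (VScale F) (VScale F) g"
    "\<forall>x \<in> insert u S. g x = (if x = u then w else 0)"
    using VV.linear_independent_extend[of "insert u S" "\<lambda>x. if x = u then w else 0"] by blast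
  obtain \<pi> where p: "Vector_Spaces.linear (VScale F) (VScale F) \<pi>" "\<And>v. \<pi> v \<in> Fob F B"
    "\<And>v. v \<in> Fob F B \<Longrightarrow> \<pi> v = v" using subspace_projection[OF Fob_subspace[OF B]] by blast
  have "u \<notin> S" using u(2) V.span_base by blast
  show thesis
  proof (rule that[of "\<lambda>x. \<pi> (g x)"])
    show "linear_between (VScale F) (Fob F A) (Fob F B) (\<lambda>x. \<pi> (g x))"
      using p(2) VV.linear_add[OF g(1)] VV.linear_scale[OF g(1)] VV.linear_add[OF p(1)] VV.linear_scale[OF p(1)]
      by (auto simp: linear_between_def)
    show "\<pi> (g u) = w" using g(2) p(3) w by simp
    show "\<pi> (g s) = 0" if "s \<in> S" for s
    proof -
      have "g s = 0" using g(2) that \<open>u \<notin> S\<close> by auto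
      then show ?thesis using p(3)[of 0] B by simp
    qed
  qed
qed

end

section \<open>Endomorphisms of a totally nonsplit extension\<close>

text \<open>An extension of \<open>A\<close> by \<open>B\<close> with its transfer \<open>0 \<rightarrow> H \<rightarrow> X \<rightarrow> 1 \<rightarrow> 0\<close> to the unit object.  A vector
  of \<open>X\<close> acts through \<open>\<rho>\<close> as a linear map \<open>h\<close> from the fibre of \<open>A\<close> to that of \<open>E\<close> such that
  \<open>p \<circ> h\<close> is a scalar; the vectors of \<open>H\<close> are those with scalar \<open>0\<close>.  The pushforward of the
  transferred extension along an arrow out of \<open>H\<close> splits iff the arrow extends to \<open>X\<close>, which is how
  total nonsplitness enters in \<open>nonsplit\<close>.  The weights enter only through \<open>no_hom\<close>.\<close>
locale transferred_extension = neutral_tannakian C F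
  for C :: "('o, 'm, 'k::field_char_0, 'z) tensor_category_scheme" (structure)
    and F :: "('o, 'm, 'k, 'v::ab_group_add) fibre_functor" +
  fixes A B E i p H ev X k q \<rho>
  assumes A_Ob: "A \<in> Ob C" and B_Ob: "B \<in> Ob C"
    and A_nonzero: "\<not> zero_obj C A" and B_nonzero: "\<not> zero_obj C B"
    and i: "i \<in> Mor C B E" and p: "p \<in> Mor C E A" and exact: "short_exact C i p"
    and ihom: "is_ihom C A B H ev"
    and k: "k \<in> Mor C H X" and q: "q \<in> Mor C X (Unit C)" and exact': "short_exact C k q"
    and \<rho>: "\<rho> \<in> Mor C (X \<otimes>\<^sub>o A) E" and \<rho>_k: "\<rho> \<cdot> (k \<otimes>\<^sub>m Ide C A) = i \<cdot> ev"
    and p_\<rho>: "p \<cdot> \<rho> = LUnit C A \<cdot> (q \<otimes>\<^sub>m Ide C A)"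
    and nonsplit: "\<lbrakk>\<sigma> \<in> Mor C H I; is_epi C \<sigma>; r \<in> Mor C X I; r \<cdot> k = \<sigma>\<rbrakk> \<Longrightarrow> zero_obj C I"
    and no_hom: "\<lbrakk>m \<in> Mor C A' A; is_mono C m; e \<in> Mor C B B'; is_epi C e; f \<in> Mor C A' B'\<rbrakk>
      \<Longrightarrow> f = Zero C A' B'"
begin

lemma E_Ob: "E \<in> Ob C" and H_Ob: "H \<in> Ob C" and X_Ob: "X \<in> Ob C"
  using Mor_Ob[OF i] Mor_Ob[OF k] by auto

lemma typing:
  "i \<in> Arr C" "Dom C i = B" "Cod C i = E" "p \<in> Arr C" "Dom C p = E" "Cod C p = A"
  "k \<in> Arr C" "Dom C k = H" "Cod C k = X" "q \<in> Arr C" "Dom C q = X" "Cod C q = Unit C"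
  "\<rho> \<in> Arr C" "Dom C \<rho> = X \<otimes>\<^sub>o A" "Cod C \<rho> = E"
  "ev \<in> Arr C" "Dom C ev = H \<otimes>\<^sub>o A" "Cod C ev = B"
  using i p k q \<rho> ihom_typing[OF ihom] by (auto simp: Mor_def)

lemmas objects = A_Ob B_Ob E_Ob H_Ob X_Ob

abbreviation hom :: "'v \<Rightarrow> 'v \<Rightarrow> 'v" where "hom \<equiv> act H A ev"

lemma hom_in: "x \<in> Fob F H \<Longrightarrow> a \<in> Fob F A \<Longrightarrow> hom x a \<in> Fob F B"
  using objects typing by simp

lemma hom_linear: "x \<in> Fob F H \<Longrightarrow> linear_between (VScale F) (Fob F A) (Fob F B) (hom x)"
  by (rule act_linear) (use objects typing in \<open>auto simp: Mor_def\<close>)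

lemma i_inj: "x \<in> Fob F B \<Longrightarrow> y \<in> Fob F B \<Longrightarrow> Farr F i x = Farr F i y \<Longrightarrow> x = y"
  using Farr_exact[OF exact] typing by (auto simp: inj_on_def)

lemma p_i: "x \<in> Fob F B \<Longrightarrow> Farr F p (Farr F i x) = 0"
  using Farr_exact[OF exact] typing by auto

lemma p_kernel: "x \<in> Fob F E \<Longrightarrow> Farr F p x = 0 \<Longrightarrow> x \<in> Farr F i ` Fob F B"
  using Farr_exact[OF exact] typing by auto

lemma q_kernel: "x \<in> Fob F X \<Longrightarrow> Farr F q x = 0 \<Longrightarrow> x \<in> Farr F k ` Fob F H"
  using Farr_exact[OF exact'] typing by auto

lemma rho_k: 
  assumes "x \<in> Fob F H" "a \<in> Fob F A"
  shows "Farr F \<rho> (Fmult F X A (Farr F k x) a) = Farr F i (hom x a)"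
proof -
  have "Farr F (\<rho> \<cdot> (k \<otimes>\<^sub>m Ide C A)) (Fmult F H A x a) = Farr F (i \<cdot> ev) (Fmult F H A x a)"
    by (simp add: \<rho>_k)
  then show ?thesis using assms objects typing by simp
qed

lemma p_rho:
  assumes "x \<in> Fob F X"
  obtains c where "\<And>a. a \<in> Fob F A \<Longrightarrow> Farr F p (Farr F \<rho> (Fmult F X A x a)) = VScale F c a"
proof -
  have "Farr F q x \<in> Fob F (Unit C)" using assms typing by simp
  then obtain c where c: "Farr F q x = VScale F c unit_vec" by (rule Unit_fibre_cases)
  have "Farr F p (Farr F \<rho> (Fmult F X A x a)) = VScale F c a" if a: "a \<in> Fob F A" for a
  proof -
    have "Farr F (p \<cdot> \<rho>) (Fmult F X A x a) = VScale F c a"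
      unfolding p_\<rho> using assms a objects typing c by simp
    then show ?thesis using assms a objects typing by simp
  qed
  then show thesis by (rule that)
qed

lemma epi_k_q: "is_epi C q" "is_mono C k" "is_mono C i" "is_epi C p"
  using short_exactD[OF exact] short_exactD[OF exact'] by auto

text \<open>How extensions to \<open>X\<close> arise: a family of linear maps into \<open>E\<close> that is killed by \<open>p\<close> takes
  values in \<open>B\<close>, hence is an arrow into \<open>H\<close>.\<close>
lemma hom_from_family:
  assumes \<theta>: "\<theta> \<in> Mor C (X \<otimes>\<^sub>o A) E"
    and p\<theta>: "\<And>x a. x \<in> Fob F X \<Longrightarrow> a \<in> Fob F A \<Longrightarrow> Farr F p (Farr F \<theta> (Fmult F X A x a)) = 0"
  obtains s where "s \<in> Mor C X H"
    "\<And>x a. x \<in> Fob F X \<Longrightarrow> a \<in> Fob F A \<Longrightarrow> Farr F i (hom (Farr F s x) a) = Farr F \<theta> (Fmult F X A x a)"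
proof -
  have \<theta>A: "\<theta> \<in> Arr C" "Dom C \<theta> = X \<otimes>\<^sub>o A" "Cod C \<theta> = E" using \<theta> by (auto simp: Mor_def)
  have "p \<cdot> \<theta> = Zero C (X \<otimes>\<^sub>o A) A"
    by (rule Mor_tensor_eqI[OF _ _ X_Ob A_Ob]) (use \<theta>A typing objects p\<theta> in \<open>auto simp: Mor_def\<close>)
  then have z: "Farr F p (Farr F \<theta> z) = 0" if "z \<in> Fob F (X \<otimes>\<^sub>o A)" for z
    using that \<theta>A typing objects Farr_comp[of \<theta> p z] by simp
  obtain t where t: "t \<in> Mor C (X \<otimes>\<^sub>o A) (Dom C i)" "i \<cdot> t = \<theta>"
    by (rule factor_through_mono[OF epi_k_q(3), of \<theta> "X \<otimes>\<^sub>o A"])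
      (use \<theta> \<theta>A typing z p_kernel in auto)
  have tB: "t \<in> Mor C (X \<otimes>\<^sub>o A) B" using t(1) typing by simp
  obtain s where s: "s \<in> Mor C X H"
    "\<And>x a. x \<in> Fob F X \<Longrightarrow> a \<in> Fob F A \<Longrightarrow> hom (Farr F s x) a = Farr F t (Fmult F X A x a)"
    by (rule ihom_lift[OF ihom A_Ob X_Ob tB]) blast
  have "Farr F i (hom (Farr F s x) a) = Farr F \<theta> (Fmult F X A x a)" if "x \<in> Fob F X" "a \<in> Fob F A" for x a
    unfolding t(2)[symmetric] using that s tB typing objects by (simp add: Mor_def)
  then show thesis using that s(1) by blast
qed

text \<open>An arrow \<open>X \<otimes> A' \<rightarrow> Q\<close> that vanishes on \<open>H \<otimes> A'\<close> comes from an arrow \<open>A' \<rightarrow> Q\<close>; in adjoint form,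
  an arrow \<open>X \<rightarrow> Hom(A', Q)\<close> that vanishes on \<open>H\<close> factors through \<open>1\<close>.\<close>
lemma vanishing_family:
  assumes g: "g \<in> Mor C (X \<otimes>\<^sub>o A') Q" and O: "A' \<in> Ob C" "Q \<in> Ob C"
    and z: "\<And>x a. x \<in> Fob F H \<Longrightarrow> a \<in> Fob F A' \<Longrightarrow> Farr F g (Fmult F X A' (Farr F k x) a) = 0"
    and hom0: "\<And>f. f \<in> Mor C A' Q \<Longrightarrow> f = Zero C A' Q"
    and x: "x \<in> Fob F X" and a: "a \<in> Fob F A'"
  shows "Farr F g (Fmult F X A' x a) = 0"
proof -
  obtain K ek where K: "is_ihom C A' Q K ek" using ex_ihom[OF O] by blast
  note KT = ihom_typing[OF K]
  obtain g' where g': "g' \<in> Mor C X K"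
    "\<And>x a. x \<in> Fob F X \<Longrightarrow> a \<in> Fob F A' \<Longrightarrow> act K A' ek (Farr F g' x) a = Farr F g (Fmult F X A' x a)"
    by (rule ihom_lift[OF K O(1) X_Ob g]) blast
  have g'k: "Farr F g' (Farr F k y) = 0" if "y \<in> Fob F H" for y
    by (rule ihom_act_inj[OF K O]) (use that g' typing z in auto)
  have g'0: "Farr F g' x = 0" if "x \<in> Fob F X" "Farr F q x = 0" for x
    using q_kernel[OF that] g'k by auto
  obtain t where t: "t \<in> Mor C (Cod C q) K" "t \<cdot> q = g'"
    by (rule factor_through_epi[OF epi_k_q(1), of g' K]) (use g'(1) typing g'0 in auto)
  have tA: "t \<in> Arr C" "Dom C t = Unit C" "Cod C t = K" using t typing by (auto simp: Mor_def)
  obtain u where u: "is_inverse C (LUnit C A') u" using LUnit_iso[OF O(1)] by (auto simp: is_iso_def)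
  have uA: "u \<in> Arr C" "Dom C u = A'" "Cod C u = Unit C \<otimes>\<^sub>o A'" using inverse_typing[OF u] O by auto
  have ux: "Farr F u b = Fmult F (Unit C) A' unit_vec b" if "b \<in> Fob F A'" for b
    using inverse_fibre[OF u, of "Fmult F (Unit C) A' unit_vec b"] that O by simp
  have "ek \<cdot> (t \<otimes>\<^sub>m Ide C A') \<cdot> u = Zero C A' Q"
    by (rule hom0) (use KT tA uA O in \<open>auto simp: Mor_def\<close>)
  then have "Farr F (ek \<cdot> (t \<otimes>\<^sub>m Ide C A') \<cdot> u) a = 0" using a O by simp
  then have e0: "act K A' ek (Farr F t unit_vec) a = 0" using KT tA uA O a ux by simp
  have "Farr F q x \<in> Fob F (Unit C)" using x typing by simp
  then obtain c where c: "Farr F q x = VScale F c unit_vec" by (rule Unit_fibre_cases)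
  have "Farr F g' x = VScale F c (Farr F t unit_vec)"
    unfolding t(2)[symmetric] using x tA typing c by simp
  then show ?thesis using g'(2)[OF x a] e0 KT tA O a by simp
qed

lemma A_vec: obtains v where "v \<in> Fob F A" "v \<noteq> 0"
  using A_nonzero zero_obj_iff[OF A_Ob] Fob_closed(1)[OF A_Ob] by auto

lemma B_vec: obtains v where "v \<in> Fob F B" "v \<noteq> 0"
  using B_nonzero zero_obj_iff[OF B_Ob] Fob_closed(1)[OF B_Ob] by auto

text \<open>If \<open>f \<mapsto> b \<circ> f \<circ> a\<close> extends to \<open>X\<close>, then the extension is forced to take values in
  the maps \<open>A \<rightarrow> B\<close> that vanish on \<open>ker a\<close> and have image in \<open>im b\<close>, since the obstructions are
  arrows from a subobject of \<open>A\<close> to a quotient of \<open>B\<close>.  By linear algebra these maps are exactly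
  the values of \<open>f \<mapsto> b \<circ> f \<circ> a\<close> on \<open>H\<close>, so its corestriction to its image extends and, by
  total nonsplitness, is zero.\<close>
lemma sandwich_extends:
  assumes b: "b \<in> Mor C B B" and a: "a \<in> Mor C A A" and s: "s \<in> Mor C X H"
    and sk: "\<And>x v. x \<in> Fob F H \<Longrightarrow> v \<in> Fob F A \<Longrightarrow>
      hom (Farr F s (Farr F k x)) v = Farr F b (hom x (Farr F a v))"
  shows "(\<forall>w \<in> Fob F B. Farr F b w = 0) \<or> (\<forall>v \<in> Fob F A. Farr F a v = 0)"
proof (rule ccontr)
  assume neg: "\<not> ?thesis"
  then obtain v0 w0 where v0: "v0 \<in> Fob F A" "Farr F a v0 \<noteq> 0" and w0: "w0 \<in> Fob F B" "Farr F b w0 \<noteq> 0"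
    by auto
  have bA: "b \<in> Arr C" "Dom C b = B" "Cod C b = B" and aA: "a \<in> Arr C" "Dom C a = A" "Cod C a = A"
    and sA: "s \<in> Arr C" "Dom C s = X" "Cod C s = H"
    using a b s by (auto simp: Mor_def)
  note T = typing objects bA aA sA
  define s' where "s' = ev \<cdot> (s \<otimes>\<^sub>m Ide C A)"
  have s'A: "s' \<in> Arr C" "Dom C s' = X \<otimes>\<^sub>o A" "Cod C s' = B" using T by (auto simp: s'_def)
  have s'x: "Farr F s' (Fmult F X A x v) = hom (Farr F s x) v" if "x \<in> Fob F X" "v \<in> Fob F A" for x v
    using T that by (simp add: s'_def)
  obtain J \<epsilon> \<iota> where J: "\<epsilon> \<in> Mor C B J" "is_epi C \<epsilon>" "\<iota> \<in> Mor C J B" "is_mono C \<iota>" "\<iota> \<cdot> \<epsilon> = b"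
    by (rule image_factorization[OF b])
  have JA: "\<epsilon> \<in> Arr C" "Dom C \<epsilon> = B" "Cod C \<epsilon> = J" "\<iota> \<in> Arr C" "Dom C \<iota> = J" "Cod C \<iota> = B" "J \<in> Ob C"
    using J Mor_Ob[OF J(1)] by (auto simp: Mor_def)
  have bx: "Farr F b x = Farr F \<iota> (Farr F \<epsilon> x)" if "x \<in> Fob F B" for x
    unfolding J(5)[symmetric] using that JA by simp
  obtain \<kappa> where \<kappa>: "short_exact C \<iota> \<kappa>" using mono_short_exact[OF J(4)] .
  have \<kappa>A: "\<kappa> \<in> Arr C" "Dom C \<kappa> = B" "Cod C \<kappa> \<in> Ob C" and \<kappa>e: "is_epi C \<kappa>"
    using short_exactD[OF \<kappa>] JA Cod_in_Ob by auto
  have \<kappa>\<iota>: "Farr F \<kappa> (Farr F \<iota> y) = 0" if "y \<in> Fob F J" for y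
    using Farr_exact[OF \<kappa>] that JA by auto
  \<comment> \<open>Modulo the image of \<open>b\<close> the extension is an arrow \<open>A \<rightarrow> B / im b\<close>.\<close>
  have "Farr F (\<kappa> \<cdot> s') (Fmult F X A x v) = 0" if "x \<in> Fob F X" "v \<in> Fob F A" for x v
  proof (rule vanishing_family[of "\<kappa> \<cdot> s'" A "Cod C \<kappa>"])
    show "\<kappa> \<cdot> s' \<in> Mor C (X \<otimes>\<^sub>o A) (Cod C \<kappa>)" using \<kappa>A s'A by (simp add: Mor_def)
    show "Farr F (\<kappa> \<cdot> s') (Fmult F X A (Farr F k x) v) = 0" if "x \<in> Fob F H" "v \<in> Fob F A" for x v
      using that \<kappa>A s'A T JA by (simp add: s'x sk bx \<kappa>\<iota>)
    show "f = Zero C A (Cod C \<kappa>)" if "f \<in> Mor C A (Cod C \<kappa>)" for f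
    proof (rule no_hom[OF Ide_in_Mor[OF A_Ob] _ _ \<kappa>e that])
      show "is_mono C (Ide C A)" by (rule inj0_mono) (use A_Ob in auto)
      show "\<kappa> \<in> Mor C B (Cod C \<kappa>)" using \<kappa>A by (simp add: Mor_def)
    qed
  qed (use that objects \<kappa>A in auto)
  then have \<kappa>s: "Farr F \<kappa> (hom (Farr F s x) v) = 0" if "x \<in> Fob F X" "v \<in> Fob F A" for x v
    using that \<kappa>A s'A T by (simp add: s'x)
  have im: "Farr F s' z \<in> Farr F \<iota> ` Fob F (Dom C \<iota>)" if "z \<in> Fob F (X \<otimes>\<^sub>o A)" for z
  proof -
    have "\<kappa> \<cdot> s' = Zero C (X \<otimes>\<^sub>o A) (Cod C \<kappa>)"
      by (rule Mor_tensor_eqI[OF _ _ X_Ob A_Ob]) (use \<kappa>A s'A T \<kappa>s in \<open>auto simp: Mor_def s'x\<close>)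
    then have "Farr F \<kappa> (Farr F s' z) = 0" using that \<kappa>A s'A T Farr_comp[of s' \<kappa> z] by simp
    then show ?thesis using Farr_exact[OF \<kappa>] that s'A JA by auto
  qed
  obtain s1 where s1: "s1 \<in> Mor C (X \<otimes>\<^sub>o A) (Dom C \<iota>)" "\<iota> \<cdot> s1 = s'"
    by (rule factor_through_mono[OF J(4), of s' "X \<otimes>\<^sub>o A"]) (use s'A JA im in \<open>auto simp: Mor_def\<close>)
  have s1A: "s1 \<in> Arr C" "Dom C s1 = X \<otimes>\<^sub>o A" "Cod C s1 = J" using s1 JA by (auto simp: Mor_def)
  have s1x: "Farr F \<iota> (Farr F s1 (Fmult F X A x v)) = hom (Farr F s x) v"
    if "x \<in> Fob F X" "v \<in> Fob F A" for x v
    using Farr_comp[of s1 \<iota> "Fmult F X A x v"] that s1A JA T unfolding s1(2) by (simp add: s'x)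
  obtain n where n: "is_kernel C n a" using ex_kernel aA by blast
  have nm: "is_mono C n" using is_kernel_is_mono[OF n] .
  have nA: "n \<in> Arr C" "Cod C n = A" "Dom C n \<in> Ob C"
    using n aA by (auto simp: is_kernel_def Mor_def Dom_in_Ob)
  note nx = kernel_fibre[OF n, unfolded aA]
  \<comment> \<open>On the kernel of \<open>a\<close> the extension is an arrow \<open>ker a \<rightarrow> im b\<close>.\<close>
  have "Farr F (s1 \<cdot> (Ide C X \<otimes>\<^sub>m n)) (Fmult F X (Dom C n) x v) = 0" if "x \<in> Fob F X" "v \<in> Fob F (Dom C n)" for x v
  proof (rule vanishing_family[of "s1 \<cdot> (Ide C X \<otimes>\<^sub>m n)" "Dom C n" J])
    show "s1 \<cdot> (Ide C X \<otimes>\<^sub>m n) \<in> Mor C (X \<otimes>\<^sub>o Dom C n) J" using s1A nA T by (simp add: Mor_def)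
    show "Farr F (s1 \<cdot> (Ide C X \<otimes>\<^sub>m n)) (Fmult F X (Dom C n) (Farr F k x) v) = 0"
      if xv: "x \<in> Fob F H" "v \<in> Fob F (Dom C n)" for x v
    proof (rule mono_inj0[OF J(4)])
      have nv: "Farr F n v \<in> Fob F A" "Farr F a (Farr F n v) = 0" using xv nx by auto
      have "Farr F \<iota> (Farr F s1 (Fmult F X A (Farr F k x) (Farr F n v))) = 0"
        using s1x[of "Farr F k x" "Farr F n v"] sk[OF xv(1) nv(1)] nv xv T by simp
      then show "Farr F \<iota> (Farr F (s1 \<cdot> (Ide C X \<otimes>\<^sub>m n)) (Fmult F X (Dom C n) (Farr F k x) v)) = 0"
        using xv s1A nA T by simp
    qed (use xv s1A nA T JA in auto)
    show "f = Zero C (Dom C n) J" if "f \<in> Mor C (Dom C n) J" for f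
      by (rule no_hom[of n _ \<epsilon>]) (use nA nm J that in \<open>auto simp: Mor_def\<close>)
  qed (use that nA JA in auto)
  then have sn: "hom (Farr F s x) (Farr F n v) = 0" if "x \<in> Fob F X" "v \<in> Fob F (Dom C n)" for x v
    using that s1A nA T JA s1x[of x "Farr F n v"] by simp
  have ker: "hom (Farr F s x) v = 0" if "x \<in> Fob F X" "v \<in> Fob F A" "Farr F a v = 0" for x v
  proof -
    have "v \<in> Farr F n ` Fob F (Dom C n)" using nx that by auto
    then show ?thesis using sn[OF that(1)] by auto
  qed
  have img: "\<exists>u \<in> Fob F B. hom (Farr F s x) v = Farr F b u" if xv: "x \<in> Fob F X" "v \<in> Fob F A" for x v
  proof -
    have "Farr F s1 (Fmult F X A x v) \<in> Fob F (Cod C \<epsilon>)" using xv s1A JA T by simp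
    then obtain u where "u \<in> Fob F (Dom C \<epsilon>)" "Farr F \<epsilon> u = Farr F s1 (Fmult F X A x v)"
      by (rule epi_surj[OF J(2)])
    then show ?thesis using s1x[OF xv] JA by (intro bexI[of _ u]) (auto simp: bx)
  qed
  obtain \<beta> where \<beta>: "linear_between (VScale F) (Fob F B) (Fob F B) \<beta>"
    "\<And>x. x \<in> Fob F B \<Longrightarrow> Farr F b (\<beta> (Farr F b x)) = Farr F b x"
    using generalized_inverse[OF Farr_linear[OF b] B_Ob] by blast
  obtain \<alpha> where \<alpha>: "linear_between (VScale F) (Fob F A) (Fob F A) \<alpha>"
    "\<And>x. x \<in> Fob F A \<Longrightarrow> Farr F a (\<alpha> (Farr F a x)) = Farr F a x"
    using generalized_inverse[OF Farr_linear[OF a] A_Ob] by blast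
  have attained: "\<exists>y \<in> Fob F H. Farr F s (Farr F k y) = Farr F s x" if x: "x \<in> Fob F X" for x
  proof -
    have sx: "Farr F s x \<in> Fob F H" using x T by simp
    have "linear_between (VScale F) (Fob F A) (Fob F B) (\<lambda>v. \<beta> (hom (Farr F s x) (\<alpha> v)))"
      using \<alpha>(1) \<beta>(1) hom_linear[OF sx] by (auto simp: linear_between_def)
    then obtain y where y: "y \<in> Fob F H" "\<And>v. v \<in> Fob F A \<Longrightarrow> hom y v = \<beta> (hom (Farr F s x) (\<alpha> v))"
      using ihom_act_surj[OF ihom A_Ob B_Ob] by blast
    have "Farr F s (Farr F k y) = Farr F s x"
    proof (rule ihom_act_eqI[OF ihom A_Ob B_Ob])
      fix v assume v: "v \<in> Fob F A"
      have av: "\<alpha> (Farr F a v) \<in> Fob F A" using \<alpha>(1) v T by (simp add: linear_between_def)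
      have "hom (Farr F s x) (\<alpha> (Farr F a v) - v) = 0"
        by (rule ker) (use x v av \<alpha>(2) T in auto)
      then have same: "hom (Farr F s x) (\<alpha> (Farr F a v)) = hom (Farr F s x) v"
        using sx av v T by simp
      obtain u where u: "u \<in> Fob F B" "hom (Farr F s x) v = Farr F b u" using img[OF x v] by blast
      show "hom (Farr F s (Farr F k y)) v = hom (Farr F s x) v"
        using sk[OF y(1) v] y(2)[of "Farr F a v"] v T same u \<beta>(2) by simp
    qed (use y(1) sx T in auto)
    then show ?thesis using y(1) by blast
  qed
  have skM: "s \<cdot> k \<in> Mor C H H" using T by (simp add: Mor_def)
  obtain I \<sigma> \<mu> where I: "\<sigma> \<in> Mor C H I" "is_epi C \<sigma>" "\<mu> \<in> Mor C I H" "is_mono C \<mu>" "\<mu> \<cdot> \<sigma> = s \<cdot> k"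
    by (rule image_factorization[OF skM])
  have IA: "\<sigma> \<in> Arr C" "Dom C \<sigma> = H" "Cod C \<sigma> = I" "\<mu> \<in> Arr C" "Dom C \<mu> = I" "Cod C \<mu> = H" "I \<in> Ob C"
    using I Mor_Ob[OF I(1)] by (auto simp: Mor_def)
  have \<mu>\<sigma>: "Farr F \<mu> (Farr F \<sigma> x) = Farr F s (Farr F k x)" if "x \<in> Fob F H" for x
    using Farr_comp[of \<sigma> \<mu> x] that IA T unfolding I(5) by simp
  obtain r where r: "r \<in> Mor C X (Dom C \<mu>)" "\<mu> \<cdot> r = s"
  proof (rule factor_through_mono[OF I(4), of s X])
    show "s \<in> Mor C X (Cod C \<mu>)" using s IA by simp
    fix x assume "x \<in> Fob F X"
    then obtain y where y: "y \<in> Fob F H" "Farr F s (Farr F k y) = Farr F s x" using attained by blast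
    then have "Farr F s x = Farr F \<mu> (Farr F \<sigma> y)" using \<mu>\<sigma> by simp
    then show "Farr F s x \<in> Farr F \<mu> ` Fob F (Dom C \<mu>)" using y IA by auto
  qed
  have rA: "r \<in> Arr C" "Dom C r = X" "Cod C r = I" using r IA by (auto simp: Mor_def)
  have "r \<cdot> k = \<sigma>"
  proof (rule Mor_eqI)
    fix x assume "x \<in> Fob F (Dom C \<sigma>)"
    then have x: "x \<in> Fob F H" using IA by simp
    have "Farr F \<mu> (Farr F r (Farr F k x)) = Farr F \<mu> (Farr F \<sigma> x)"
      using Farr_comp[of r \<mu> "Farr F k x"] x rA IA T unfolding r(2) by (simp add: \<mu>\<sigma>)
    then show "Farr F (r \<cdot> k) x = Farr F \<sigma> x"
      using mono_inj[OF I(4), of "Farr F r (Farr F k x)" "Farr F \<sigma> x"] x rA IA T by simp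
  qed (use rA IA T in auto)
  from nonsplit[OF I(1,2) _ this] r(1) IA have "zero_obj C I" by simp
  then have "Fob F I = {0}" using zero_obj_iff IA by simp
  then have \<sigma>0: "Farr F \<sigma> x = 0" if "x \<in> Fob F H" for x using that IA Farr_in[of \<sigma> I x] by simp
  then have sk0: "Farr F s (Farr F k x) = 0" if "x \<in> Fob F H" for x using \<mu>\<sigma>[OF that] that IA by simp
  have "Farr F a v0 \<notin> V.span {}" using v0 by simp
  then obtain f where f: "linear_between (VScale F) (Fob F A) (Fob F B) f" "f (Farr F a v0) = w0"
    using linear_map_separating[OF A_Ob B_Ob _ _ _ _ w0(1), of "{}" "Farr F a v0"] v0(1) T V.independent_empty
    by auto
  obtain y where y: "y \<in> Fob F H" "\<And>v. v \<in> Fob F A \<Longrightarrow> hom y v = f v"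
    using ihom_act_surj[OF ihom A_Ob B_Ob f(1)] by blast
  have "Farr F b w0 = 0" using sk[OF y(1) v0(1)] sk0[OF y(1)] y(2)[of "Farr F a v0"] f(2) v0 T by simp
  then show False using w0 by simp
qed

text \<open>Let \<open>S = \<mu> \<cdot> \<sigma>\<close> be the factorization through the image.  If \<open>s\<close> extends \<open>S\<close>, then \<open>\<sigma> \<cdot> U \<cdot> s\<close>
  extends \<open>\<sigma> \<cdot> U \<cdot> S\<close>, which equals \<open>\<sigma>\<close> because \<open>\<mu>\<close> is mono; so \<open>nonsplit\<close> applies to \<open>\<sigma>\<close>.\<close>
lemma regular_extends_zero:
  assumes S: "S \<in> Mor C H H" and U: "U \<in> Mor C H H" and s: "s \<in> Mor C X H"
    and sk: "\<And>x. x \<in> Fob F H \<Longrightarrow> Farr F s (Farr F k x) = Farr F S x"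
    and SUS: "\<And>x. x \<in> Fob F H \<Longrightarrow> Farr F S (Farr F U (Farr F S x)) = Farr F S x"
    and x: "x \<in> Fob F H"
  shows "Farr F S x = 0"
proof -
  obtain I \<sigma> \<mu> where I: "\<sigma> \<in> Mor C H I" "is_epi C \<sigma>" "\<mu> \<in> Mor C I H" "is_mono C \<mu>" "\<mu> \<cdot> \<sigma> = S"
    by (rule image_factorization[OF S])
  have T: "\<sigma> \<in> Arr C" "Dom C \<sigma> = H" "Cod C \<sigma> = I" "\<mu> \<in> Arr C" "Dom C \<mu> = I" "Cod C \<mu> = H" "I \<in> Ob C"
    "S \<in> Arr C" "Dom C S = H" "Cod C S = H" "U \<in> Arr C" "Dom C U = H" "Cod C U = H"
    "s \<in> Arr C" "Dom C s = X" "Cod C s = H"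
    using I S U s Mor_Ob[OF I(1)] by (auto simp: Mor_def)
  note T = T typing objects
  have \<mu>\<sigma>: "Farr F \<mu> (Farr F \<sigma> x) = Farr F S x" if "x \<in> Fob F H" for x
    using Farr_comp[of \<sigma> \<mu> x] that T unfolding I(5) by simp
  have "(\<sigma> \<cdot> U \<cdot> s) \<cdot> k = \<sigma>"
  proof (rule Mor_eqI)
    fix x assume "x \<in> Fob F (Dom C \<sigma>)"
    then have x: "x \<in> Fob F H" using T by simp
    have "Farr F \<mu> (Farr F \<sigma> (Farr F U (Farr F S x))) = Farr F \<mu> (Farr F \<sigma> x)"
      using \<mu>\<sigma>[OF x] \<mu>\<sigma>[of "Farr F U (Farr F S x)"] SUS[OF x] x T by simp
    then have "Farr F \<sigma> (Farr F U (Farr F S x)) = Farr F \<sigma> x"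
      using mono_inj[OF I(4), of "Farr F \<sigma> (Farr F U (Farr F S x))" "Farr F \<sigma> x"] x T by simp
    then show "Farr F ((\<sigma> \<cdot> U \<cdot> s) \<cdot> k) x = Farr F \<sigma> x" using x sk[OF x] T by simp
  qed (use T in auto)
  from nonsplit[OF I(1,2) _ this] have "zero_obj C I" using T by (simp add: Mor_def)
  then have "Fob F I = {0}" using zero_obj_iff T by simp
  then have "Farr F \<sigma> x = 0" using x T Farr_in[of \<sigma> I x] by simp
  then show ?thesis using \<mu>\<sigma>[OF x] T by simp
qed

text \<open>Encoded on fibres; by faithfulness it says that \<open>\<phi>\<close> preserves \<open>B\<close>, with restriction \<open>b\<close> and
  induced endomorphism \<open>a\<close> of \<open>A\<close>.\<close>
definition ext_end :: "'m \<Rightarrow> 'm \<Rightarrow> 'm \<Rightarrow> bool" where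
  "ext_end \<phi> b a \<longleftrightarrow> \<phi> \<in> Mor C E E \<and> b \<in> Mor C B B \<and> a \<in> Mor C A A \<and>
     (\<forall>w \<in> Fob F B. Farr F i (Farr F b w) = Farr F \<phi> (Farr F i w)) \<and>
     (\<forall>x \<in> Fob F E. Farr F a (Farr F p x) = Farr F p (Farr F \<phi> x))"

lemma ext_endD:
  assumes "ext_end \<phi> b a"
  shows "\<phi> \<in> Mor C E E" "b \<in> Mor C B B" "a \<in> Mor C A A"
    "\<phi> \<in> Arr C" "Dom C \<phi> = E" "Cod C \<phi> = E" "b \<in> Arr C" "Dom C b = B" "Cod C b = B"
    "a \<in> Arr C" "Dom C a = A" "Cod C a = A"
    "\<And>w. w \<in> Fob F B \<Longrightarrow> Farr F \<phi> (Farr F i w) = Farr F i (Farr F b w)"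
    "\<And>x. x \<in> Fob F E \<Longrightarrow> Farr F p (Farr F \<phi> x) = Farr F a (Farr F p x)"
  using assms by (auto simp: ext_end_def Mor_def)

lemma ext_end_poly:
  assumes "ext_end \<phi> b a"
  shows "ext_end (end_poly \<phi> f) (end_poly b f) (end_poly a f)"
  unfolding ext_end_def
proof (intro conjI ballI)
  note D = ext_endD[OF assms]
  show "end_poly \<phi> f \<in> Mor C E E" "end_poly b f \<in> Mor C B B" "end_poly a f \<in> Mor C A A"
    using D by (auto intro: end_poly_in)
  show "Farr F i (poly_act b f w) = poly_act \<phi> f (Farr F i w)" if "w \<in> Fob F B" for w
    by (rule poly_act_intertwine[OF D(2,1) Farr_linear[OF i] _ that]) (use D in simp)
  show "poly_act a f (Farr F p x) = Farr F p (poly_act \<phi> f x)" if "x \<in> Fob F E" for x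
    by (rule poly_act_intertwine[OF D(1,3) Farr_linear[OF p] _ that, symmetric]) (use D in simp)
qed

text \<open>Consider \<open>h \<mapsto> \<phi> \<circ> h \<circ> a' - \<phi> \<circ> \<phi>' \<circ> h\<close> on \<open>X\<close>.  Composed with \<open>p\<close>, both terms become the scalar of
  \<open>h\<close> times \<open>a \<circ> a'\<close>, so the difference lies in \<open>H\<close>; on \<open>H\<close> the second term is \<open>b \<circ> b' \<circ> f = 0\<close>, so
  this extends \<open>f \<mapsto> b \<circ> f \<circ> a'\<close>.\<close>
lemma ext_end_product_zero:
  assumes e: "ext_end \<phi> b a" and e': "ext_end \<phi>' b' a'"
    and bb: "\<And>w. w \<in> Fob F B \<Longrightarrow> Farr F b (Farr F b' w) = 0"
  shows "(\<forall>w \<in> Fob F B. Farr F b w = 0) \<or> (\<forall>v \<in> Fob F A. Farr F a' v = 0)"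
proof -
  note D = ext_endD[OF e] and D' = ext_endD[OF e']
  note T = D(4-12) D'(4-12) typing objects
  define \<theta> where "\<theta> = \<phi> \<cdot> \<rho> \<cdot> (Ide C X \<otimes>\<^sub>m a') \<boxplus> (- 1) \<star> (\<phi> \<cdot> \<phi>' \<cdot> \<rho>)"
  have \<theta>M: "\<theta> \<in> Mor C (X \<otimes>\<^sub>o A) E" using T by (simp add: \<theta>_def Mor_def)
  let ?\<rho> = "\<lambda>x v. Farr F \<rho> (Fmult F X A x v)"
  have \<theta>x: "Farr F \<theta> (Fmult F X A x v) = Farr F \<phi> (?\<rho> x (Farr F a' v)) - Farr F \<phi> (Farr F \<phi>' (?\<rho> x v))"
    if "x \<in> Fob F X" "v \<in> Fob F A" for x v
    using that T by (simp add: \<theta>_def)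
  have p\<theta>: "Farr F p (Farr F \<theta> (Fmult F X A x v)) = 0" if xv: "x \<in> Fob F X" "v \<in> Fob F A" for x v
  proof -
    obtain c where c: "\<And>v. v \<in> Fob F A \<Longrightarrow> Farr F p (?\<rho> x v) = VScale F c v" using p_rho[OF xv(1)] by blast
    show ?thesis
      using xv T c by (simp add: \<theta>x D(14) D'(14))
  qed
  obtain s where s: "s \<in> Mor C X H"
    "\<And>x v. x \<in> Fob F X \<Longrightarrow> v \<in> Fob F A \<Longrightarrow> Farr F i (hom (Farr F s x) v) = Farr F \<theta> (Fmult F X A x v)"
    using hom_from_family[OF \<theta>M p\<theta>] by blast
  have sA: "s \<in> Arr C" "Dom C s = X" "Cod C s = H" using s by (auto simp: Mor_def)
  show ?thesis
  proof (rule sandwich_extends[OF D(2) D'(3) s(1)])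
    fix x v assume xv: "x \<in> Fob F H" "v \<in> Fob F A"
    show "hom (Farr F s (Farr F k x)) v = Farr F b (hom x (Farr F a' v))"
    proof (rule i_inj)
      have "Farr F i (hom (Farr F s (Farr F k x)) v) =
          Farr F i (Farr F b (hom x (Farr F a' v))) - Farr F i (Farr F b (Farr F b' (hom x v)))"
        using xv T sA s(2)[of "Farr F k x" v] \<theta>x[of "Farr F k x" v] by (simp add: rho_k D(13) D'(13))
      then show "Farr F i (hom (Farr F s (Farr F k x)) v) = Farr F i (Farr F b (hom x (Farr F a' v)))"
        using xv T bb by simp
    qed (use xv T sA in auto)
  qed
qed

text \<open>If \<open>a = 0\<close>, then \<open>h \<mapsto> \<phi> \<circ> h\<close> on \<open>X\<close> takes values in \<open>H\<close> and extends \<open>f \<mapsto> b \<circ> f\<close>.\<close>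
lemma ext_end_A_zero:
  assumes e: "ext_end \<phi> b a" and a0: "\<And>v. v \<in> Fob F A \<Longrightarrow> Farr F a v = 0" and w: "w \<in> Fob F B"
  shows "Farr F b w = 0"
proof -
  note D = ext_endD[OF e]
  note T = D(4-12) typing objects
  have \<theta>M: "\<phi> \<cdot> \<rho> \<in> Mor C (X \<otimes>\<^sub>o A) E" using T by (simp add: Mor_def)
  obtain s where s: "s \<in> Mor C X H"
    "\<And>x v. x \<in> Fob F X \<Longrightarrow> v \<in> Fob F A \<Longrightarrow> Farr F i (hom (Farr F s x) v) = Farr F (\<phi> \<cdot> \<rho>) (Fmult F X A x v)"
    by (rule hom_from_family[OF \<theta>M]) (use T D(14) a0 in auto)
  have sA: "s \<in> Arr C" "Dom C s = X" "Cod C s = H" using s by (auto simp: Mor_def)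
  have "(\<forall>w \<in> Fob F B. Farr F b w = 0) \<or> (\<forall>v \<in> Fob F A. Farr F (Ide C A) v = 0)"
  proof (rule sandwich_extends[OF D(2) Ide_in_Mor[OF A_Ob] s(1)])
    fix x v assume xv: "x \<in> Fob F H" "v \<in> Fob F A"
    show "hom (Farr F s (Farr F k x)) v = Farr F b (hom x (Farr F (Ide C A) v))"
      by (rule i_inj) (use xv T sA s(2)[of "Farr F k x" v] D(13) in \<open>auto simp: rho_k\<close>)
  qed
  then show ?thesis using w A_vec A_Ob by auto
qed

text \<open>The product of \<open>Ide C E\<close> and \<open>\<phi>\<close> restricts to zero on \<open>B\<close>, while \<open>Ide C E\<close> does not.\<close>
lemma ext_end_B_zero:
  assumes e: "ext_end \<phi> b a" and b0: "\<And>w. w \<in> Fob F B \<Longrightarrow> Farr F b w = 0" and v: "v \<in> Fob F A"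
  shows "Farr F a v = 0"
proof -
  have "ext_end (Ide C E) (Ide C B) (Ide C A)"
    unfolding ext_end_def using objects typing Ide_in_Mor by auto
  from ext_end_product_zero[OF this e] b0 v show ?thesis using B_vec B_Ob by auto
qed

lemma ext_end_no_zero_divisors:
  assumes "ext_end \<phi> b a" "ext_end \<phi>' b' a'" and "\<And>w. w \<in> Fob F B \<Longrightarrow> Farr F b (Farr F b' w) = 0"
  shows "(\<forall>w \<in> Fob F B. Farr F b w = 0) \<or> (\<forall>w \<in> Fob F B. Farr F b' w = 0)"
  using ext_end_product_zero[OF assms] ext_end_A_zero[OF assms(2)] by blast

text \<open>A finite-dimensional algebra without zero divisors is a division algebra: a minimal polynomial
  has nonzero constant term.\<close>
lemma ext_end_injective:
  assumes e: "ext_end \<phi> b a" and nz: "\<exists>w \<in> Fob F B. Farr F b w \<noteq> 0"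
    and w: "w \<in> Fob F B" "Farr F b w = 0"
  shows "w = 0"
proof -
  note D = ext_endD[OF e]
  obtain h where h: "h \<noteq> 0" "\<And>x. x \<in> Fob F B \<Longrightarrow> poly_act b h x = 0"
    "\<And>r. r \<noteq> 0 \<Longrightarrow> (\<And>x. x \<in> Fob F B \<Longrightarrow> poly_act b r x = 0) \<Longrightarrow> degree h \<le> degree r"
    using minimal_polynomial[OF D(2)] by blast
  obtain c h1 where hc: "h = pCons c h1" by (cases h)
  have "c \<noteq> 0"
  proof
    assume c: "c = 0"
    have "Farr F b (poly_act b h1 x) = 0" if "x \<in> Fob F B" for x
      using h(2)[OF that] D(2) that by (simp add: hc c)
    from ext_end_no_zero_divisors[OF e ext_end_poly[OF e] this] nz
    have "poly_act b h1 x = 0" if "x \<in> Fob F B" for x using that by blast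
    from h(3)[OF _ this] h(1) show False by (auto simp: hc c)
  qed
  moreover have "VScale F c w + poly_act b h1 (Farr F b w) = 0"
    using h(2)[OF w(1)] D(2) w(1) by (simp add: hc poly_act_commute)
  then have "VScale F c w = 0" using w(2) D(2) end_poly_in[OF D(2), of h1] by (simp add: Mor_def)
  ultimately show ?thesis by simp
qed

lemma commutator_map:
  assumes e: "ext_end \<phi> b a"
  obtains T where "T \<in> Mor C H H"
    "\<And>x v. x \<in> Fob F H \<Longrightarrow> v \<in> Fob F A \<Longrightarrow> hom (Farr F T x) v = Farr F b (hom x v) - hom x (Farr F a v)"
proof -
  note D = ext_endD[OF e]
  note T = D(4-12) typing objects
  have g: "b \<cdot> ev \<boxplus> (- 1) \<star> (ev \<cdot> (Ide C H \<otimes>\<^sub>m a)) \<in> Mor C (H \<otimes>\<^sub>o A) B" using T by (simp add: Mor_def)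
  show thesis
    by (rule ihom_lift[OF ihom A_Ob H_Ob g], rule that, assumption) (use T in simp)
qed

text \<open>Let \<open>f\<close> be the minimal polynomial of \<open>b\<close>; then \<open>f(a) = 0\<close> because \<open>f(b)\<close> determines \<open>f(a)\<close>.  In
  characteristic zero \<open>f'\<close> is nonzero and of smaller degree than \<open>f\<close>, so \<open>f'(b)\<close> is nonzero, hence
  injective.  If the commutator \<open>y\<close> of \<open>x\<close> is itself killed by \<open>T\<close>, then
  \<open>0 = f(b) x - x f(a) = f'(b) y\<close>.\<close>
lemma commutator_map_semisimple:
  assumes e: "ext_end \<phi> b a" and TM: "T \<in> Mor C H H"
    and T: "\<And>x v. x \<in> Fob F H \<Longrightarrow> v \<in> Fob F A \<Longrightarrow> hom (Farr F T x) v = Farr F b (hom x v) - hom x (Farr F a v)"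
    and x: "x \<in> Fob F H" and TT: "Farr F T (Farr F T x) = 0"
  shows "Farr F T x = 0"
proof -
  note D = ext_endD[OF e]
  have Tx: "Farr F T x \<in> Fob F H" using TM x by simp
  obtain f where f: "f \<noteq> 0" "\<And>x. x \<in> Fob F B \<Longrightarrow> poly_act b f x = 0"
    "\<And>r. r \<noteq> 0 \<Longrightarrow> (\<And>x. x \<in> Fob F B \<Longrightarrow> poly_act b r x = 0) \<Longrightarrow> degree f \<le> degree r"
    using minimal_polynomial[OF D(2)] by blast
  have fa: "poly_act a f v = 0" if "v \<in> Fob F A" for v
    using ext_end_B_zero[OF ext_end_poly[OF e] f(2) that] by blast
  have deg: "degree f \<noteq> 0"
  proof
    assume "degree f = 0"
    then obtain c where c: "f = [:c:]" by (rule degree_eq_zeroE)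
    obtain w where w: "w \<in> Fob F B" "w \<noteq> 0" by (rule B_vec)
    have "VScale F c w = 0" using f(2)[OF w(1)] D(2,7) w(1) by (simp add: c)
    then show False using w f(1) c by simp
  qed
  then have "pderiv f \<noteq> 0" "degree (pderiv f) < degree f" by (auto simp: pderiv_eq_0_iff degree_pderiv)
  then have nz: "\<exists>w \<in> Fob F B. poly_act b (pderiv f) w \<noteq> 0" using f(3) by (metis not_le)
  have y0: "hom (Farr F T x) v = 0" if v: "v \<in> Fob F A" for v
  proof (rule ext_end_injective[OF ext_end_poly[OF e] nz])
    show "hom (Farr F T x) v \<in> Fob F B" using Tx v by (rule hom_in)
    have "poly_act b f (hom x v) = hom x (poly_act a f v) + poly_act b (pderiv f) (hom (Farr F T x) v)"
    proof (rule poly_act_commutator[OF D(2,3) hom_linear[OF x] hom_linear[OF Tx] _ _ v])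
      show "Farr F b (hom x v) = hom x (Farr F a v) + hom (Farr F T x) v" if "v \<in> Fob F A" for v
        using T[OF x that] by simp
      show "hom (Farr F T x) (Farr F a v) = Farr F b (hom (Farr F T x) v)" if "v \<in> Fob F A" for v
        using T[OF Tx that] TT that objects typing by simp
    qed
    then show "poly_act b (pderiv f) (hom (Farr F T x) v) = 0"
      using f(2)[OF hom_in[OF x v]] fa[OF v] x objects typing by simp
  qed
  show ?thesis by (rule ihom_act_inj[OF ihom A_Ob B_Ob Tx y0])
qed

text \<open>Since \<open>ker T\<^sup>2 = ker T\<close>, the minimal polynomial of \<open>T\<close> has at most a simple root at \<open>0\<close>, which
  provides a generalised inverse of \<open>T\<close>.  As \<open>h \<mapsto> \<phi> \<circ> h - h \<circ> a\<close> extends \<open>T\<close> to \<open>X\<close>, \<open>T\<close> vanishes.\<close>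
lemma commutator_map_zero:
  assumes e: "ext_end \<phi> b a" and TM: "T \<in> Mor C H H"
    and T: "\<And>x v. x \<in> Fob F H \<Longrightarrow> v \<in> Fob F A \<Longrightarrow> hom (Farr F T x) v = Farr F b (hom x v) - hom x (Farr F a v)"
    and x: "x \<in> Fob F H"
  shows "Farr F T x = 0"
proof -
  note D = ext_endD[OF e]
  have TA: "T \<in> Arr C" "Dom C T = H" "Cod C T = H" using TM by (auto simp: Mor_def)
  note TT = D(4-12) typing objects TA
  obtain m where m: "m \<noteq> 0" "\<And>x. x \<in> Fob F H \<Longrightarrow> poly_act T m x = 0"
    "\<And>r. r \<noteq> 0 \<Longrightarrow> (\<And>x. x \<in> Fob F H \<Longrightarrow> poly_act T r x = 0) \<Longrightarrow> degree m \<le> degree r"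
    using minimal_polynomial[OF TM] by blast
  obtain c m1 where mc: "m = pCons c m1" by (cases m)
  have solve: "VScale F d y + z = 0 \<Longrightarrow> d \<noteq> 0 \<Longrightarrow> VScale F (- inverse d) z = y" for d y z
    by (metis V.scale_minus_left V.scale_minus_right V.scale_scale V.scale_one left_inverse minus_unique minus_minus)
  have "\<exists>d r. d \<noteq> 0 \<and> (\<forall>x \<in> Fob F H. VScale F d (Farr F T x) + Farr F T (Farr F T (poly_act T r x)) = 0)"
  proof (cases "c = 0")
    case False
    have "VScale F c (Farr F T x) + Farr F T (Farr F T (poly_act T m1 x)) = 0" if x: "x \<in> Fob F H" for x
    proof -
      have "Farr F T (VScale F c x + Farr F T (poly_act T m1 x)) = 0"
        using m(2)[OF x] TM x TA by (simp add: mc)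
      then show ?thesis using x TM H_Ob by (simp add: Farr_sums)
    qed
    then show ?thesis using False by blast
  next
    case True
    then have "m1 \<noteq> 0" using m(1) mc by simp
    obtain d m2 where md: "m1 = pCons d m2" by (cases m1)
    have T0: "VScale F d (Farr F T x) + Farr F T (Farr F T (poly_act T m2 x)) = 0" if x: "x \<in> Fob F H" for x
    proof -
      have "Farr F T (VScale F d x + Farr F T (poly_act T m2 x)) = 0"
        using m(2)[OF x] TM x TA by (simp add: mc md True)
      then show ?thesis using x TM H_Ob by (simp add: Farr_sums)
    qed
    have "d \<noteq> 0"
    proof
      assume d: "d = 0"
      have "poly_act T m1 x = 0" if x: "x \<in> Fob F H" for x
      proof -
        have "Farr F T (poly_act T m2 x) = 0"
          by (rule commutator_map_semisimple[OF e TM T]) (use T0[OF x] d x TM in auto)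
        then show ?thesis using TM x by (simp add: md d)
      qed
      from m(3)[OF \<open>m1 \<noteq> 0\<close> this] show False using \<open>m1 \<noteq> 0\<close> by (simp add: mc)
    qed
    then show ?thesis using T0 by blast
  qed
  then obtain d r where d: "d \<noteq> 0"
    "\<And>x. x \<in> Fob F H \<Longrightarrow> VScale F d (Farr F T x) + Farr F T (Farr F T (poly_act T r x)) = 0" by blast
  define d' where "d' = - inverse d"
  define U where "U = d' \<star> end_poly T r"
  have UM: "U \<in> Mor C H H" using Scale_in_Mor[OF end_poly_in[OF TM]] by (simp add: U_def)
  have TUT: "Farr F T (Farr F U (Farr F T x)) = Farr F T x" if x: "x \<in> Fob F H" for x
  proof -
    have "Farr F T (Farr F U (Farr F T x)) = VScale F d' (Farr F T (Farr F T (poly_act T r x)))"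
      using x TM end_poly_in[OF TM, of r] TA by (simp add: U_def Farr_sums poly_act_commute Mor_def)
    also have "\<dots> = Farr F T x" unfolding d'_def by (rule solve[OF d(2)[OF x] d(1)])
    finally show ?thesis .
  qed
  define \<theta> where "\<theta> = \<phi> \<cdot> \<rho> \<boxplus> (- 1) \<star> (\<rho> \<cdot> (Ide C X \<otimes>\<^sub>m a))"
  have \<theta>M: "\<theta> \<in> Mor C (X \<otimes>\<^sub>o A) E" using TT by (simp add: \<theta>_def Mor_def)
  let ?\<rho> = "\<lambda>x v. Farr F \<rho> (Fmult F X A x v)"
  have \<theta>x: "Farr F \<theta> (Fmult F X A x v) = Farr F \<phi> (?\<rho> x v) - ?\<rho> x (Farr F a v)"
    if "x \<in> Fob F X" "v \<in> Fob F A" for x v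
    using that TT by (simp add: \<theta>_def)
  have p\<theta>: "Farr F p (Farr F \<theta> (Fmult F X A x v)) = 0" if xv: "x \<in> Fob F X" "v \<in> Fob F A" for x v
  proof -
    obtain c where c: "\<And>v. v \<in> Fob F A \<Longrightarrow> Farr F p (?\<rho> x v) = VScale F c v" using p_rho[OF xv(1)] by blast
    show ?thesis
      using xv TT c by (simp add: \<theta>x D(14))
  qed
  obtain s where s: "s \<in> Mor C X H"
    "\<And>x v. x \<in> Fob F X \<Longrightarrow> v \<in> Fob F A \<Longrightarrow> Farr F i (hom (Farr F s x) v) = Farr F \<theta> (Fmult F X A x v)"
    using hom_from_family[OF \<theta>M p\<theta>] by blast
  have sA: "s \<in> Arr C" "Dom C s = X" "Cod C s = H" using s by (auto simp: Mor_def)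
  show ?thesis
  proof (rule regular_extends_zero[OF TM UM s(1) _ TUT x])
    fix x assume x: "x \<in> Fob F H"
    show "Farr F s (Farr F k x) = Farr F T x"
    proof (rule ihom_act_eqI[OF ihom A_Ob B_Ob])
      fix v assume v: "v \<in> Fob F A"
      have "Farr F i (hom (Farr F s (Farr F k x)) v) = Farr F i (Farr F b (hom x v)) - Farr F i (hom x (Farr F a v))"
        using x v TT sA s(2)[of "Farr F k x" v] \<theta>x[of "Farr F k x" v] by (simp add: rho_k D(13))
      also have "\<dots> = Farr F i (hom (Farr F T x) v)" using x v TT by (simp add: T)
      finally have eq: "Farr F i (hom (Farr F s (Farr F k x)) v) = Farr F i (hom (Farr F T x) v)" .
      show "hom (Farr F s (Farr F k x)) v = hom (Farr F T x) v"
        by (rule i_inj[OF _ _ eq]) (use x v TT sA in auto)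
    qed (use x TT sA in auto)
  qed
qed

text \<open>As the commutator map vanishes, every linear \<open>f : A \<rightarrow> B\<close> intertwines \<open>a\<close> and \<open>b\<close>.  A linear map
  that kills \<open>v\<close> but not \<open>a v\<close> cannot do so, hence \<open>v\<close> is an eigenvector of \<open>a\<close>; its eigenvalue is
  then passed to all of \<open>B\<close> by maps that take \<open>v\<close> to a given vector, and from there back to \<open>A\<close>.\<close>
lemma ext_end_scalar:
  assumes e: "ext_end \<phi> b a"
  obtains c where "b = c \<star> Ide C B" "a = c \<star> Ide C A"
proof -
  note D = ext_endD[OF e]
  note TT = D(4-12) typing objects
  obtain T where T: "T \<in> Mor C H H"
    "\<And>x v. x \<in> Fob F H \<Longrightarrow> v \<in> Fob F A \<Longrightarrow> hom (Farr F T x) v = Farr F b (hom x v) - hom x (Farr F a v)"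
    using commutator_map[OF e] by blast
  have comm: "Farr F b (f v) = f (Farr F a v)"
    if f: "linear_between (VScale F) (Fob F A) (Fob F B) f" and v: "v \<in> Fob F A" for f v
  proof -
    obtain x where x: "x \<in> Fob F H" "\<And>v. v \<in> Fob F A \<Longrightarrow> hom x v = f v"
      using ihom_act_surj[OF ihom A_Ob B_Ob f] by blast
    have "Farr F b (hom x v) - hom x (Farr F a v) = 0"
      using T(2)[OF x(1) v] commutator_map_zero[OF e T x(1)] v TT by simp
    then show ?thesis using x(2) v TT by simp
  qed
  obtain v0 where v0: "v0 \<in> Fob F A" "v0 \<noteq> 0" by (rule A_vec)
  obtain w0 where w0: "w0 \<in> Fob F B" "w0 \<noteq> 0" by (rule B_vec)
  have "Farr F a v0 \<in> V.span {v0}"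
  proof (rule ccontr)
    assume n: "Farr F a v0 \<notin> V.span {v0}"
    obtain f where f: "linear_between (VScale F) (Fob F A) (Fob F B) f" "f (Farr F a v0) = w0" "f v0 = 0"
      by (rule linear_map_separating[OF A_Ob B_Ob _ _ _ n w0(1)]) (use v0 TT in auto)
    show False using comm[OF f(1) v0(1)] f w0 TT by simp
  qed
  then obtain c where c: "Farr F a v0 = VScale F c v0" by (auto simp: V.span_singleton)
  have bw: "Farr F b w = VScale F c w" if w: "w \<in> Fob F B" for w
  proof -
    have "v0 \<notin> V.span {}" using v0 by simp
    then obtain f where f: "linear_between (VScale F) (Fob F A) (Fob F B) f" "f v0 = w"
      using linear_map_separating[OF A_Ob B_Ob V.independent_empty _ v0(1) _ w] by auto
    have "f (VScale F c v0) = VScale F c w" using f v0 by (auto simp: linear_between_def)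
    then show ?thesis using comm[OF f(1) v0(1)] f(2) c by simp
  qed
  have av: "Farr F a v = VScale F c v" if v: "v \<in> Fob F A" for v
  proof (rule ccontr)
    let ?u = "Farr F a v - VScale F c v"
    assume "Farr F a v \<noteq> VScale F c v"
    then have "?u \<notin> V.span {}" by simp
    moreover have u: "?u \<in> Fob F A" using v TT by simp
    ultimately obtain f where f: "linear_between (VScale F) (Fob F A) (Fob F B) f" "f ?u = w0"
      using linear_map_separating[OF A_Ob B_Ob V.independent_empty _ u _ w0(1)] by auto
    have "VScale F c v \<in> Fob F A" using v A_Ob by simp
    then have add: "f (?u + VScale F c v) = f ?u + f (VScale F c v)" and sc: "f (VScale F c v) = VScale F c (f v)"
      and fv: "f v \<in> Fob F B"
      using f(1) v u unfolding linear_between_def by blast+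
    have "f (Farr F a v) = w0 + VScale F c (f v)" using add sc f(2) by simp
    then show False using comm[OF f(1) v] bw[OF fv] w0 by simp
  qed
  show thesis
  proof (rule that[of c])
    show "b = c \<star> Ide C B" by (rule Mor_eqI) (use bw TT in auto)
    show "a = c \<star> Ide C A" by (rule Mor_eqI) (use av TT in auto)
  qed
qed

lemma Omega_image:
  "Omega C i p ` End_sub C i = {(c \<star> Ide C B, c \<star> Ide C A) | c. True}"
proof -
  have r: "restrict_end C i \<phi> = b" if e: "ext_end \<phi> b a" for \<phi> b a
  proof -
    note D = ext_endD[OF e]
    have ib: "i \<cdot> b = \<phi> \<cdot> i" by (rule Mor_eqI) (use D typing in auto)
    show ?thesis
      unfolding restrict_end_def
    proof (rule the_equality)
      show "b \<in> Mor C (Dom C i) (Dom C i) \<and> i \<cdot> b = \<phi> \<cdot> i" using D ib typing by simp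
      fix b' assume "b' \<in> Mor C (Dom C i) (Dom C i) \<and> i \<cdot> b' = \<phi> \<cdot> i"
      then have "b' \<in> Mor C (Dom C i) (Dom C i)" "i \<cdot> b' = i \<cdot> b" using ib by auto
      moreover have "b \<in> Mor C (Dom C i) (Dom C i)" using D typing by simp
      ultimately show "b' = b" using epi_k_q(3) unfolding is_mono_def by blast
    qed
  qed
  have s: "induced_end C p \<phi> = a" if e: "ext_end \<phi> b a" for \<phi> b a
  proof -
    note D = ext_endD[OF e]
    have ap: "a \<cdot> p = p \<cdot> \<phi>" by (rule Mor_eqI) (use D typing in auto)
    show ?thesis
      unfolding induced_end_def
    proof (rule the_equality)
      show "a \<in> Mor C (Cod C p) (Cod C p) \<and> a \<cdot> p = p \<cdot> \<phi>" using D ap typing by simp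
      fix a' assume "a' \<in> Mor C (Cod C p) (Cod C p) \<and> a' \<cdot> p = p \<cdot> \<phi>"
      then have "a' \<in> Mor C (Cod C p) (Cod C p)" "a' \<cdot> p = a \<cdot> p" using ap by auto
      moreover have "a \<in> Mor C (Cod C p) (Cod C p)" using D typing by simp
      ultimately show "a' = a" using epi_k_q(4) unfolding is_epi_def by blast
    qed
  qed
  have 1: "\<exists>b a. ext_end \<phi> b a" if \<phi>: "\<phi> \<in> End_sub C i" for \<phi>
  proof -
    obtain b where b: "b \<in> Mor C B B" "i \<cdot> b = \<phi> \<cdot> i" and \<phi>E: "\<phi> \<in> Mor C E E"
      using \<phi> typing by (auto simp: End_sub_def)
    have A: "b \<in> Arr C" "Dom C b = B" "Cod C b = B" "\<phi> \<in> Arr C" "Dom C \<phi> = E" "Cod C \<phi> = E"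
      using b \<phi>E by (auto simp: Mor_def)
    have ib: "Farr F i (Farr F b w) = Farr F \<phi> (Farr F i w)" if "w \<in> Fob F B" for w
      using Farr_comp[of b i w] Farr_comp[of i \<phi> w] that A typing b(2) by simp
    have p\<phi>: "p \<cdot> \<phi> \<in> Mor C (Dom C p) A" using A typing by (simp add: Mor_def)
    have ker: "Farr F (p \<cdot> \<phi>) x = 0" if x: "x \<in> Fob F (Dom C p)" "Farr F p x = 0" for x
    proof -
      obtain w where w: "w \<in> Fob F B" "x = Farr F i w" using p_kernel x typing by auto
      then have "Farr F \<phi> x = Farr F i (Farr F b w)" using ib by simp
      then show ?thesis using x w A typing by (simp add: p_i)
    qed
    obtain a where a: "a \<in> Mor C (Cod C p) A" "a \<cdot> p = p \<cdot> \<phi>"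
      using factor_through_epi[OF epi_k_q(4) p\<phi> ker] by blast
    have aA: "a \<in> Arr C" "Dom C a = A" "Cod C a = A" using a typing by (auto simp: Mor_def)
    have "Farr F a (Farr F p x) = Farr F p (Farr F \<phi> x)" if "x \<in> Fob F E" for x
      using Farr_comp[of p a x] Farr_comp[of \<phi> p x] that A aA typing a(2) by simp
    then have "ext_end \<phi> b a" unfolding ext_end_def using b \<phi>E a typing ib by auto
    then show ?thesis by blast
  qed
  have 2: "ext_end (c \<star> Ide C E) (c \<star> Ide C B) (c \<star> Ide C A)" for c
    unfolding ext_end_def using objects typing Ide_in_Mor Scale_in_Mor by auto
  have 3: "c \<star> Ide C E \<in> End_sub C i" for c
    unfolding End_sub_def
  proof (intro CollectI conjI bexI[of _ "c \<star> Ide C B"])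
    show "i \<cdot> c \<star> Ide C B = (c \<star> Ide C E) \<cdot> i" by (rule Mor_eqI) (use objects typing in auto)
  qed (use objects typing Ide_in_Mor Scale_in_Mor in auto)
  show ?thesis
  proof (intro equalityI subsetI)
    fix z assume "z \<in> Omega C i p ` End_sub C i"
    then obtain \<phi> where \<phi>: "\<phi> \<in> End_sub C i" "z = Omega C i p \<phi>" by auto
    obtain b a where e: "ext_end \<phi> b a" using 1[OF \<phi>(1)] by blast
    obtain c where "b = c \<star> Ide C B" "a = c \<star> Ide C A" by (rule ext_end_scalar[OF e])
    then show "z \<in> {(c \<star> Ide C B, c \<star> Ide C A) | c. True}"
      using \<phi>(2) r[OF e] s[OF e] by (auto simp: Omega_def)
  next
    fix z assume "z \<in> {(c \<star> Ide C B, c \<star> Ide C A) | c. True}"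
    then obtain c where "z = (c \<star> Ide C B, c \<star> Ide C A)" by auto
    then have "z = Omega C i p (c \<star> Ide C E)" using r[OF 2] s[OF 2] by (simp add: Omega_def)
    then show "z \<in> Omega C i p ` End_sub C i" using 3 by blast
  qed
qed

end

section \<open>Transfer to the unit object\<close>

context neutral_tannakian
begin

lemma biproduct_fibre:
  assumes b: "is_biproduct C X Y P i1 i2 p1 p2"
  shows "i1 \<in> Arr C" "Dom C i1 = X" "Cod C i1 = P" "i2 \<in> Arr C" "Dom C i2 = Y" "Cod C i2 = P"
    "p1 \<in> Arr C" "Dom C p1 = P" "Cod C p1 = X" "p2 \<in> Arr C" "Dom C p2 = P" "Cod C p2 = Y"
    "X \<in> Ob C" "Y \<in> Ob C" "P \<in> Ob C"
    and "\<And>x. x \<in> Fob F X \<Longrightarrow> Farr F p1 (Farr F i1 x) = x" "\<And>y. y \<in> Fob F Y \<Longrightarrow> Farr F p2 (Farr F i2 y) = y"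
    "\<And>x. x \<in> Fob F X \<Longrightarrow> Farr F p2 (Farr F i1 x) = 0" "\<And>y. y \<in> Fob F Y \<Longrightarrow> Farr F p1 (Farr F i2 y) = 0"
    "\<And>z. z \<in> Fob F P \<Longrightarrow> Farr F i1 (Farr F p1 z) + Farr F i2 (Farr F p2 z) = z"
proof -
  show T: "i1 \<in> Arr C" "Dom C i1 = X" "Cod C i1 = P" "i2 \<in> Arr C" "Dom C i2 = Y" "Cod C i2 = P"
    "p1 \<in> Arr C" "Dom C p1 = P" "Cod C p1 = X" "p2 \<in> Arr C" "Dom C p2 = P" "Cod C p2 = Y"
    using b by (auto simp: is_biproduct_def Mor_def)
  show O: "X \<in> Ob C" "Y \<in> Ob C" "P \<in> Ob C" using T Dom_in_Ob by metis+
  have eqs: "p1 \<cdot> i1 = Ide C X" "p2 \<cdot> i2 = Ide C Y" "p2 \<cdot> i1 = Zero C X Y" "p1 \<cdot> i2 = Zero C Y X"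
    "(i1 \<cdot> p1) \<boxplus> (i2 \<cdot> p2) = Ide C P"
    using b by (auto simp: is_biproduct_def)
  show "Farr F p1 (Farr F i1 x) = x" if "x \<in> Fob F X" for x
    using Farr_comp[of i1 p1 x] T O that unfolding eqs by simp
  show "Farr F p2 (Farr F i2 x) = x" if "x \<in> Fob F Y" for x
    using Farr_comp[of i2 p2 x] T O that unfolding eqs by simp
  show "Farr F p2 (Farr F i1 x) = 0" if "x \<in> Fob F X" for x
    using Farr_comp[of i1 p2 x] T O that unfolding eqs by simp
  show "Farr F p1 (Farr F i2 x) = 0" if "x \<in> Fob F Y" for x
    using Farr_comp[of i2 p1 x] T O that unfolding eqs by simp
  show "Farr F i1 (Farr F p1 z) + Farr F i2 (Farr F p2 z) = z" if "z \<in> Fob F P" for z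
    using Farr_add[of "i1 \<cdot> p1" "i2 \<cdot> p2" z] T O that unfolding eqs by simp
qed

lemma iso_Ide: "X \<in> Ob C \<Longrightarrow> is_iso C (Ide C X)"
  unfolding is_iso_def is_inverse_def
  using Ide_in_Mor[of X] Comp_Ide_left[of "Ide C X" X X] by (intro exI[of _ "Ide C X"]) simp

lemma iso_surj:
  assumes "is_iso C f" "y \<in> Fob F (Cod C f)"
  obtains x where "x \<in> Fob F (Dom C f)" "Farr F f x = y"
proof -
  obtain g where g: "is_inverse C f g" using assms by (auto simp: is_iso_def)
  have T: "f \<in> Arr C" "g \<in> Arr C" "Dom C g = Cod C f" "Cod C g = Dom C f" "f \<cdot> g = Ide C (Cod C f)"
    using g by (auto simp: is_inverse_def Mor_def)
  have "Farr F f (Farr F g y) = y"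
    using Farr_comp[of g f y] T assms(2) Cod_in_Ob[OF T(1)] by simp
  then show thesis using that[of "Farr F g y"] T assms(2) by simp
qed

text \<open>If \<open>g : H \<rightarrow> Q\<close> extends to \<open>r : X \<rightarrow> Q\<close>, the pushforward along \<open>g\<close> is the direct sum of \<open>Q\<close> and \<open>U\<close>,
  with \<open>(r, q)\<close> as the arrow out of \<open>X\<close>.\<close>
lemma pushforward_split:
  assumes ex: "short_exact C k q" and k: "k \<in> Mor C H X" and q: "q \<in> Mor C X U"
    and g: "g \<in> Mor C H Q" and r: "r \<in> Mor C X Q" and rk: "r \<cdot> k = g" and \<xi>: "(k, q) \<in> \<xi>"
  shows "\<exists>(i', p') \<in> ext_pushforward C g \<xi>. split_extension C i' p'"
proof -
  have O: "H \<in> Ob C" "X \<in> Ob C" "U \<in> Ob C" "Q \<in> Ob C" using Mor_Ob[OF k] Mor_Ob[OF q] Mor_Ob[OF g] by auto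
  obtain P i1 i2 p1 p2 where b: "is_biproduct C Q U P i1 i2 p1 p2" using ex_biproduct[OF O(4,3)] by blast
  note bi = biproduct_fibre[OF b]
  have A: "k \<in> Arr C" "Dom C k = H" "Cod C k = X" "q \<in> Arr C" "Dom C q = X" "Cod C q = U"
    "g \<in> Arr C" "Dom C g = H" "Cod C g = Q" "r \<in> Arr C" "Dom C r = X" "Cod C r = Q"
    using k q g r by (auto simp: Mor_def)
  note T = A O bi(1-15)
  have qk: "Farr F q (Farr F k x) = 0" if "x \<in> Fob F H" for x using Farr_exact[OF ex] that A by auto
  have rkx: "Farr F r (Farr F k x) = Farr F g x" if "x \<in> Fob F H" for x
    using Farr_comp[of k r x] that A unfolding rk by simp
  have qe: "is_epi C q" using short_exactD[OF ex] by simp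
  have se: "short_exact C i1 p2"
  proof (rule short_exactI_fibre[of i1 Q P p2 U])
    show "x = 0" if "x \<in> Fob F Q" "Farr F i1 x = 0" for x using bi(16)[OF that(1)] that T by simp
    show "\<exists>x \<in> Fob F Q. Farr F i1 x = y" if "y \<in> Fob F P" "Farr F p2 y = 0" for y
      using bi(20)[OF that(1)] that T by (intro bexI[of _ "Farr F p1 y"]) auto
    show "\<exists>y \<in> Fob F P. Farr F p2 y = z" if "z \<in> Fob F U" for z
      using bi(17)[OF that] that T by (intro bexI[of _ "Farr F i2 z"]) auto
  qed (use T bi in \<open>auto simp: Mor_def\<close>)
  define G where "G = (i1 \<cdot> r) \<boxplus> (i2 \<cdot> q)"
  have G: "G \<in> Arr C" "Dom C G = X" "Cod C G = P" using T by (auto simp: G_def)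
  have Gx: "Farr F G x = Farr F i1 (Farr F r x) + Farr F i2 (Farr F q x)" if "x \<in> Fob F X" for x
    using T that by (simp add: G_def)
  have po: "is_pushout C g k i1 G"
    unfolding is_pushout_def
  proof (intro conjI allI ballI impI)
    show "i1 \<cdot> g = G \<cdot> k"
      by (rule Mor_eqI) (use T G qk rkx in \<open>auto simp: Gx\<close>)
    fix Z a b' assume a: "a \<in> Mor C (Cod C g) Z" and b': "b' \<in> Mor C (Cod C k) Z" and eq: "a \<cdot> g = b' \<cdot> k"
    have Z: "Z \<in> Ob C" using Mor_Ob[OF a] by simp
    have aA: "a \<in> Arr C" "Dom C a = Q" "Cod C a = Z" "b' \<in> Arr C" "Dom C b' = X" "Cod C b' = Z"
      using a b' A by (auto simp: Mor_def)
    have eqx: "Farr F b' (Farr F k x) = Farr F a (Farr F g x)" if "x \<in> Fob F H" for x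
      using Farr_comp[of k b' x] Farr_comp[of g a x] that aA A eq by simp
    define d where "d = b' \<boxplus> (- 1) \<star> (a \<cdot> r)"
    have d: "d \<in> Mor C (Dom C q) Z" using T aA by (simp add: d_def Mor_def)
    have dx: "Farr F d x = Farr F b' x - Farr F a (Farr F r x)" if "x \<in> Fob F X" for x
      using T aA that by (simp add: d_def)
    have d0: "Farr F d x = 0" if "x \<in> Fob F (Dom C q)" "Farr F q x = 0" for x
    proof -
      have "x \<in> Farr F k ` Fob F H" using Farr_exact[OF ex] that A by auto
      then show ?thesis using dx eqx rkx T by auto
    qed
    obtain c where c: "c \<in> Mor C (Cod C q) Z" "c \<cdot> q = d" using factor_through_epi[OF qe d d0] by blast
    have cA: "c \<in> Arr C" "Dom C c = U" "Cod C c = Z" using c A by (auto simp: Mor_def)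
    have cq: "Farr F c (Farr F q x) = Farr F b' x - Farr F a (Farr F r x)" if "x \<in> Fob F X" for x
      using Farr_comp[of q c x] that cA A dx[OF that] unfolding c(2) by simp
    define t where "t = (a \<cdot> p1) \<boxplus> (c \<cdot> p2)"
    have t: "t \<in> Arr C" "Dom C t = P" "Cod C t = Z" using T aA cA by (auto simp: t_def)
    have tx: "Farr F t z = Farr F a (Farr F p1 z) + Farr F c (Farr F p2 z)" if "z \<in> Fob F P" for z
      using T aA cA that by (simp add: t_def)
    show "\<exists>!t. t \<in> Mor C (Cod C i1) Z \<and> t \<cdot> i1 = a \<and> t \<cdot> G = b'"
    proof (rule ex1I[of _ t], intro conjI)
      show "t \<in> Mor C (Cod C i1) Z" using t T by (simp add: Mor_def)
      show "t \<cdot> i1 = a" by (rule Mor_eqI) (use t T aA cA bi(16-20) in \<open>auto simp: tx\<close>)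
      show "t \<cdot> G = b'" by (rule Mor_eqI) (use t T G aA cA bi(16-20) in \<open>auto simp: tx Gx cq\<close>)
      fix t' assume t': "t' \<in> Mor C (Cod C i1) Z \<and> t' \<cdot> i1 = a \<and> t' \<cdot> G = b'"
      then have t'A: "t' \<in> Arr C" "Dom C t' = P" "Cod C t' = Z" using T by (auto simp: Mor_def)
      have e1: "Farr F t' (Farr F i1 x) = Farr F a x" if "x \<in> Fob F Q" for x
        using Farr_comp[of i1 t' x] t' t'A T that by simp
      have e2: "Farr F t' (Farr F i2 (Farr F q x)) = Farr F b' x - Farr F a (Farr F r x)" if "x \<in> Fob F X" for x
      proof -
        have "Farr F t' (Farr F G x) = Farr F b' x" using Farr_comp[of G t' x] t' t'A G that by simp
        then show ?thesis using that t'A T e1[of "Farr F r x"] by (simp add: Gx algebra_simps)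
      qed
      show "t' = t"
      proof (rule Mor_eqI)
        fix z assume "z \<in> Fob F (Dom C t)"
        then have z: "z \<in> Fob F P" using t by simp
        then have "Farr F p2 z \<in> Fob F (Cod C q)" using T by simp
        then obtain x where x: "x \<in> Fob F (Dom C q)" "Farr F q x = Farr F p2 z" by (rule epi_surj[OF qe])
        have "Farr F t' (Farr F i1 (Farr F p1 z) + Farr F i2 (Farr F p2 z)) =
          Farr F a (Farr F p1 z) + Farr F c (Farr F p2 z)"
          using z x t'A T e1[of "Farr F p1 z"] e2[of x] cq[of x] by simp
        then show "Farr F t' z = Farr F t z" using bi(20)[OF z] tx[OF z] by simp
      qed (use t t'A in auto)
    qed
  qed (use T G in \<open>auto simp: Mor_def\<close>)
  have pG: "p2 \<cdot> G = q"
    by (rule Mor_eqI) (use T G bi(16-20) in \<open>auto simp: Gx\<close>)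
  have "p2 \<cdot> i2 = Ide C (Cod C p2)" using b T by (simp add: is_biproduct_def)
  moreover have "i2 \<in> Mor C (Cod C p2) (Dom C p2)" using T by (simp add: Mor_def)
  ultimately have "split_extension C i1 p2" unfolding split_extension_def by blast
  moreover have "(i1, p2) \<in> ext_pushforward C g \<xi>"
    unfolding ext_pushforward_def using se po pG \<xi> by blast
  ultimately show ?thesis by blast
qed

text \<open>The pullback is the kernel of \<open>(p, -j) : Y \<oplus> U \<rightarrow> Z\<close>; the last two conclusions say that its fibre
  is the pullback of the fibres.\<close>
lemma ex_pullback:
  assumes p: "p \<in> Mor C Y Z" and j: "j \<in> Mor C U Z"
  obtains X r q where "r \<in> Mor C X Y" "q \<in> Mor C X U" "is_pullback C p j r q"
    "\<And>x. x \<in> Fob F X \<Longrightarrow> Farr F r x = 0 \<Longrightarrow> Farr F q x = 0 \<Longrightarrow> x = 0"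
    "\<And>y u. y \<in> Fob F Y \<Longrightarrow> u \<in> Fob F U \<Longrightarrow> Farr F p y = Farr F j u \<Longrightarrow>
       \<exists>x \<in> Fob F X. Farr F r x = y \<and> Farr F q x = u"
proof -
  have O: "Y \<in> Ob C" "Z \<in> Ob C" "U \<in> Ob C" using Mor_Ob[OF p] Mor_Ob[OF j] by auto
  have A: "p \<in> Arr C" "Dom C p = Y" "Cod C p = Z" "j \<in> Arr C" "Dom C j = U" "Cod C j = Z"
    using p j by (auto simp: Mor_def)
  obtain P i1 i2 p1 p2 where b: "is_biproduct C Y U P i1 i2 p1 p2" using ex_biproduct[OF O(1,3)] by blast
  note bi = biproduct_fibre[OF b]
  note T = A O bi(1-15)
  define d where "d = (p \<cdot> p1) \<boxplus> (- 1) \<star> (j \<cdot> p2)"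
  have d: "d \<in> Arr C" "Dom C d = P" "Cod C d = Z" using T by (auto simp: d_def)
  have dx: "Farr F d z = Farr F p (Farr F p1 z) - Farr F j (Farr F p2 z)" if "z \<in> Fob F P" for z
    using T that by (simp add: d_def)
  obtain n where n: "is_kernel C n d" using ex_kernel[OF d(1)] by blast
  have nm: "is_mono C n" using is_kernel_is_mono[OF n] .
  note nk = kernel_fibre[OF n]
  define X where "X = Dom C n"
  have nA: "n \<in> Arr C" "Dom C n = X" "Cod C n = P"
    using n d unfolding is_kernel_def Mor_def X_def by auto
  define r where "r = p1 \<cdot> n"
  define q where "q = p2 \<cdot> n"
  have rq: "r \<in> Arr C" "Dom C r = X" "Cod C r = Y" "q \<in> Arr C" "Dom C q = X" "Cod C q = U"
    using T nA by (auto simp: r_def q_def)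
  have rx: "Farr F r x = Farr F p1 (Farr F n x)" "Farr F q x = Farr F p2 (Farr F n x)" if "x \<in> Fob F X" for x
    using T nA that by (auto simp: r_def q_def)
  have nx: "Farr F n v = Farr F i1 (Farr F r v) + Farr F i2 (Farr F q v)" if "v \<in> Fob F X" for v
    using bi(20)[of "Farr F n v"] rx[OF that] that nA by simp
  have sep: "Farr F n x = Farr F n y" if "x \<in> Fob F X" "y \<in> Fob F X" "Farr F r x = Farr F r y" "Farr F q x = Farr F q y" for x y
    using nx[OF that(1)] nx[OF that(2)] that(3,4) by simp
  have sq: "Farr F p (Farr F r x) = Farr F j (Farr F q x)" if x: "x \<in> Fob F X" for x
  proof -
    have "Farr F n x \<in> {x \<in> Fob F (Dom C d). Farr F d x = 0}" using nk x nA by blast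
    then have "Farr F p (Farr F p1 (Farr F n x)) - Farr F j (Farr F p2 (Farr F n x)) = 0"
      using dx[of "Farr F n x"] d by simp
    then show ?thesis using rx[OF x] by simp
  qed
  have sq': "p \<cdot> r = j \<cdot> q" by (rule Mor_eqI) (use T rq sq in auto)
  show thesis
  proof (rule that[of r X q])
    show "r \<in> Mor C X Y" "q \<in> Mor C X U" using rq by (auto simp: Mor_def)
    show "x = 0" if "x \<in> Fob F X" "Farr F r x = 0" "Farr F q x = 0" for x
      using nx[OF that(1)] that nA T mono_inj0[OF nm, of x] by simp
    show "\<exists>x \<in> Fob F X. Farr F r x = y \<and> Farr F q x = u"
      if yu: "y \<in> Fob F Y" "u \<in> Fob F U" "Farr F p y = Farr F j u" for y u
    proof -
      let ?z = "Farr F i1 y + Farr F i2 u"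
      have "?z \<in> Fob F P" "Farr F d ?z = 0" using yu T bi(16-20) by (auto simp: dx)
      then have "?z \<in> Farr F n ` Fob F X" using nk nA d by auto
      then obtain x where x: "x \<in> Fob F X" "Farr F n x = ?z" by auto
      then show ?thesis using rx[OF x(1)] yu T bi(16-20) by (intro bexI[of _ x]) auto
    qed
    show "is_pullback C p j r q"
      unfolding is_pullback_def
    proof (intro conjI allI ballI impI)
      fix V a b' assume a: "a \<in> Mor C V (Dom C p)" and b': "b' \<in> Mor C V (Dom C j)" and eq: "p \<cdot> a = j \<cdot> b'"
      have V: "V \<in> Ob C" using Mor_Ob[OF a] by simp
      have aA: "a \<in> Arr C" "Dom C a = V" "Cod C a = Y" "b' \<in> Arr C" "Dom C b' = V" "Cod C b' = U"
        using a b' A by (auto simp: Mor_def)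
      have eqx: "Farr F p (Farr F a x) = Farr F j (Farr F b' x)" if "x \<in> Fob F V" for x
        using Farr_comp[of a p x] Farr_comp[of b' j x] that aA A eq by simp
      define h where "h = (i1 \<cdot> a) \<boxplus> (i2 \<cdot> b')"
      have h: "h \<in> Arr C" "Dom C h = V" "Cod C h = P" using T aA by (auto simp: h_def)
      have hx: "Farr F h x = Farr F i1 (Farr F a x) + Farr F i2 (Farr F b' x)" if "x \<in> Fob F V" for x
        using T aA that by (simp add: h_def)
      have dh: "d \<cdot> h = Zero C V (Cod C d)"
        by (rule Mor_eqI) (use T aA h d V eqx bi(16-20) in \<open>auto simp: hx dx\<close>)
      obtain t where t: "t \<in> Mor C V (Dom C n)" "n \<cdot> t = h"
        by (rule kernel_factor[OF n _ dh]) (use h d in \<open>auto simp: Mor_def\<close>)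
      have tA: "t \<in> Arr C" "Dom C t = V" "Cod C t = X" using t nA by (auto simp: Mor_def)
      have nt: "Farr F n (Farr F t x) = Farr F h x" if "x \<in> Fob F V" for x
        using Farr_comp[of t n x] that tA nA unfolding t(2) by simp
      show "\<exists>!t. t \<in> Mor C V (Dom C q) \<and> r \<cdot> t = a \<and> q \<cdot> t = b'"
      proof (rule ex1I[of _ t], intro conjI)
        show "t \<in> Mor C V (Dom C q)" using tA rq by (simp add: Mor_def)
        show "r \<cdot> t = a" by (rule Mor_eqI) (use T aA tA rq bi(16-20) in \<open>auto simp: rx nt hx\<close>)
        show "q \<cdot> t = b'" by (rule Mor_eqI) (use T aA tA rq bi(16-20) in \<open>auto simp: rx nt hx\<close>)
        fix t' assume t': "t' \<in> Mor C V (Dom C q) \<and> r \<cdot> t' = a \<and> q \<cdot> t' = b'"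
        then have t'A: "t' \<in> Arr C" "Dom C t' = V" "Cod C t' = X" using rq by (auto simp: Mor_def)
        show "t' = t"
        proof (rule Mor_eqI)
          fix x assume "x \<in> Fob F (Dom C t)"
          then have x: "x \<in> Fob F V" using tA by simp
          have "Farr F n (Farr F t' x) = Farr F n (Farr F t x)"
          proof (rule sep)
            have "Farr F r (Farr F t' x) = Farr F a x" using Farr_comp[of t' r x] t' t'A rq x by simp
            then show "Farr F r (Farr F t' x) = Farr F r (Farr F t x)"
              using x tA T aA bi(16-20) by (simp add: rx nt hx)
            have "Farr F q (Farr F t' x) = Farr F b' x" using Farr_comp[of t' q x] t' t'A rq x by simp
            then show "Farr F q (Farr F t' x) = Farr F q (Farr F t x)"
              using x tA T aA bi(16-20) by (simp add: rx nt hx)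
          qed (use x tA t'A in auto)
          then show "Farr F t' x = Farr F t x"
            using mono_inj[OF nm, of "Farr F t' x" "Farr F t x"] x tA t'A nA by simp
        qed (use tA t'A in auto)
      qed
    qed (use T rq sq' in \<open>auto simp: Mor_def\<close>)
  qed
qed

text \<open>Exactness of the transferred extension is checked on fibres, where \<open>X\<close> is the space of linear
  maps from \<open>A\<close> to \<open>E\<close> whose composite with \<open>p\<close> is a scalar.  It is onto the scalars because \<open>p\<close> has a
  linear section.\<close>
lemma ext_to_unit_representative:
  assumes A: "A \<in> Ob C" and B: "B \<in> Ob C" and i: "i \<in> Mor C B E" and p: "p \<in> Mor C E A"
    and exact: "short_exact C i p" and ih: "is_ihom C A B H ev"
  obtains X k q \<rho> where
    "(k, q) \<in> ext_to_unit C A B H ev (ext_class C A B i p)"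
    "k \<in> Mor C H X" "q \<in> Mor C X (Unit C)" "short_exact C k q"
    "\<rho> \<in> Mor C (X \<otimes>\<^sub>o A) E" "\<rho> \<cdot> (k \<otimes>\<^sub>m Ide C A) = i \<cdot> ev" "p \<cdot> \<rho> = LUnit C A \<cdot> (q \<otimes>\<^sub>m Ide C A)"
proof -
  have E: "E \<in> Ob C" using Mor_Ob[OF i] by simp
  obtain HE evE where ihE: "is_ihom C A E HE evE" using ex_ihom[OF A E] by blast
  obtain HA evA where ihA: "is_ihom C A A HA evA" using ex_ihom[OF A A] by blast
  note T = ihom_typing[OF ih] ihom_typing[OF ihE] ihom_typing[OF ihA] A B E
  have ip: "i \<in> Arr C" "Dom C i = B" "Cod C i = E" "p \<in> Arr C" "Dom C p = E" "Cod C p = A"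
    using i p by (auto simp: Mor_def)
  have i_inj: "x = y" if "x \<in> Fob F B" "y \<in> Fob F B" "Farr F i x = Farr F i y" for x y
    using Farr_exact[OF exact] that ip by (auto simp: inj_on_def)
  have p_i: "Farr F p (Farr F i x) = 0" if "x \<in> Fob F B" for x
    using Farr_exact[OF exact] that ip by auto
  have p_ker: "x \<in> Farr F i ` Fob F B" if "x \<in> Fob F E" "Farr F p x = 0" for x
    using Farr_exact[OF exact] that ip by auto
  have iev: "i \<cdot> ev \<in> Mor C (H \<otimes>\<^sub>o A) E" and pev: "p \<cdot> evE \<in> Mor C (HE \<otimes>\<^sub>o A) A"
    using T ip by (auto simp: Mor_def)
  obtain i1 where i1: "i1 \<in> Mor C H HE" "evE \<cdot> (i1 \<otimes>\<^sub>m Ide C A) = i \<cdot> ev"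
    "\<And>x a. x \<in> Fob F H \<Longrightarrow> a \<in> Fob F A \<Longrightarrow> act HE A evE (Farr F i1 x) a = Farr F (i \<cdot> ev) (Fmult F H A x a)"
    using ihom_lift[OF ihE A T(1) iev] by blast
  obtain p1 where p1: "p1 \<in> Mor C HE HA" "evA \<cdot> (p1 \<otimes>\<^sub>m Ide C A) = p \<cdot> evE"
    "\<And>x a. x \<in> Fob F HE \<Longrightarrow> a \<in> Fob F A \<Longrightarrow> act HA A evA (Farr F p1 x) a = Farr F (p \<cdot> evE) (Fmult F HE A x a)"
    using ihom_lift[OF ihA A T(5) pev] by blast
  obtain j where j: "j \<in> Mor C (Unit C) HA" "evA \<cdot> (j \<otimes>\<^sub>m Ide C A) = LUnit C A"
    "\<And>x a. x \<in> Fob F (Unit C) \<Longrightarrow> a \<in> Fob F A \<Longrightarrow> act HA A evA (Farr F j x) a = Farr F (LUnit C A) (Fmult F (Unit C) A x a)"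
    using ihom_lift[OF ihA A Unit_in_Ob LUnit_in_Mor[OF A]] by blast
  obtain X r q where rq: "r \<in> Mor C X HE" "q \<in> Mor C X (Unit C)" and pb: "is_pullback C p1 j r q"
    and sep: "\<And>x. x \<in> Fob F X \<Longrightarrow> Farr F r x = 0 \<Longrightarrow> Farr F q x = 0 \<Longrightarrow> x = 0"
    and pt: "\<And>y u. y \<in> Fob F HE \<Longrightarrow> u \<in> Fob F (Unit C) \<Longrightarrow> Farr F p1 y = Farr F j u \<Longrightarrow>
       \<exists>x \<in> Fob F X. Farr F r x = y \<and> Farr F q x = u"
  proof (rule ex_pullback[OF p1(1) j(1)], goal_cases)
    case (1 X r q)
    show ?case by (rule 1(1)[OF 1(2-6)])
  qed
  have X: "X \<in> Ob C" using Mor_Ob[OF rq(1)] by simp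
  have R: "i1 \<in> Arr C" "Dom C i1 = H" "Cod C i1 = HE" "p1 \<in> Arr C" "Dom C p1 = HE" "Cod C p1 = HA"
    "j \<in> Arr C" "Dom C j = Unit C" "Cod C j = HA" "r \<in> Arr C" "Dom C r = X" "Cod C r = HE"
    "q \<in> Arr C" "Dom C q = X" "Cod C q = Unit C"
    using i1 p1 j rq by (auto simp: Mor_def)
  note T = T ip X R
  have i1x: "act HE A evE (Farr F i1 x) a = Farr F i (act H A ev x a)" if "x \<in> Fob F H" "a \<in> Fob F A" for x a
    using i1(3)[OF that] that T by simp
  have p1x: "act HA A evA (Farr F p1 x) a = Farr F p (act HE A evE x a)" if "x \<in> Fob F HE" "a \<in> Fob F A" for x a
    using p1(3)[OF that] that T by simp
  have p1i1: "Farr F p1 (Farr F i1 x) = 0" if "x \<in> Fob F H" for x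
    by (rule ihom_act_inj[OF ihA A A]) (use that T in \<open>auto simp: p1x i1x p_i\<close>)
  have sq: "p1 \<cdot> r = j \<cdot> q" using pb by (simp add: is_pullback_def)
  have sqx: "Farr F p1 (Farr F r x) = Farr F j (Farr F q x)" if "x \<in> Fob F X" for x
    using Farr_comp[of r p1 x] Farr_comp[of q j x] that R sq by simp
  have z: "p1 \<cdot> i1 = j \<cdot> Zero C H (Unit C)" by (rule Mor_eqI) (use T p1i1 in auto)
  have z': "Zero C H (Unit C) \<in> Mor C H (Unit C)" using T(1) Unit_in_Ob by (rule Zero_in_Mor)
  have "\<exists>k. k \<in> Mor C H (Dom C q) \<and> r \<cdot> k = i1 \<and> q \<cdot> k = Zero C H (Unit C)"
    using pb z z' i1(1) R unfolding is_pullback_def by metis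
  then obtain k where k: "k \<in> Mor C H X" "r \<cdot> k = i1" "q \<cdot> k = Zero C H (Unit C)" using R by auto
  have kA: "k \<in> Arr C" "Dom C k = H" "Cod C k = X" using k by (auto simp: Mor_def)
  have rk: "Farr F r (Farr F k x) = Farr F i1 x" if "x \<in> Fob F H" for x
    using Farr_comp[of k r x] that R kA unfolding k(2) by simp
  have qk: "Farr F q (Farr F k x) = 0" if "x \<in> Fob F H" for x
    using Farr_comp[of k q x] that T kA unfolding k(3) by simp
  have se: "short_exact C k q"
  proof (rule short_exactI_fibre[OF k(1) rq(2)])
    fix x assume x: "x \<in> Fob F H" "Farr F k x = 0"
    then have i10: "Farr F i1 x = 0" using rk[OF x(1)] R by simp
    show "x = 0"
    proof (rule ihom_act_inj[OF ih A B x(1)])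
      fix a assume a: "a \<in> Fob F A"
      have "Farr F i (act H A ev x a) = Farr F i 0" using i1x[OF x(1) a] i10 a T by simp
      then show "act H A ev x a = 0" by (rule i_inj[rotated 2]) (use x a T in auto)
    qed
  next
    fix x assume "x \<in> Fob F H" then show "Farr F q (Farr F k x) = 0" by (rule qk)
  next
    fix y assume y: "y \<in> Fob F X" "Farr F q y = 0"
    have ry: "Farr F r y \<in> Fob F HE" using y T by simp
    have p0: "Farr F p (act HE A evE (Farr F r y) a) = 0" if a: "a \<in> Fob F A" for a
      using p1x[OF ry a] sqx[OF y(1)] y a T by simp
    have "\<forall>a. \<exists>w. a \<in> Fob F A \<longrightarrow> w \<in> Fob F B \<and> Farr F i w = act HE A evE (Farr F r y) a"
    proof (intro allI)
      fix a
      show "\<exists>w. a \<in> Fob F A \<longrightarrow> w \<in> Fob F B \<and> Farr F i w = act HE A evE (Farr F r y) a"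
      proof (cases "a \<in> Fob F A")
        case True
        then have "act HE A evE (Farr F r y) a \<in> Farr F i ` Fob F B"
          using p0 ry T by (intro p_ker) auto
        then show ?thesis by auto
      qed simp
    qed
    then obtain f where f: "\<And>a. a \<in> Fob F A \<Longrightarrow> f a \<in> Fob F B \<and> Farr F i (f a) = act HE A evE (Farr F r y) a"
      by metis
    have "linear_between (VScale F) (Fob F A) (Fob F B) f"
      unfolding linear_between_def
    proof (intro conjI ballI allI)
      fix a a' assume a: "a \<in> Fob F A" "a' \<in> Fob F A"
      have "Farr F i (f (a + a')) = Farr F i (f a + f a')" using f a f[of "a + a'"] ry T by simp
      then show "f (a + a') = f a + f a'" by (rule i_inj[rotated 2]) (use f a T in auto)
    next
      fix c a assume a: "a \<in> Fob F A"
      have "Farr F i (f (VScale F c a)) = Farr F i (VScale F c (f a))" using f a f[of "VScale F c a"] ry T by simp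
      then show "f (VScale F c a) = VScale F c (f a)" by (rule i_inj[rotated 2]) (use f a T in auto)
    qed (use f in auto)
    then obtain x where x: "x \<in> Fob F H" "\<And>a. a \<in> Fob F A \<Longrightarrow> act H A ev x a = f a"
      using ihom_act_surj[OF ih A B] by blast
    have ri: "Farr F i1 x = Farr F r y"
      by (rule ihom_act_eqI[OF ihE A E]) (use x ry i1x f T in auto)
    have "Farr F k x - y = 0"
      by (rule sep) (use x y T kA rk ri qk in auto)
    then show "\<exists>x \<in> Fob F H. Farr F k x = y" using x by auto
  next
    fix u assume u: "u \<in> Fob F (Unit C)"
    obtain c where c: "u = VScale F c unit_vec" using Unit_fibre_cases[OF u] by blast
    \<comment> \<open>A linear section of \<open>p\<close> on fibres is a vector of \<open>Hom(A, E)\<close> over the identity of \<open>A\<close>.\<close>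
    obtain p' where p': "Vector_Spaces.linear (VScale F) (VScale F) p'" "\<And>x. x \<in> Fob F E \<Longrightarrow> p' x = Farr F p x"
      using linear_extension[OF Farr_linear[OF p] E] by blast
    obtain g where g: "range g \<subseteq> Fob F E" "Vector_Spaces.linear (VScale F) (VScale F) g"
      "\<forall>v \<in> p' ` Fob F E. p' (g v) = v"
      using VV.linear_exists_right_inverse_on[OF p'(1) Fob_subspace[OF E]] by blast
    have gE: "g a \<in> Fob F E" for a using g(1) by auto
    have pg: "Farr F p (g a) = a" if a: "a \<in> Fob F A" for a
    proof -
      have "a \<in> Farr F p ` Fob F E" using Farr_exact[OF exact] a ip by simp
      then have "a \<in> p' ` Fob F E" using p'(2) by force
      then show ?thesis using g(3) p'(2)[OF gE] by metis
    qed
    have "linear_between (VScale F) (Fob F A) (Fob F E) g"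
      using gE VV.linear_add[OF g(2)] VV.linear_scale[OF g(2)] by (auto simp: linear_between_def)
    then obtain h where h: "h \<in> Fob F HE" "\<And>a. a \<in> Fob F A \<Longrightarrow> act HE A evE h a = g a"
      using ihom_act_surj[OF ihE A E] by blast
    have "Farr F p1 (VScale F c h) = Farr F j u"
    proof (rule ihom_act_eqI[OF ihA A A])
      fix a assume a: "a \<in> Fob F A"
      have "act HA A evA (Farr F p1 h) a = a" using p1x[OF h(1) a] h(2)[OF a] pg[OF a] by simp
      moreover have "act HA A evA (Farr F j unit_vec) a = a" using j(3)[OF unit_vec(3) a] a T by simp
      ultimately show "act HA A evA (Farr F p1 (VScale F c h)) a = act HA A evA (Farr F j u) a"
        using h(1) a T by (simp add: c)
    qed (use h u T in auto)
    then show "\<exists>y \<in> Fob F X. Farr F q y = u" using pt[of "VScale F c h" u] h u T by auto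
  qed
  define \<rho> where "\<rho> = evE \<cdot> (r \<otimes>\<^sub>m Ide C A)"
  have \<rho>M: "\<rho> \<in> Mor C (X \<otimes>\<^sub>o A) E" using T by (simp add: \<rho>_def Mor_def)
  have \<rho>A: "\<rho> \<in> Arr C" "Dom C \<rho> = X \<otimes>\<^sub>o A" "Cod C \<rho> = E" using \<rho>M by (auto simp: Mor_def)
  have \<rho>x: "Farr F \<rho> (Fmult F X A x a) = act HE A evE (Farr F r x) a" if "x \<in> Fob F X" "a \<in> Fob F A" for x a
    using that T by (simp add: \<rho>_def)
  have \<rho>k: "\<rho> \<cdot> (k \<otimes>\<^sub>m Ide C A) = i \<cdot> ev"
    by (rule Mor_tensor_eqI[OF _ iev T(1) A]) (use T kA \<rho>A in \<open>auto simp: Mor_def \<rho>x rk i1x\<close>)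
  have p\<rho>: "p \<cdot> \<rho> = LUnit C A \<cdot> (q \<otimes>\<^sub>m Ide C A)"
  proof (rule Mor_tensor_eqI[OF _ _ X A])
    show "p \<cdot> \<rho> \<in> Mor C (X \<otimes>\<^sub>o A) A" "LUnit C A \<cdot> (q \<otimes>\<^sub>m Ide C A) \<in> Mor C (X \<otimes>\<^sub>o A) A"
      using T \<rho>A by (auto simp: Mor_def)
    fix x a assume xa: "x \<in> Fob F X" "a \<in> Fob F A"
    have "Farr F p (act HE A evE (Farr F r x) a) = act HA A evA (Farr F j (Farr F q x)) a"
      using p1x[of "Farr F r x" a] sqx[OF xa(1)] xa T by simp
    also have "\<dots> = Farr F (LUnit C A) (Fmult F (Unit C) A (Farr F q x) a)"
      by (rule j(3)) (use xa T in auto)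
    finally show "Farr F (p \<cdot> \<rho>) (Fmult F X A x a) = Farr F (LUnit C A \<cdot> (q \<otimes>\<^sub>m Ide C A)) (Fmult F X A x a)"
      using xa T \<rho>A by (simp add: \<rho>x)
  qed
  have ext: "(i, p) \<in> extensions C A B" using exact ip by (simp add: extensions_def)
  have "Ide C E \<cdot> i = i" "p \<cdot> Ide C E = p" using Comp_Ide_left[OF i] Comp_Ide_right[OF p] by auto
  then have cls: "(i, p) \<in> ext_class C A B i p"
    unfolding ext_class_def ext_rel_def using ext ip iso_Ide[OF E] Ide_in_Mor[OF E] by auto
  have "(k, q) \<in> extensions C (Unit C) H" using se kA R by (simp add: extensions_def)
  moreover have "\<exists>HE evE HA evA i1 p1 j r.
        is_ihom C A (Cod C i) HE evE \<and> is_ihom C A A HA evA \<and>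
        is_ihom_map C A H ev HE evE i i1 \<and> is_ihom_map C A HE evE HA evA p p1 \<and>
        j \<in> Mor C (Unit C) HA \<and> evA \<cdot> (j \<otimes>\<^sub>m Ide C A) = LUnit C A \<and>
        is_pullback C p1 j r q \<and> r \<cdot> k = i1"
    unfolding is_ihom_map_def using ihE ihA i1(1,2) p1(1,2) j(1,2) pb k(2) ip by blast
  ultimately have "(k, q) \<in> ext_to_unit C A B H ev (ext_class C A B i p)"
    unfolding ext_to_unit_def using cls by blast
  then show thesis by (rule that[OF _ k(1) rq(2) se \<rho>M \<rho>k p\<rho>])
qed

text \<open>If \<open>\<sigma>\<close> extends to \<open>X\<close>, then the pushforward along \<open>\<sigma>\<close>, the quotient by \<open>ker \<sigma>\<close>, splits; so
  \<open>ker \<sigma>\<close> is not proper.\<close>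
lemma totally_nonsplit_extends:
  assumes nonsplit: "totally_nonsplit C H \<xi>" and kq: "(k, q) \<in> \<xi>" and ex: "short_exact C k q"
    and k: "k \<in> Mor C H X" and q: "q \<in> Mor C X U"
    and \<sigma>: "\<sigma> \<in> Mor C H I" "is_epi C \<sigma>" and r: "r \<in> Mor C X I" "r \<cdot> k = \<sigma>"
  shows "zero_obj C I"
proof -
  obtain c where c: "short_exact C c \<sigma>" using epi_short_exact[OF \<sigma>(2)] .
  have A: "\<sigma> \<in> Arr C" "Dom C \<sigma> = H" "Cod C \<sigma> = I" "I \<in> Ob C" using \<sigma> Mor_Ob[OF \<sigma>(1)] by (auto simp: Mor_def)
  have cA: "is_mono C c" "Cod C c = H" "c \<in> Arr C" using short_exactD[OF c] A by auto
  have "is_iso C c"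
  proof (rule ccontr)
    assume "\<not> is_iso C c"
    moreover have "is_cokernel C \<sigma> c" using c by (simp add: short_exact_def)
    ultimately have "\<not> (\<exists>(i', p') \<in> ext_pushforward C \<sigma> \<xi>. split_extension C i' p')"
      using nonsplit cA unfolding totally_nonsplit_def by blast
    then show False using pushforward_split[OF ex k q \<sigma>(1) r kq] by blast
  qed
  then have "Farr F \<sigma> x = 0" if x: "x \<in> Fob F H" for x
    using iso_surj[of c x] cA x Farr_exact[OF c] by auto
  then have "y = 0" if "y \<in> Fob F I" for y using epi_surj[OF \<sigma>(2), of y] A that by metis
  then show ?thesis using zero_obj_iff[OF A(4)] A(4) by auto
qed

end

section \<open>Semisimple objects\<close>

context neutral_tannakian
begin

definition monos_split :: "'o \<Rightarrow> bool" where
  "monos_split X \<longleftrightarrow> (\<forall>m. is_mono C m \<and> Cod C m = X \<longrightarrow>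
     (\<exists>r \<in> Mor C X (Dom C m). \<forall>x \<in> Fob F (Dom C m). Farr F r (Farr F m x) = x))"

lemma monos_split_sub:
  assumes X: "monos_split X" and j: "j \<in> Mor C Y X" "is_mono C j"
  shows "monos_split Y"
  unfolding monos_split_def
proof (intro allI impI)
  fix m assume m: "is_mono C m \<and> Cod C m = Y"
  have A: "m \<in> Arr C" "Cod C m = Y" "j \<in> Arr C" "Dom C j = Y" "Cod C j = X"
    using m j by (auto simp: is_mono_def Mor_def)
  have "is_mono C (j \<cdot> m)"
    by (rule inj0_mono) (use A m mono_inj0[OF j(2)] mono_inj0[of m] in auto)
  then obtain r where r: "r \<in> Mor C X (Dom C m)" "\<forall>x \<in> Fob F (Dom C m). Farr F r (Farr F (j \<cdot> m) x) = x"
    using X A unfolding monos_split_def by (metis Comp_typing(2,3))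
  have rA: "r \<in> Arr C" "Dom C r = X" "Cod C r = Dom C m" using r by (auto simp: Mor_def)
  have "r \<cdot> j \<in> Mor C Y (Dom C m)" using rA A by (simp add: Mor_def)
  moreover have "\<forall>x \<in> Fob F (Dom C m). Farr F (r \<cdot> j) (Farr F m x) = x" using r(2) rA A by simp
  ultimately show "\<exists>r \<in> Mor C Y (Dom C m). \<forall>x \<in> Fob F (Dom C m). Farr F r (Farr F m x) = x" by blast
qed

lemma monos_split_section:
  assumes X: "monos_split X" and e: "e \<in> Mor C X Y" "is_epi C e"
  obtains s where "s \<in> Mor C Y X" "\<And>y. y \<in> Fob F Y \<Longrightarrow> Farr F e (Farr F s y) = y"
proof -
  obtain k where k: "short_exact C k e" using epi_short_exact[OF e(2)] .
  have A: "e \<in> Arr C" "Dom C e = X" "Cod C e = Y" "k \<in> Arr C" "Cod C k = X" "X \<in> Ob C"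
    using e short_exactD[OF k] Mor_Ob[OF e(1)] by (auto simp: Mor_def)
  have ek: "Farr F e (Farr F k x) = 0" if "x \<in> Fob F (Dom C k)" for x using Farr_exact[OF k] that by auto
  obtain r where r: "r \<in> Mor C X (Dom C k)" "\<And>x. x \<in> Fob F (Dom C k) \<Longrightarrow> Farr F r (Farr F k x) = x"
    using X short_exactD(1)[OF k] A unfolding monos_split_def by blast
  have rA: "r \<in> Arr C" "Dom C r = X" "Cod C r = Dom C k" using r by (auto simp: Mor_def)
  define d where "d = Ide C X \<boxplus> (- 1) \<star> (k \<cdot> r)"
  have dM: "d \<in> Mor C (Dom C e) X" using A rA by (simp add: d_def Mor_def)
  have dx: "Farr F d x = x - Farr F k (Farr F r x)" if "x \<in> Fob F X" for x using A rA that by (simp add: d_def)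
  have d0: "Farr F d x = 0" if "x \<in> Fob F (Dom C e)" "Farr F e x = 0" for x
  proof -
    have "x \<in> Farr F k ` Fob F (Dom C k)" using Farr_exact[OF k] that A by auto
    then show ?thesis using dx r(2) A by auto
  qed
  obtain s where s: "s \<in> Mor C (Cod C e) X" "s \<cdot> e = d" using factor_through_epi[OF e(2) dM d0] by blast
  have sA: "s \<in> Arr C" "Dom C s = Y" "Cod C s = X" using s A by (auto simp: Mor_def)
  have "Farr F e (Farr F s y) = y" if y: "y \<in> Fob F Y" for y
  proof -
    obtain x where x: "x \<in> Fob F X" "Farr F e x = y" using epi_surj[OF e(2), of y] y A by auto
    have "Farr F s y = x - Farr F k (Farr F r x)"
      using Farr_comp[of e s x] x A sA dx[OF x(1)] unfolding s(2) by simp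
    then show ?thesis using x A rA by (simp add: ek)
  qed
  then show thesis using that s A by simp
qed

lemma monos_split_quotient:
  assumes X: "monos_split X" and e: "e \<in> Mor C X Y" "is_epi C e"
  shows "monos_split Y"
proof -
  obtain s where s: "s \<in> Mor C Y X" "\<And>y. y \<in> Fob F Y \<Longrightarrow> Farr F e (Farr F s y) = y"
    using monos_split_section[OF assms] by blast
  have "e \<in> Arr C" using e by (simp add: Mor_def)
  have "is_mono C s"
  proof (rule inj0_mono)
    fix y assume "y \<in> Fob F (Dom C s)" "Farr F s y = 0"
    moreover from this have "y \<in> Fob F Y" using s(1) by (simp add: Mor_def)
    ultimately show "y = 0" using s(2)[of y] Farr_zero[OF \<open>e \<in> Arr C\<close>] by simp
  qed (use s in \<open>simp add: Mor_def\<close>)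
  then show ?thesis by (rule monos_split_sub[OF X s(1)])
qed

text \<open>The simple summands are added to the given subobject one at a time: each summand either lies
  in the subobject \<open>w\<close> reached so far or meets it trivially, in which case the direct sum is again
  a subobject.  The retraction extends by zero.\<close>
lemma semisimple_monos_split:
  assumes "semisimple_obj C X"
  shows "monos_split X"
  unfolding monos_split_def
proof (intro allI impI)
  fix m assume "is_mono C m \<and> Cod C m = X"
  then have m: "is_mono C m" "Cod C m = X" "m \<in> Arr C" by (auto simp: is_mono_def)
  define Y where "Y = Dom C m"
  obtain n :: nat and S u where S: "\<And>l. l < n \<Longrightarrow> simple_obj C (S l)" and cp: "is_coproduct C {..<n} S u X"
    using assms unfolding semisimple_obj_def by blast
  have X: "X \<in> Ob C" and u: "\<And>l. l < n \<Longrightarrow> u l \<in> Mor C (S l) X" using cp by (auto simp: is_coproduct_def)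
  have Y: "Y \<in> Ob C" using m Dom_in_Ob by (simp add: Y_def)
  have "\<exists>P w y r. w \<in> Mor C P X \<and> is_mono C w \<and> y \<in> Mor C Y P \<and> w \<cdot> y = m \<and> r \<in> Mor C P Y \<and>
      (\<forall>x \<in> Fob F Y. Farr F r (Farr F y x) = x) \<and> (\<forall>l<j. \<exists>t \<in> Mor C (S l) P. w \<cdot> t = u l)"
    if "j \<le> n" for j
    using that
  proof (induction j)
    case 0
    have "m \<cdot> Ide C Y = m" by (rule Mor_eqI) (use m Y in \<open>auto simp: Y_def\<close>)
    then show ?case
      using m Y Ide_in_Mor[OF Y] by (intro exI[of _ Y] exI[of _ m] exI[of _ "Ide C Y"]) (auto simp: Y_def Mor_def)
  next
    case (Suc j)
    then obtain P w y r where w: "w \<in> Mor C P X" "is_mono C w" and y: "y \<in> Mor C Y P" "w \<cdot> y = m"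
      and r: "r \<in> Mor C P Y" "\<And>x. x \<in> Fob F Y \<Longrightarrow> Farr F r (Farr F y x) = x"
      and t: "\<And>l. l < j \<Longrightarrow> \<exists>t \<in> Mor C (S l) P. w \<cdot> t = u l" by force
    have uj: "u j \<in> Mor C (S j) X" and Sj: "simple_obj C (S j)" using u S Suc by auto
    have A: "w \<in> Arr C" "Dom C w = P" "Cod C w = X" "y \<in> Arr C" "Dom C y = Y" "Cod C y = P"
      "r \<in> Arr C" "Dom C r = P" "Cod C r = Y" "u j \<in> Arr C" "Dom C (u j) = S j" "Cod C (u j) = X"
      "P \<in> Ob C" "S j \<in> Ob C"
      using w y r uj Mor_Ob[OF w(1)] Mor_Ob[OF uj] by (auto simp: Mor_def)
    obtain c where c: "short_exact C w c" using mono_short_exact[OF w(2)] .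
    have cA: "c \<in> Arr C" "Dom C c = X" using short_exactD[OF c] A by auto
    have cw: "Farr F c (Farr F w x) = 0" if "x \<in> Fob F P" for x using Farr_exact[OF c] that A by auto
    obtain k where k: "is_kernel C k (c \<cdot> u j)" using ex_kernel[of "c \<cdot> u j"] cA A by auto
    have kx: "Farr F k ` Fob F (Dom C k) = {x \<in> Fob F (S j). Farr F c (Farr F (u j) x) = 0}"
      using kernel_fibre[OF k] cA A by auto
    have kA: "k \<in> Arr C" "Cod C k = S j" using kernel_typing[OF k] cA A by auto
    have "zero_obj C (Dom C k) \<or> is_iso C k"
      using Sj is_kernel_is_mono[OF k] kA unfolding simple_obj_def by blast
    then show ?case
    proof
      assume k_iso: "is_iso C k"
      have c0: "Farr F c (Farr F (u j) x) = 0" if x: "x \<in> Fob F (S j)" for x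
      proof -
        have "x \<in> Fob F (Cod C k)" using x kA by simp
        then obtain y where "y \<in> Fob F (Dom C k)" "Farr F k y = x" by (rule iso_surj[OF k_iso])
        then have "x \<in> Farr F k ` Fob F (Dom C k)" by blast
        then show ?thesis unfolding kx by simp
      qed
      obtain t' where t': "t' \<in> Mor C (S j) P" "w \<cdot> t' = u j"
      proof (rule factor_through_mono[OF w(2), of "u j" "S j"])
        show "u j \<in> Mor C (S j) (Cod C w)" using uj A by simp
        show "Farr F (u j) x \<in> Farr F w ` Fob F (Dom C w)" if "x \<in> Fob F (S j)" for x
          using Farr_exact[OF c] c0[OF that] that A by auto
      qed (use A that in auto)
      then have "\<forall>l<Suc j. \<exists>t \<in> Mor C (S l) P. w \<cdot> t = u l" using t less_Suc_eq by metis
      then show ?case using w y r by blast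
    next
      assume "zero_obj C (Dom C k)"
      then have "Fob F (Dom C k) = {0}" using zero_obj_iff[OF Dom_in_Ob[OF kA(1)]] by simp
      then have "{x \<in> Fob F (S j). Farr F c (Farr F (u j) x) = 0} = {0}" using kx kA by auto
      then have cu: "x = 0" if "x \<in> Fob F (S j)" "Farr F c (Farr F (u j) x) = 0" for x using that by blast
      obtain Q i1 i2 p1 p2 where b: "is_biproduct C P (S j) Q i1 i2 p1 p2"
        using ex_biproduct A by blast
      note bi = biproduct_fibre[OF b]
      note T = A cA X Y bi(1-15)
      define w' where "w' = (w \<cdot> p1) \<boxplus> (u j \<cdot> p2)"
      have w'A: "w' \<in> Arr C" "Dom C w' = Q" "Cod C w' = X" using T by (auto simp: w'_def)
      have w'x: "Farr F w' z = Farr F w (Farr F p1 z) + Farr F (u j) (Farr F p2 z)" if "z \<in> Fob F Q" for z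
        using T that by (simp add: w'_def)
      have "is_mono C w'"
      proof (rule inj0_mono[OF w'A(1)])
        fix z assume "z \<in> Fob F (Dom C w')" "Farr F w' z = 0"
        then have z: "z \<in> Fob F Q" "Farr F w (Farr F p1 z) + Farr F (u j) (Farr F p2 z) = 0"
          using w'A w'x by auto
        have "Farr F c (Farr F w (Farr F p1 z) + Farr F (u j) (Farr F p2 z)) = 0" using z(2) T by simp
        then have "Farr F c (Farr F (u j) (Farr F p2 z)) = 0" using z(1) T by (simp add: cw)
        then have p2: "Farr F p2 z = 0" using cu z(1) T by simp
        then have "Farr F w (Farr F p1 z) = 0" using z(2) T by simp
        then have "Farr F p1 z = 0" using mono_inj0[OF w(2), of "Farr F p1 z"] z(1) T by simp
        then show "z = 0" using bi(20)[OF z(1)] p2 T by simp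
      qed
      moreover have "w' \<in> Mor C Q X" using w'A by (simp add: Mor_def)
      moreover have "i1 \<cdot> y \<in> Mor C Y Q" "r \<cdot> p1 \<in> Mor C Q Y" using T by (auto simp: Mor_def)
      moreover have wi: "w' \<cdot> i1 = w" by (rule Mor_eqI) (use T w'A bi(16-20) in \<open>auto simp: w'x\<close>)
      have wi2: "w' \<cdot> i2 = u j" by (rule Mor_eqI) (use T w'A bi(16-20) in \<open>auto simp: w'x\<close>)
      have w'i: "w' \<cdot> (i1 \<cdot> f) = w \<cdot> f" if "f \<in> Mor C V P" for f V
        unfolding wi[symmetric] by (rule Comp_assoc[symmetric, OF that]) (use T w'A in \<open>auto simp: Mor_def\<close>)
      have "w' \<cdot> (i1 \<cdot> y) = m" using w'i[OF y(1)] y(2) by simp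
      moreover have "\<forall>x \<in> Fob F Y. Farr F (r \<cdot> p1) (Farr F (i1 \<cdot> y) x) = x"
        using T bi(16-20) r(2) by simp
      moreover have "\<exists>t \<in> Mor C (S l) Q. w' \<cdot> t = u l" if "l < Suc j" for l
      proof (cases "l < j")
        case True
        then obtain t' where t': "t' \<in> Mor C (S l) P" "w \<cdot> t' = u l" using t by blast
        have "i1 \<cdot> t' \<in> Mor C (S l) Q" using t' T by (auto simp: Mor_def)
        then show ?thesis using w'i[OF t'(1)] t'(2) by auto
      next
        case False
        then have "l = j" using that by simp
        then show ?thesis using wi2 T by (auto simp: Mor_def)
      qed
      ultimately show ?case by blast
    qed
  qed
  from this[OF order_refl] obtain P w y r where w: "w \<in> Mor C P X" "is_mono C w" and y: "y \<in> Mor C Y P" "w \<cdot> y = m"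
      and r: "r \<in> Mor C P Y" "\<And>x. x \<in> Fob F Y \<Longrightarrow> Farr F r (Farr F y x) = x"
      and t: "\<forall>l<n. \<exists>t. t \<in> Mor C (S l) P \<and> w \<cdot> t = u l" by force
  have A: "w \<in> Arr C" "Dom C w = P" "Cod C w = X" "y \<in> Arr C" "Dom C y = Y" "Cod C y = P"
    "r \<in> Arr C" "Dom C r = P" "Cod C r = Y" "P \<in> Ob C"
    using w y r Mor_Ob[OF w(1)] by (auto simp: Mor_def)
  obtain h where h: "\<And>l. l < n \<Longrightarrow> h l \<in> Mor C (S l) P \<and> w \<cdot> h l = u l" using t by metis
  obtain v where v: "v \<in> Mor C X P" "\<And>l. l < n \<Longrightarrow> v \<cdot> u l = h l"
    using cp h A(10) unfolding is_coproduct_def by (metis lessThan_iff)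
  have vA: "v \<in> Arr C" "Dom C v = X" "Cod C v = P" using v by (auto simp: Mor_def)
  have "\<exists>!s. s \<in> Mor C X X \<and> (\<forall>l\<in>{..<n}. s \<cdot> u l = u l)"
    using cp X u unfolding is_coproduct_def by (metis lessThan_iff)
  moreover have "Ide C X \<cdot> u l = u l" if "l < n" for l using Comp_Ide_left[OF u[OF that]] .
  moreover have "(w \<cdot> v) \<cdot> u l = u l" if "l < n" for l
    using Comp_assoc[OF u[OF that] v(1) w(1)] v(2)[OF that] h[OF that] by simp
  moreover have "w \<cdot> v \<in> Mor C X X" using vA A by (simp add: Mor_def)
  ultimately have "w \<cdot> v = Ide C X" using Ide_in_Mor[OF X] by (metis lessThan_iff)
  then have wv: "Farr F w (Farr F v z) = z" if "z \<in> Fob F X" for z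
    using Farr_comp[of v w z] vA A that X by simp
  have "Farr F (r \<cdot> v) (Farr F m x) = x" if x: "x \<in> Fob F Y" for x
  proof -
    have mx: "Farr F m x = Farr F w (Farr F y x)" unfolding y(2)[symmetric] using x A by simp
    have eq: "Farr F w (Farr F v (Farr F m x)) = Farr F w (Farr F y x)"
      using wv[of "Farr F m x"] x m A by (simp add: mx)
    have "Farr F v (Farr F m x) = Farr F y x"
      by (rule mono_inj[OF w(2) _ _ eq]) (use x m vA A in \<open>auto simp: Y_def\<close>)
    then show ?thesis using r(2)[OF x] x m vA A by (simp add: Y_def)
  qed
  moreover have "r \<cdot> v \<in> Mor C X Y" using vA A by (simp add: Mor_def)
  ultimately show "\<exists>r \<in> Mor C X (Dom C m). \<forall>x \<in> Fob F (Dom C m). Farr F r (Farr F m x) = x"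
    unfolding Y_def by blast
qed

lemma coproduct_projection:
  assumes cp: "is_coproduct C I Q u G" and j: "j \<in> I"
  obtains \<pi> where "\<pi> \<in> Mor C G (Q j)" "\<And>x. x \<in> Fob F (Q j) \<Longrightarrow> Farr F \<pi> (Farr F (u j) x) = x"
proof -
  have u: "u l \<in> Mor C (Q l) G" if "l \<in> I" for l using cp that by (auto simp: is_coproduct_def)
  have O: "Q l \<in> Ob C" if "l \<in> I" for l using Mor_Ob[OF u[OF that]] by simp
  define h where "h l = (if l = j then Ide C (Q j) else Zero C (Q l) (Q j))" for l
  have "h l \<in> Mor C (Q l) (Q j)" if "l \<in> I" for l
    using Ide_in_Mor[OF O[OF j]] Zero_in_Mor[OF O[OF that] O[OF j]] by (auto simp: h_def)
  then obtain \<pi> where \<pi>: "\<pi> \<in> Mor C G (Q j)" "\<forall>l\<in>I. \<pi> \<cdot> u l = h l"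
    using cp O[OF j] unfolding is_coproduct_def by metis
  have "Farr F \<pi> (Farr F (u j) x) = x" if "x \<in> Fob F (Q j)" for x
    using Farr_comp[of "u j" \<pi> x] u[OF j] \<pi> j that O[OF j] by (auto simp: Mor_def h_def)
  then show thesis using that \<pi>(1) by blast
qed

end

section \<open>Weight filtrations on fibres\<close>

locale filtered_tannakian = neutral_tannakian C F + weight_filtration C W
  for C :: "('o, 'm, 'k::field, 'z) tensor_category_scheme" (structure)
    and F :: "('o, 'm, 'k, 'v::ab_group_add) fibre_functor"
    and W :: "int \<Rightarrow> 'o \<Rightarrow> 'm"
begin

definition W_fibre :: "int \<Rightarrow> 'o \<Rightarrow> 'v set" where
  "W_fibre n X = Farr F (W n X) ` Fob F (Dom C (W n X))"

lemma W_typing: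
  assumes "X \<in> Ob C"
  shows "W n X \<in> Arr C" "Cod C (W n X) = X" "Dom C (W n X) \<in> Ob C"
  using W_mono[OF assms, of n] W_Cod[OF assms] by (auto simp: is_mono_def Dom_in_Ob)

lemma W_fibre_in: "X \<in> Ob C \<Longrightarrow> x \<in> W_fibre n X \<Longrightarrow> x \<in> Fob F X"
  using W_typing[of X n] by (auto simp: W_fibre_def)

lemma W_fibreE:
  assumes "x \<in> W_fibre n X"
  obtains y where "y \<in> Fob F (Dom C (W n X))" "Farr F (W n X) y = x"
  using assms by (auto simp: W_fibre_def)

lemma W_arrow:
  assumes f: "f \<in> Mor C X Y"
  obtains g where "g \<in> Mor C (Dom C (W n X)) (Dom C (W n Y))" "W n Y \<cdot> g = f \<cdot> W n X"
    "\<And>x. x \<in> Fob F (Dom C (W n X)) \<Longrightarrow> Farr F (W n Y) (Farr F g x) = Farr F f (Farr F (W n X) x)"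
proof -
  obtain g where g: "g \<in> Mor C (Dom C (W n X)) (Dom C (W n Y))" "W n Y \<cdot> g = f \<cdot> W n X"
    using W_functorial[OF f] by blast
  have "Farr F (W n Y) (Farr F g x) = Farr F f (Farr F (W n X) x)" if "x \<in> Fob F (Dom C (W n X))" for x
    using Farr_comp[of g "W n Y" x] Farr_comp[of "W n X" f x] that g f Mor_Ob[OF f] W_typing
    by (simp add: Mor_def)
  then show thesis using that g by blast
qed

lemma W_fibre_functorial:
  assumes f: "f \<in> Mor C X Y" and x: "x \<in> W_fibre n X"
  shows "Farr F f x \<in> W_fibre n Y"
proof -
  obtain g where g: "g \<in> Mor C (Dom C (W n X)) (Dom C (W n Y))"
    "\<And>x. x \<in> Fob F (Dom C (W n X)) \<Longrightarrow> Farr F (W n Y) (Farr F g x) = Farr F f (Farr F (W n X) x)"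
    using W_arrow[OF f] by metis
  obtain y where y: "y \<in> Fob F (Dom C (W n X))" "Farr F (W n X) y = x" using x by (rule W_fibreE)
  have "Farr F f x = Farr F (W n Y) (Farr F g y)" using g(2)[OF y(1)] y(2) by simp
  then show ?thesis unfolding W_fibre_def using end_in[OF g(1) y(1)] by blast
qed

text \<open>Strictness comes from the exactness of \<open>W\<^sub>n\<close>, applied to \<open>0 \<rightarrow> X \<rightarrow> Y \<rightarrow> Y / X \<rightarrow> 0\<close> here and to
  \<open>0 \<rightarrow> ker e \<rightarrow> Y \<rightarrow> Z \<rightarrow> 0\<close> in the dual statement.\<close>
lemma W_fibre_sub:
  assumes m: "m \<in> Mor C X Y" "is_mono C m" and x: "x \<in> Fob F X" "Farr F m x \<in> W_fibre n Y"
  shows "x \<in> W_fibre n X"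
proof -
  obtain q where q: "short_exact C m q" using mono_short_exact[OF m(2)] .
  define Z where "Z = Cod C q"
  have A: "m \<in> Arr C" "Dom C m = X" "Cod C m = Y" "q \<in> Arr C" "Dom C q = Y" "Cod C q = Z"
    "X \<in> Ob C" "Y \<in> Ob C" "Z \<in> Ob C"
    using m short_exactD[OF q] Mor_Ob[OF m(1)] by (auto simp: Mor_def Z_def Cod_in_Ob)
  have qM: "q \<in> Mor C Y Z" using A by (simp add: Mor_def)
  obtain m' where m': "m' \<in> Mor C (Dom C (W n X)) (Dom C (W n Y))" "W n Y \<cdot> m' = m \<cdot> W n X"
    "\<And>x. x \<in> Fob F (Dom C (W n X)) \<Longrightarrow> Farr F (W n Y) (Farr F m' x) = Farr F m (Farr F (W n X) x)"
    using W_arrow[OF m(1), of n] by blast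
  obtain q' where q': "q' \<in> Mor C (Dom C (W n Y)) (Dom C (W n Z))" "W n Z \<cdot> q' = q \<cdot> W n Y"
    "\<And>x. x \<in> Fob F (Dom C (W n Y)) \<Longrightarrow> Farr F (W n Z) (Farr F q' x) = Farr F q (Farr F (W n Y) x)"
    using W_arrow[OF qM, of n] by blast
  have ex: "short_exact C m' q'" by (rule W_exact[OF q m(1) qM m'(1,2) q'(1,2)])
  obtain y where y: "y \<in> Fob F (Dom C (W n Y))" "Farr F (W n Y) y = Farr F m x" using x(2) by (rule W_fibreE)
  have "Farr F q (Farr F m x) = 0" using Farr_exact[OF q] x A by auto
  then have "Farr F (W n Z) (Farr F q' y) = 0" using q'(3)[OF y(1)] y by simp
  then have "Farr F q' y = 0" using mono_inj0[OF W_mono[OF A(9)]] end_in[OF q'(1) y(1)] by blast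
  then have "y \<in> Farr F m' ` Fob F (Dom C (W n X))" using Farr_exact[OF ex] y m' by (auto simp: Mor_def)
  then obtain z where z: "z \<in> Fob F (Dom C (W n X))" "y = Farr F m' z" by auto
  have "Farr F m x = Farr F m (Farr F (W n X) z)" using m'(3)[OF z(1)] z y by simp
  then have "x = Farr F (W n X) z" using mono_inj[OF m(2)] x z A W_typing by simp
  then show ?thesis using z by (auto simp: W_fibre_def)
qed

lemma W_fibre_quotient:
  assumes e: "e \<in> Mor C Y Z" "is_epi C e" and z: "z \<in> W_fibre n Z"
  obtains y where "y \<in> W_fibre n Y" "Farr F e y = z"
proof -
  obtain k where k: "short_exact C k e" using epi_short_exact[OF e(2)] .
  define X where "X = Dom C k"
  have A: "e \<in> Arr C" "Dom C e = Y" "Cod C e = Z" "k \<in> Arr C" "Dom C k = X" "Cod C k = Y"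
    "X \<in> Ob C" "Y \<in> Ob C" "Z \<in> Ob C"
    using e short_exactD[OF k] Mor_Ob[OF e(1)] by (auto simp: Mor_def X_def Dom_in_Ob)
  have kM: "k \<in> Mor C X Y" using A by (simp add: Mor_def)
  obtain k' where k': "k' \<in> Mor C (Dom C (W n X)) (Dom C (W n Y))" "W n Y \<cdot> k' = k \<cdot> W n X"
    using W_arrow[OF kM, of n] by blast
  obtain e' where e': "e' \<in> Mor C (Dom C (W n Y)) (Dom C (W n Z))" "W n Z \<cdot> e' = e \<cdot> W n Y"
    "\<And>x. x \<in> Fob F (Dom C (W n Y)) \<Longrightarrow> Farr F (W n Z) (Farr F e' x) = Farr F e (Farr F (W n Y) x)"
    using W_arrow[OF e(1), of n] by blast
  have ex: "short_exact C k' e'" by (rule W_exact[OF k kM e(1) k' e'(1,2)])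
  obtain z' where z': "z' \<in> Fob F (Dom C (W n Z))" "Farr F (W n Z) z' = z" using z by (rule W_fibreE)
  have "z' \<in> Farr F e' ` Fob F (Dom C (W n Y))" using Farr_exact[OF ex] e' z' by (auto simp: Mor_def)
  then obtain y where y: "y \<in> Fob F (Dom C (W n Y))" "z' = Farr F e' y" by auto
  show thesis
    by (rule that[of "Farr F (W n Y) y"]) (use y e'(3)[OF y(1)] z' in \<open>auto simp: W_fibre_def\<close>)
qed

lemma W_fibre_zero: "X \<in> Ob C \<Longrightarrow> \<exists>a. \<forall>n\<le>a. W_fibre n X = {0}"
proof -
  assume X: "X \<in> Ob C"
  obtain a where a: "\<And>n. n \<le> a \<Longrightarrow> zero_obj C (Dom C (W n X))" using W_eventually_zero[OF X] by blast
  have "W_fibre n X = {0}" if "n \<le> a" for n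
    using a[OF that] zero_obj_iff[OF W_typing(3)[OF X]] W_typing(1)[OF X] by (auto simp: W_fibre_def)
  then show ?thesis by blast
qed

lemma W_fibre_all: "X \<in> Ob C \<Longrightarrow> \<exists>b. \<forall>n\<ge>b. W_fibre n X = Fob F X"
proof -
  assume X: "X \<in> Ob C"
  obtain b where b: "\<And>n. n \<ge> b \<Longrightarrow> is_iso C (W n X)" using W_eventually_all[OF X] by blast
  have "W_fibre n X = Fob F X" if n: "n \<ge> b" for n
  proof (intro equalityI subsetI)
    fix x assume "x \<in> Fob F X"
    then have "x \<in> Fob F (Cod C (W n X))" using W_typing(2)[OF X] by simp
    then obtain y where "y \<in> Fob F (Dom C (W n X))" "Farr F (W n X) y = x"
      by (rule iso_surj[OF b[OF n]])
    then show "x \<in> W_fibre n X" by (auto simp: W_fibre_def)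
  qed (rule W_fibre_in[OF X])
  then show ?thesis by blast
qed

text \<open>By strictness the image \<open>J\<close> of \<open>f\<close> has \<open>W\<^sub>n J = W\<^sub>n\<^sub>-\<^sub>1 J\<close> for all \<open>n\<close>, and a filtration that is both
  constant and finite is zero.\<close>
lemma weight_lowering_zero:
  assumes f: "f \<in> Mor C X Y" and shift: "\<And>n x. x \<in> W_fibre n X \<Longrightarrow> Farr F f x \<in> W_fibre (n - 1) Y"
  shows "f = Zero C X Y"
proof -
  obtain J e m where J: "e \<in> Mor C X J" "is_epi C e" "m \<in> Mor C J Y" "is_mono C m" "m \<cdot> e = f"
    by (rule image_factorization[OF f])
  have O: "X \<in> Ob C" "Y \<in> Ob C" "J \<in> Ob C" using Mor_Ob[OF J(1)] Mor_Ob[OF J(3)] by auto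
  have fx: "Farr F f x = Farr F m (Farr F e x)" if "x \<in> Fob F X" for x
    using Farr_comp[of e m x] that J by (simp add: Mor_def)
  have down: "W_fibre n J \<subseteq> W_fibre (n - 1) J" for n
  proof
    fix z assume z: "z \<in> W_fibre n J"
    obtain x where x: "x \<in> W_fibre n X" "Farr F e x = z" using W_fibre_quotient[OF J(1,2) z] .
    have "Farr F m z \<in> W_fibre (n - 1) Y" using shift[OF x(1)] fx[OF W_fibre_in[OF O(1) x(1)]] x(2) by simp
    then show "z \<in> W_fibre (n - 1) J" by (rule W_fibre_sub[OF J(3,4) W_fibre_in[OF O(3) z]])
  qed
  have downs: "W_fibre n J \<subseteq> W_fibre (n - int j) J" for n j
  proof (induction j)
    case (Suc j)
    then show ?case using down[of "n - int j"] by (auto simp: algebra_simps)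
  qed simp
  obtain a where a: "\<And>n. n \<le> a \<Longrightarrow> W_fibre n J = {0}" using W_fibre_zero[OF O(3)] by blast
  obtain b where b: "\<And>n. n \<ge> b \<Longrightarrow> W_fibre n J = Fob F J" using W_fibre_all[OF O(3)] by blast
  have "Fob F J \<subseteq> {0}" using downs[of b "nat (b - a)"] a[of "b - int (nat (b - a))"] b[of b] by simp
  then have z: "Farr F e x = 0" if "x \<in> Fob F X" for x using end_in[OF J(1) that] by auto
  show ?thesis
    by (rule Mor_eqI) (use f J(3) z fx O in \<open>auto simp: Mor_def\<close>)
qed

lemma W_step:
  assumes X: "X \<in> Ob C"
  obtains w q where "w \<in> Mor C (Dom C (W (n - 1) X)) (Dom C (W n X))" "W n X \<cdot> w = W (n - 1) X"
    "is_cokernel C q w" "is_gr_quotient C W n X q"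
proof -
  obtain w where w: "w \<in> Mor C (Dom C (W (n - 1) X)) (Dom C (W n X))" "W n X \<cdot> w = W (n - 1) X"
    using W_increasing[OF X, of "n - 1" n] by (auto simp: subobj_le_def)
  obtain q where "is_cokernel C q w" using ex_cokernel[of w] w by (auto simp: Mor_def)
  then show thesis using that w unfolding is_gr_quotient_def by blast
qed

lemma gr_quotient_fibre:
  assumes X: "X \<in> Ob C" and q: "is_gr_quotient C W n X q"
  shows "q \<in> Arr C" "Dom C q = Dom C (W n X)" "is_epi C q"
    and "\<And>x. x \<in> Fob F (Dom C (W n X)) \<Longrightarrow> Farr F q x = 0 \<longleftrightarrow> Farr F (W n X) x \<in> W_fibre (n - 1) X"
proof -
  obtain w where w: "w \<in> Mor C (Dom C (W (n - 1) X)) (Dom C (W n X))" "W n X \<cdot> w = W (n - 1) X"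
    and c: "is_cokernel C q w" using q unfolding is_gr_quotient_def by blast
  have wA: "w \<in> Arr C" "Dom C w = Dom C (W (n - 1) X)" "Cod C w = Dom C (W n X)" using w by (auto simp: Mor_def)
  show qA: "q \<in> Arr C" "Dom C q = Dom C (W n X)" using c wA by (auto simp: is_cokernel_def Mor_def)
  show qe: "is_epi C q" using is_cokernel_is_epi[OF c] .
  have Ww: "Farr F (W n X) (Farr F w x) = Farr F (W (n - 1) X) x" if "x \<in> Fob F (Dom C (W (n - 1) X))" for x
    using Farr_comp[of w "W n X" x] that wA W_typing[OF X, of n] unfolding w(2) by simp
  have "is_mono C w"
  proof (rule inj0_mono[OF wA(1)])
    fix x assume "x \<in> Fob F (Dom C w)" "Farr F w x = 0"
    then show "x = 0"
      using Ww[of x] wA mono_inj0[OF W_mono[OF X, of "n - 1"], of x] W_typing[OF X] by simp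
  qed
  then obtain q' where q': "short_exact C w q'" using mono_short_exact by blast
  have q'A: "q' \<in> Arr C" "Dom C q' = Dom C (W n X)" using short_exactD[OF q'] wA by auto
  have "q' \<cdot> w = Zero C (Dom C w) (Cod C q')" using q' by (simp add: short_exact_def is_cokernel_def)
  then obtain t where t: "t \<in> Mor C (Cod C q) (Cod C q')" "t \<cdot> q = q'"
    by (rule cokernel_factor[OF c, rotated]) (use q'A wA in \<open>auto simp: Mor_def\<close>)
  have tA: "t \<in> Arr C" "Dom C t = Cod C q" using t by (auto simp: Mor_def)
  have qw: "q \<cdot> w = Zero C (Dom C w) (Cod C q)" using c by (simp add: is_cokernel_def)
  show "Farr F q x = 0 \<longleftrightarrow> Farr F (W n X) x \<in> W_fibre (n - 1) X" if x: "x \<in> Fob F (Dom C (W n X))" for x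
  proof
    assume "Farr F q x = 0"
    then have "Farr F q' x = 0" using Farr_comp[of q t x] x qA tA t(2) by simp
    then have "x \<in> Farr F w ` Fob F (Dom C w)" using Farr_exact[OF q'] x wA by auto
    then obtain y where y: "y \<in> Fob F (Dom C (W (n - 1) X))" "x = Farr F w y" using wA by auto
    then show "Farr F (W n X) x \<in> W_fibre (n - 1) X" using Ww by (auto simp: W_fibre_def)
  next
    assume "Farr F (W n X) x \<in> W_fibre (n - 1) X"
    then obtain y where y: "y \<in> Fob F (Dom C (W (n - 1) X))" "Farr F (W (n - 1) X) y = Farr F (W n X) x"
      by (rule W_fibreE)
    have "x = Farr F w y"
      using mono_inj[OF W_mono[OF X, of n], of x "Farr F w y"] x y Ww wA by simp
    then show "Farr F q x = 0"
      using Farr_comp[of w q y] y wA qA Cod_in_Ob[OF qA(1)] W_typing(3)[OF X] unfolding qw by simp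
  qed
qed

lemma W_fibre_not_weight:
  assumes X: "X \<in> Ob C" and n: "n \<notin> weights C W X" and x: "x \<in> W_fibre n X"
  shows "x \<in> W_fibre (n - 1) X"
proof -
  obtain q where q: "is_gr_quotient C W n X q" using W_step[OF X, of n] by blast
  note Q = gr_quotient_fibre[OF X q]
  have "zero_obj C (Cod C q)" using n q unfolding weights_def by blast
  then have "Fob F (Cod C q) = {0}" using zero_obj_iff[OF Cod_in_Ob[OF Q(1)]] by simp
  then have z: "Farr F q y = 0" if "y \<in> Fob F (Dom C q)" for y using Farr_in[OF Q(1) refl that] by simp
  obtain y where y: "y \<in> Fob F (Dom C (W n X))" "Farr F (W n X) y = x" using x by (rule W_fibreE)
  then show ?thesis using Q(4)[OF y(1)] z Q(2) by simp
qed

text \<open>Each \<open>n\<close> fails to be a weight of \<open>A\<close> or of \<open>B\<close>, so \<open>W\<^sub>n = W\<^sub>n\<^sub>-\<^sub>1\<close> holds on \<open>A'\<close> or on \<open>B'\<close>, and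
  \<open>f\<close> lowers weights.\<close>
lemma no_hom_disjoint_weights:
  assumes A: "A \<in> Ob C" and B: "B \<in> Ob C" and disj: "weights C W A \<inter> weights C W B = {}"
    and m: "m \<in> Mor C A' A" "is_mono C m" and e: "e \<in> Mor C B B'" "is_epi C e" and f: "f \<in> Mor C A' B'"
  shows "f = Zero C A' B'"
proof (rule weight_lowering_zero[OF f])
  fix n x assume x: "x \<in> W_fibre n A'"
  have xA: "x \<in> Fob F A'" using W_fibre_in x Mor_Ob[OF f] by blast
  show "Farr F f x \<in> W_fibre (n - 1) B'"
  proof (cases "n \<in> weights C W A")
    case False
    have "Farr F m x \<in> W_fibre (n - 1) A" by (rule W_fibre_not_weight[OF A False W_fibre_functorial[OF m(1) x]])
    then have "x \<in> W_fibre (n - 1) A'" by (rule W_fibre_sub[OF m xA])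
    then show ?thesis by (rule W_fibre_functorial[OF f])
  next
    case True
    then have nB: "n \<notin> weights C W B" using disj by blast
    obtain y where y: "y \<in> W_fibre n B" "Farr F e y = Farr F f x"
      using W_fibre_quotient[OF e W_fibre_functorial[OF f x]] .
    then show ?thesis using W_fibre_functorial[OF e(1) W_fibre_not_weight[OF B nB y(1)]] by simp
  qed
qed

text \<open>The arrow induced on the \<open>n\<close>-th graded pieces, described on fibres without naming the arrow that
  \<open>f\<close> induces on the \<open>n\<close>-th steps: \<open>y\<close> is the image of \<open>x\<close> under it.\<close>
definition is_gr_map :: "int \<Rightarrow> 'o \<Rightarrow> 'o \<Rightarrow> 'm \<Rightarrow> 'm \<Rightarrow> 'm \<Rightarrow> 'm \<Rightarrow> bool" where
  "is_gr_map n X Y f qX qY g \<longleftrightarrow> f \<in> Mor C X Y \<and> is_gr_quotient C W n X qX \<and> is_gr_quotient C W n Y qY \<and>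
     g \<in> Mor C (Cod C qX) (Cod C qY) \<and>
     (\<forall>x \<in> Fob F (Dom C (W n X)). \<forall>y \<in> Fob F (Dom C (W n Y)).
        Farr F (W n Y) y = Farr F f (Farr F (W n X) x) \<longrightarrow> Farr F g (Farr F qX x) = Farr F qY y)"

lemma ex_gr_map:
  assumes f: "f \<in> Mor C X Y" and qX: "is_gr_quotient C W n X qX" and qY: "is_gr_quotient C W n Y qY"
  obtains g where "is_gr_map n X Y f qX qY g"
proof -
  have O: "X \<in> Ob C" "Y \<in> Ob C" using Mor_Ob[OF f] by auto
  note QX = gr_quotient_fibre[OF O(1) qX] and QY = gr_quotient_fibre[OF O(2) qY]
  obtain f' where f': "f' \<in> Mor C (Dom C (W n X)) (Dom C (W n Y))"
    "\<And>x. x \<in> Fob F (Dom C (W n X)) \<Longrightarrow> Farr F (W n Y) (Farr F f' x) = Farr F f (Farr F (W n X) x)"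
    using W_arrow[OF f] by metis
  have f'A: "f' \<in> Arr C" "Dom C f' = Dom C (W n X)" "Cod C f' = Dom C (W n Y)" using f' by (auto simp: Mor_def)
  have M: "qY \<cdot> f' \<in> Mor C (Dom C qX) (Cod C qY)" using QX QY f'A by (simp add: Mor_def)
  have z: "Farr F (qY \<cdot> f') x = 0" if x: "x \<in> Fob F (Dom C qX)" "Farr F qX x = 0" for x
  proof -
    have x': "x \<in> Fob F (Dom C (W n X))" using x QX by simp
    have "Farr F (W n X) x \<in> W_fibre (n - 1) X" using QX(4)[OF x'] x by simp
    then have "Farr F (W n Y) (Farr F f' x) \<in> W_fibre (n - 1) Y" using W_fibre_functorial[OF f] f'(2)[OF x'] by simp
    then have "Farr F qY (Farr F f' x) = 0" using QY(4)[OF end_in[OF f'(1) x']] by simp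
    then show ?thesis using x' f'A QY by simp
  qed
  obtain g where g: "g \<in> Mor C (Cod C qX) (Cod C qY)" "g \<cdot> qX = qY \<cdot> f'"
    using factor_through_epi[OF QX(3) M z] by blast
  have gA: "g \<in> Arr C" "Dom C g = Cod C qX" using g by (auto simp: Mor_def)
  have "Farr F g (Farr F qX x) = Farr F qY y"
    if x: "x \<in> Fob F (Dom C (W n X))" and y: "y \<in> Fob F (Dom C (W n Y))"
      and e: "Farr F (W n Y) y = Farr F f (Farr F (W n X) x)" for x y
  proof -
    have "y = Farr F f' x"
      using mono_inj[OF W_mono[OF O(2), of n], of y "Farr F f' x"] y e f'(2)[OF x] end_in[OF f'(1) x] by simp
    then show ?thesis using Farr_comp[of qX g x] Farr_comp[of f' qY x] g(2) gA QX QY f'A x by simp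
  qed
  then show thesis using that[of g] f qX qY g(1) unfolding is_gr_map_def by blast
qed

lemma gr_mapE:
  assumes g: "is_gr_map n X Y f qX qY g" and z: "z \<in> Fob F (Cod C qX)"
  obtains x y where "x \<in> Fob F (Dom C (W n X))" "Farr F qX x = z" "y \<in> Fob F (Dom C (W n Y))"
    "Farr F (W n Y) y = Farr F f (Farr F (W n X) x)" "Farr F g z = Farr F qY y"
proof -
  have f: "f \<in> Mor C X Y" and qX: "is_gr_quotient C W n X qX" using g by (auto simp: is_gr_map_def)
  have O: "X \<in> Ob C" using Mor_Ob[OF f] by simp
  note QX = gr_quotient_fibre[OF O qX]
  obtain x where x: "x \<in> Fob F (Dom C (W n X))" "Farr F qX x = z" using epi_surj[OF QX(3) z] QX(2) by metis
  have "Farr F (W n X) x \<in> W_fibre n X" using x by (auto simp: W_fibre_def)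
  from W_fibre_functorial[OF f this] obtain y where y: "y \<in> Fob F (Dom C (W n Y))"
    "Farr F (W n Y) y = Farr F f (Farr F (W n X) x)" by (rule W_fibreE)
  then have "Farr F g z = Farr F qY y" using g x unfolding is_gr_map_def by blast
  then show thesis using that x y by blast
qed

lemma gr_map_mono:
  assumes g: "is_gr_map n X Y f qX qY g" and f: "is_mono C f"
  shows "is_mono C g"
proof (rule inj0_mono)
  have fM: "f \<in> Mor C X Y" and qX: "is_gr_quotient C W n X qX" and qY: "is_gr_quotient C W n Y qY"
    and gM: "g \<in> Mor C (Cod C qX) (Cod C qY)" using g by (auto simp: is_gr_map_def)
  have O: "X \<in> Ob C" "Y \<in> Ob C" using Mor_Ob[OF fM] by auto
  note QX = gr_quotient_fibre[OF O(1) qX] and QY = gr_quotient_fibre[OF O(2) qY]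
  show "g \<in> Arr C" using gM by (simp add: Mor_def)
  fix z assume z: "z \<in> Fob F (Dom C g)" "Farr F g z = 0"
  then have "z \<in> Fob F (Cod C qX)" using gM by (simp add: Mor_def)
  then obtain x y where xy: "x \<in> Fob F (Dom C (W n X))" "Farr F qX x = z" "y \<in> Fob F (Dom C (W n Y))"
    "Farr F (W n Y) y = Farr F f (Farr F (W n X) x)" "Farr F g z = Farr F qY y" by (rule gr_mapE[OF g])
  have "Farr F f (Farr F (W n X) x) \<in> W_fibre (n - 1) Y" using QY(4)[OF xy(3)] xy z by simp
  then have "Farr F (W n X) x \<in> W_fibre (n - 1) X"
    by (rule W_fibre_sub[OF fM f, rotated]) (use xy W_typing[OF O(1)] in simp)
  then show "z = 0" using QX(4)[OF xy(1)] xy by simp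
qed

lemma gr_map_epi:
  assumes g: "is_gr_map n X Y f qX qY g" and f: "is_epi C f"
  shows "is_epi C g"
proof (rule surj_epi)
  have fM: "f \<in> Mor C X Y" and qX: "is_gr_quotient C W n X qX" and qY: "is_gr_quotient C W n Y qY"
    and gM: "g \<in> Mor C (Cod C qX) (Cod C qY)" using g by (auto simp: is_gr_map_def)
  have O: "X \<in> Ob C" "Y \<in> Ob C" using Mor_Ob[OF fM] by auto
  note QX = gr_quotient_fibre[OF O(1) qX] and QY = gr_quotient_fibre[OF O(2) qY]
  have gA: "g \<in> Arr C" "Dom C g = Cod C qX" "Cod C g = Cod C qY" using gM by (auto simp: Mor_def)
  show "g \<in> Arr C" by (rule gA)
  fix z assume "z \<in> Fob F (Cod C g)"
  then have "z \<in> Fob F (Cod C qY)" using gA by simp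
  then obtain y where "y \<in> Fob F (Dom C qY)" "Farr F qY y = z" by (rule epi_surj[OF QY(3)])
  then have y: "y \<in> Fob F (Dom C (W n Y))" "Farr F qY y = z" using QY by auto
  have "Farr F (W n Y) y \<in> W_fibre n Y" using y by (auto simp: W_fibre_def)
  then obtain v where v: "v \<in> W_fibre n X" "Farr F f v = Farr F (W n Y) y" by (rule W_fibre_quotient[OF fM f])
  obtain x where x: "x \<in> Fob F (Dom C (W n X))" "Farr F (W n X) x = v" using v(1) by (rule W_fibreE)
  have "Farr F g (Farr F qX x) = z" using g x y v(2) unfolding is_gr_map_def by metis
  moreover have "Farr F qX x \<in> Fob F (Dom C g)" using x QX gA by simp
  ultimately show "\<exists>x \<in> Fob F (Dom C g). Farr F g x = z" by blast
qed

lemma gr_map_zero: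
  assumes g: "is_gr_map n X Y f qX qY g" and z: "\<And>z. z \<in> Fob F (Cod C qX) \<Longrightarrow> Farr F g z = 0"
    and x: "x \<in> W_fibre n X"
  shows "Farr F f x \<in> W_fibre (n - 1) Y"
proof -
  have fM: "f \<in> Mor C X Y" and qX: "is_gr_quotient C W n X qX" and qY: "is_gr_quotient C W n Y qY"
    using g by (auto simp: is_gr_map_def)
  have O: "X \<in> Ob C" "Y \<in> Ob C" using Mor_Ob[OF fM] by auto
  note QX = gr_quotient_fibre[OF O(1) qX] and QY = gr_quotient_fibre[OF O(2) qY]
  obtain x' where x': "x' \<in> Fob F (Dom C (W n X))" "Farr F (W n X) x' = x" using x by (rule W_fibreE)
  obtain y where y: "y \<in> Fob F (Dom C (W n Y))" "Farr F (W n Y) y = Farr F f x"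
    using W_fibre_functorial[OF fM x] by (rule W_fibreE)
  have "Farr F qY y = Farr F g (Farr F qX x')" using g x' y unfolding is_gr_map_def by metis
  also have "\<dots> = 0" by (rule z) (use x' QX in simp)
  finally show ?thesis using QY(4)[OF y(1)] y(2) by simp
qed

text \<open>Graded pieces of subobjects of \<open>A\<close> are direct summands of those of \<open>A\<close>, and graded pieces of
  quotients of \<open>B\<close> are direct summands of those of \<open>B\<close>; so a nonzero arrow between them would give
  a nonzero arrow from the associated graded of \<open>A\<close> to that of \<open>B\<close>.\<close>
lemma no_hom_semisimple_graded:
  assumes i: "i \<in> Mor C B E" "is_mono C i" and p: "p \<in> Mor C E A" "is_epi C p"
    and GA: "is_associated_graded C W A GrA" and GB: "is_associated_graded C W B GrB"
    and GE: "is_associated_graded C W E GrE" and ss: "semisimple_obj C GrE"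
    and hom0: "\<And>f. f \<in> Mor C GrA GrB \<Longrightarrow> f = Zero C GrA GrB"
    and m: "m \<in> Mor C A' A" "is_mono C m" and e: "e \<in> Mor C B B'" "is_epi C e" and f: "f \<in> Mor C A' B'"
  shows "f = Zero C A' B'"
proof (rule weight_lowering_zero[OF f])
  fix n x assume x: "x \<in> W_fibre n A'"
  have O: "A' \<in> Ob C" "B' \<in> Ob C" using Mor_Ob[OF f] by auto
  obtain qA uA where qA: "\<And>n. is_gr_quotient C W n A (qA n)" and uA: "is_coproduct C UNIV (\<lambda>n. Cod C (qA n)) uA GrA"
    using GA unfolding is_associated_graded_def by blast
  obtain qB uB where qB: "\<And>n. is_gr_quotient C W n B (qB n)" and uB: "is_coproduct C UNIV (\<lambda>n. Cod C (qB n)) uB GrB"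
    using GB unfolding is_associated_graded_def by blast
  obtain qE uE where qE: "\<And>n. is_gr_quotient C W n E (qE n)" and uE: "is_coproduct C UNIV (\<lambda>n. Cod C (qE n)) uE GrE"
    using GE unfolding is_associated_graded_def by blast
  obtain qA' where qA': "is_gr_quotient C W n A' qA'" using W_step[OF O(1), of n] by blast
  obtain qB' where qB': "is_gr_quotient C W n B' qB'" using W_step[OF O(2), of n] by blast
  obtain g where g: "is_gr_map n A' B' f qA' qB' g" using ex_gr_map[OF f qA' qB'] .
  obtain gi where gi: "is_gr_map n B E i (qB n) (qE n) gi" using ex_gr_map[OF i(1) qB qE] .
  obtain gp where gp: "is_gr_map n E A p (qE n) (qA n) gp" using ex_gr_map[OF p(1) qE qA] .
  obtain gm where gm: "is_gr_map n A' A m qA' (qA n) gm" using ex_gr_map[OF m(1) qA' qA] .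
  obtain ge where ge: "is_gr_map n B B' e (qB n) qB' ge" using ex_gr_map[OF e(1) qB qB'] .
  have M: "g \<in> Mor C (Cod C qA') (Cod C qB')" "gi \<in> Mor C (Cod C (qB n)) (Cod C (qE n))"
    "gp \<in> Mor C (Cod C (qE n)) (Cod C (qA n))" "gm \<in> Mor C (Cod C qA') (Cod C (qA n))"
    "ge \<in> Mor C (Cod C (qB n)) (Cod C qB')"
    using g gi gp gm ge unfolding is_gr_map_def by auto
  have split_mono: "is_mono C u" if u: "u \<in> Mor C Q G" and \<pi>: "\<pi> \<in> Mor C G Q" "\<And>x. x \<in> Fob F Q \<Longrightarrow> Farr F \<pi> (Farr F u x) = x"
    for u Q G \<pi>
  proof (rule inj0_mono)
    show "u \<in> Arr C" using u by (simp add: Mor_def)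
    show "x = 0" if "x \<in> Fob F (Dom C u)" "Farr F u x = 0" for x
      using \<pi>(2)[of x] \<pi>(1) that u by (simp add: Mor_def)
  qed
  obtain \<pi>E where \<pi>E: "\<pi>E \<in> Mor C GrE (Cod C (qE n))" "\<And>x. x \<in> Fob F (Cod C (qE n)) \<Longrightarrow> Farr F \<pi>E (Farr F (uE n) x) = x"
    using coproduct_projection[OF uE, of n] by auto
  obtain \<pi>A where \<pi>A: "\<pi>A \<in> Mor C GrA (Cod C (qA n))" "\<And>x. x \<in> Fob F (Cod C (qA n)) \<Longrightarrow> Farr F \<pi>A (Farr F (uA n) x) = x"
    using coproduct_projection[OF uA, of n] by auto
  obtain \<pi>B where \<pi>B: "\<pi>B \<in> Mor C GrB (Cod C (qB n))" "\<And>x. x \<in> Fob F (Cod C (qB n)) \<Longrightarrow> Farr F \<pi>B (Farr F (uB n) x) = x"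
    using coproduct_projection[OF uB, of n] by auto
  have U: "uE n \<in> Mor C (Cod C (qE n)) GrE" "uA n \<in> Mor C (Cod C (qA n)) GrA" "uB n \<in> Mor C (Cod C (qB n)) GrB"
    using uE uA uB by (auto simp: is_coproduct_def)
  have sE: "monos_split (Cod C (qE n))"
    by (rule monos_split_sub[OF semisimple_monos_split[OF ss] U(1) split_mono[OF U(1) \<pi>E]])
  have sA: "monos_split (Cod C (qA n))" by (rule monos_split_quotient[OF sE M(3) gr_map_epi[OF gp p(2)]])
  have sB: "monos_split (Cod C (qB n))" by (rule monos_split_sub[OF sE M(2) gr_map_mono[OF gi i(2)]])
  have A: "Dom C gm = Cod C qA'" "Cod C gm = Cod C (qA n)" using M by (auto simp: Mor_def)
  obtain r where r: "r \<in> Mor C (Cod C (qA n)) (Cod C qA')" "\<And>x. x \<in> Fob F (Cod C qA') \<Longrightarrow> Farr F r (Farr F gm x) = x"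
    using sA gr_map_mono[OF gm m(2)] A unfolding monos_split_def by metis
  obtain s where s: "s \<in> Mor C (Cod C qB') (Cod C (qB n))" "\<And>y. y \<in> Fob F (Cod C qB') \<Longrightarrow> Farr F ge (Farr F s y) = y"
    using monos_split_section[OF sB M(5) gr_map_epi[OF ge e(2)]] by blast
  define h where "h = uB n \<cdot> s \<cdot> g \<cdot> r \<cdot> \<pi>A"
  have hM: "h \<in> Mor C GrA GrB" using U M r s \<pi>A by (simp add: h_def Mor_def)
  have "Farr F g z = 0" if z: "z \<in> Fob F (Cod C qA')" for z
  proof -
    have gz: "Farr F g z \<in> Fob F (Cod C qB')" using M z by simp
    have gmz: "Farr F gm z \<in> Fob F (Cod C (qA n))" using M z by simp
    have "Farr F h (Farr F (uA n) (Farr F gm z)) = Farr F (uB n) (Farr F s (Farr F g z))"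
      using gmz U M(1) r s(1) \<pi>A z by (simp add: h_def Mor_def)
    moreover have "Farr F h (Farr F (uA n) (Farr F gm z)) = 0"
      unfolding hom0[OF hM] using gmz U Mor_Ob[OF hM] by (simp add: Mor_def)
    ultimately have "Farr F (uB n) (Farr F s (Farr F g z)) = 0" by simp
    then have "Farr F \<pi>B (Farr F (uB n) (Farr F s (Farr F g z))) = 0" using \<pi>B by (simp add: Mor_def)
    then have "Farr F s (Farr F g z) = 0" using \<pi>B(2)[OF end_in[OF s(1) gz]] by simp
    then show ?thesis using s(2)[OF gz] M by (simp add: Mor_def)
  qed
  then show "Farr F f x \<in> W_fibre (n - 1) B'" by (rule gr_map_zero[OF g _ x])
qed

end

section \<open>The theorem\<close>

theorem theorem1p2:
  fixes T :: "('o, 'm, 'k::field_char_0) tensor_category"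
    and F :: "('o, 'm, 'k, 'v::ab_group_add) fibre_functor"
    and W :: "int \<Rightarrow> 'o \<Rightarrow> 'm"
  assumes "neutral_tannakian T F"
    and "weight_filtration T W"
    and "A \<in> Ob T" and "\<not> zero_obj T A"
    and "B \<in> Ob T" and "\<not> zero_obj T B"
    and "i \<in> Mor T B E" and "p \<in> Mor T E A" and "short_exact T i p"
    and "is_associated_graded T W A GrA"
    and "is_associated_graded T W B GrB"
    and "is_associated_graded T W E GrE"
    and "(semisimple_obj T GrE \<and> (\<forall>f \<in> Mor T GrA GrB. f = Zero T GrA GrB))
         \<or> weights T W A \<inter> weights T W B = {}"
    and "is_ihom T A B HAB ev"
    and "\<E> = ext_to_unit T A B HAB ev (ext_class T A B i p)"
    and "totally_nonsplit T HAB \<E>"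
  shows "Omega T i p ` End_sub T i = {(a \<star>\<^bsub>T\<^esub> Ide T B, a \<star>\<^bsub>T\<^esub> Ide T A) | a :: 'k. True}"
proof -
  interpret filtered_tannakian T F W
    using assms(1,2) by (rule filtered_tannakian.intro)
  have ip: "is_mono T i" "is_epi T p" using short_exactD[OF assms(9)] by auto
  have no_hom: "f = Zero T A' B'"
    if "m \<in> Mor T A' A" "is_mono T m" "e \<in> Mor T B B'" "is_epi T e" "f \<in> Mor T A' B'" for m A' e B' f
    using assms(13)
  proof
    assume ss: "semisimple_obj T GrE \<and> (\<forall>f \<in> Mor T GrA GrB. f = Zero T GrA GrB)"
    show ?thesis
      by (rule no_hom_semisimple_graded[OF assms(7) ip(1) assms(8) ip(2) assms(10-12) _ _ that]) (use ss in auto)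
  next
    assume "weights T W A \<inter> weights T W B = {}"
    then show ?thesis by (rule no_hom_disjoint_weights[OF assms(3,5) _ that])
  qed
  obtain X k q \<rho> where kq: "(k, q) \<in> \<E>" and rep: "k \<in> Mor T HAB X" "q \<in> Mor T X (Unit T)" "short_exact T k q"
    "\<rho> \<in> Mor T (X \<otimes>\<^sub>o\<^bsub>T\<^esub> A) E" "\<rho> \<cdot>\<^bsub>T\<^esub> (k \<otimes>\<^sub>m\<^bsub>T\<^esub> Ide T A) = i \<cdot>\<^bsub>T\<^esub> ev"
    "p \<cdot>\<^bsub>T\<^esub> \<rho> = LUnit T A \<cdot>\<^bsub>T\<^esub> (q \<otimes>\<^sub>m\<^bsub>T\<^esub> Ide T A)"
    unfolding assms(15) by (rule ext_to_unit_representative[OF assms(3,5,7,8,9,14)])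
  interpret transferred_extension T F A B E i p HAB ev X k q \<rho>
  proof unfold_locales
    show "zero_obj T I" if "\<sigma> \<in> Mor T HAB I" "is_epi T \<sigma>" "r \<in> Mor T X I" "r \<cdot>\<^bsub>T\<^esub> k = \<sigma>" for \<sigma> I r
      by (rule totally_nonsplit_extends[OF assms(16) kq rep(3,1,2) that])
  qed (use assms rep no_hom in blast)+
  show ?thesis by (rule Omega_image)
qed

end
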